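(* Let $k>0$ and $l\neq 0$ be coprime integers. The algebra $\mathcal{O}(S^2_{pq}(k,l^+))$ (if $l>0$), respectively $\mathcal{O}(S^2_{pq}(k,l^-))$ (if $l<0$), is a degree one generalised Weyl algebra.
   Context: Fix real numbers $0<p,q,\theta<1$ with $\theta$ irrational. $\mathcal{O}(S^3_{pq\theta})$ is the unital complex $*$-algebra generated by $a,b$ subject to $$ab=e^{2\pi i\theta}ba,\quad ab^*=e^{-2\pi i\theta}b^*a,\quad a^*a-paa^*=1-p,\quad b^*b-qbb^*=1-q,\quad (1-aa^* )(1-bb^* )=0.$$ $\mathcal{O}(U(1))=\mathbb{C}[u,u^*]$ with $uu^*=u^*u=1$ is the Hopf $*$-algebra with $\Delta(u)=u\otimes u$. For coprime integers $k>0$, $l\ne 0$, let $\phi_{k,l}:\mathcal{O}(S^3_{pq\theta})\to\mathcal{O}(S^3_{pq\theta})\otimes\mathcal{O}(U(1))$ be the $*$-algebra map with $a\mapsto a\otimes u^k$, $b\mapsto b\otimes u^l$. The coordinate algebra of the quantum weighted Heegaard sphere is the fixed point algebra $\{x\in\mathcal{O}(S^3_{pq\theta}):\phi_{k,l}(x)=x\otimes 1\}$; it is denoted $\mathcal{O}(S^2_{pq}(k,l^+))$ if $l>0$ and $\mathcal{O}(S^2_{pq}(k,l^-))$ if $l<0$. Generalised Weyl algebra of degree one: let $\mathcal{D}$ be a ring, $\sigma$ an automorphism of $\mathcal{D}$ and $\tilde a$ a non-zero element of the centre of $\mathcal{D}$. The degree one generalised Weyl algebra $\mathcal{D}(\sigma,\tilde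 a)$ is the ring generated by $\mathcal{D}$ and two indeterminates $X^+,X^-$ subject to the relations, for all $\alpha\in\mathcal{D}$, $$X^-X^+=\tilde a,\qquad X^+X^-=\sigma(\tilde a),\qquad X^{\pm}\alpha=\sigma^{\pm1}(\alpha)X^{\pm}.$$ *)

theory Defs
  imports Complex_Main "HOL-Library.Poly_Mapping" "HOL-Algebra.QuotRing" "HOL-Algebra.Module"
begin

section \<open>Algebras given by generators and relations\<close>

text \<open>The monoid ring over a commutative coefficient ring: finitely supported functions on the
  monoid with the convolution product. For the monoid of words in an alphabet this is the free
  ring (coefficients \<^typ>\<open>int\<close>) or the free complex algebra (coefficients \<^typ>\<open>complex\<close>).\<close>

definition monoid_ring_mult ::
  "('w, 'm) monoid_scheme \<Rightarrow> ('w \<Rightarrow>\<^sub>0 'c::comm_ring_1) \<Rightarrow> ('w \<Rightarrow>\<^sub>0 'c) \<Rightarrow> ('w \<Rightarrow>\<^sub>0 'c)" where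
  "monoid_ring_mult G f g =
     (\<Sum>v\<in>Poly_Mapping.keys f. \<Sum>w\<in>Poly_Mapping.keys g.
        Poly_Mapping.single (v \<otimes>\<^bsub>G\<^esub> w) (Poly_Mapping.lookup f v * Poly_Mapping.lookup g w))"

definition monoid_ring :: "('w, 'm) monoid_scheme \<Rightarrow> ('w \<Rightarrow>\<^sub>0 'c::comm_ring_1) ring" where
  "monoid_ring G =
     \<lparr>carrier = {f. Poly_Mapping.keys f \<subseteq> carrier G},
      mult = monoid_ring_mult G,
      one = Poly_Mapping.single \<one>\<^bsub>G\<^esub> 1,
      zero = 0,
      add = (+)\<rparr>"

definition words :: "'x set \<Rightarrow> 'x list monoid" where
  "words X = \<lparr>carrier = lists X, mult = (@), one = []\<rparr>"

record 'a star_algebra = "(complex, 'a) module" +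
  star :: "'a \<Rightarrow> 'a"

text \<open>The complex monoid algebra, with the antilinear star operation extending a map
  \<open>s\<close> (an anti-multiplicative involution) of the monoid.\<close>

definition star_monoid_algebra ::
  "('w, 'm) monoid_scheme \<Rightarrow> ('w \<Rightarrow> 'w) \<Rightarrow> ('w \<Rightarrow>\<^sub>0 complex) star_algebra" where
  "star_monoid_algebra G s =
     \<lparr>carrier = carrier (monoid_ring G :: ('w \<Rightarrow>\<^sub>0 complex) ring),
      mult = monoid.mult (monoid_ring G),
      one = monoid.one (monoid_ring G),
      zero = ring.zero (monoid_ring G),
      add = ring.add (monoid_ring G),
      smult = (\<lambda>c. Poly_Mapping.map ((*) c)),
      star = (\<lambda>f. \<Sum>w\<in>Poly_Mapping.keys f.
                Poly_Mapping.single (s w) (cnj (Poly_Mapping.lookup f w)))\<rparr>"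

text \<open>The quotient by a two-sided star-closed ideal; as for the library's \<^const>\<open>FactRing\<close>,
  the elements are the additive cosets of the ideal.\<close>

definition quotient_star_algebra ::
  "('a, 'm) star_algebra_scheme \<Rightarrow> 'a set \<Rightarrow> 'a set star_algebra" where
  "quotient_star_algebra A I =
     \<lparr>carrier = carrier (A Quot I),
      mult = monoid.mult (A Quot I),
      one = monoid.one (A Quot I),
      zero = ring.zero (A Quot I),
      add = ring.add (A Quot I),
      smult = (\<lambda>c U. \<Union>x\<in>U. I +>\<^bsub>A\<^esub> (c \<odot>\<^bsub>A\<^esub> x)),
      star = (\<lambda>U. \<Union>x\<in>U. I +>\<^bsub>A\<^esub> star A x)\<rparr>"

definition star_algebra_hom ::
  "('a, 'm) star_algebra_scheme \<Rightarrow> ('b, 'n) star_algebra_scheme \<Rightarrow> ('a \<Rightarrow> 'b) set" where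
  "star_algebra_hom A B =
     {h \<in> ring_hom A B. \<forall>x\<in>carrier A.
        (\<forall>c. h (c \<odot>\<^bsub>A\<^esub> x) = c \<odot>\<^bsub>B\<^esub> h x) \<and> h (star A x) = star B (h x)}"

text \<open>The free unital star-algebra on the elements of the type \<open>'g\<close>: the free algebra on the
  generators and their formal adjoints.\<close>

datatype 'g letter = Gen 'g | Adj 'g

primrec letter_adj :: "'g letter \<Rightarrow> 'g letter" where
  "letter_adj (Gen g) = Adj g"
| "letter_adj (Adj g) = Gen g"

type_synonym 'g star_poly = "'g letter list \<Rightarrow>\<^sub>0 complex"

definition free_star_algebra :: "'g star_poly star_algebra" where
  "free_star_algebra = star_monoid_algebra (words UNIV) (\<lambda>w. rev (map letter_adj w))"

definition free_gen :: "'g \<Rightarrow> 'g star_poly" where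
  "free_gen g = Poly_Mapping.single [Gen g] 1"

text \<open>A set \<open>R\<close> of relators \<open>r\<close> (standing for the relations \<open>r = 0\<close>) generates
  the star-ideal that is the two-sided ideal generated by the \<open>r\<close> and their adjoints.\<close>

definition relation_ideal :: "'g star_poly set \<Rightarrow> 'g star_poly set" where
  "relation_ideal R = Idl\<^bsub>free_star_algebra\<^esub> (R \<union> star free_star_algebra ` R)"

definition presented_star_algebra :: "'g star_poly set \<Rightarrow> 'g star_poly set star_algebra" where
  "presented_star_algebra R = quotient_star_algebra free_star_algebra (relation_ideal R)"

definition presented_gen :: "'g star_poly set \<Rightarrow> 'g \<Rightarrow> 'g star_poly set" where
  "presented_gen R g = relation_ideal R +>\<^bsub>free_star_algebra\<^esub> free_gen g"


section \<open>Tensor product of complex star-algebras\<close>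

text \<open>The free vector space on \<open>A \<times> B\<close> is an algebra under
  \<open>(x, y) (x', y') = (x x', y y')\<close> and has the star operation
  \<open>(x, y)\<^sup>* = (x\<^sup>*, y\<^sup>*)\<close>. The linear span of the bilinearity relators below is already a
  star-closed two-sided ideal, so dividing by the ideal they generate yields the usual
  tensor product over the complex numbers.\<close>

definition free_on_pairs ::
  "'a star_algebra \<Rightarrow> 'b star_algebra \<Rightarrow> ('a \<times> 'b \<Rightarrow>\<^sub>0 complex) star_algebra" where
  "free_on_pairs A B = star_monoid_algebra (A \<times>\<times> B) (\<lambda>(x, y). (star A x, star B y))"

definition bilinearity_relators ::
  "'a star_algebra \<Rightarrow> 'b star_algebra \<Rightarrow> ('a \<times> 'b \<Rightarrow>\<^sub>0 complex) set" where
  "bilinearity_relators A B =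
     (let pair = (\<lambda>x y. Poly_Mapping.single (x, y) (1::complex)) in
      {pair (x \<oplus>\<^bsub>A\<^esub> x') y - pair x y - pair x' y | x x' y.
         x \<in> carrier A \<and> x' \<in> carrier A \<and> y \<in> carrier B} \<union>
      {pair x (y \<oplus>\<^bsub>B\<^esub> y') - pair x y - pair x y' | x y y'.
         x \<in> carrier A \<and> y \<in> carrier B \<and> y' \<in> carrier B} \<union>
      {pair (c \<odot>\<^bsub>A\<^esub> x) y - Poly_Mapping.single (x, y) c | c x y.
         x \<in> carrier A \<and> y \<in> carrier B} \<union>
      {pair x (c \<odot>\<^bsub>B\<^esub> y) - Poly_Mapping.single (x, y) c | c x y.
         x \<in> carrier A \<and> y \<in> carrier B})"

definition tensor_ideal ::
  "'a star_algebra \<Rightarrow> 'b star_algebra \<Rightarrow> ('a \<times> 'b \<Rightarrow>\<^sub>0 complex) set" where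
  "tensor_ideal A B = Idl\<^bsub>free_on_pairs A B\<^esub> (bilinearity_relators A B)"

definition tensor_algebra ::
  "'a star_algebra \<Rightarrow> 'b star_algebra \<Rightarrow> ('a \<times> 'b \<Rightarrow>\<^sub>0 complex) set star_algebra" where
  "tensor_algebra A B = quotient_star_algebra (free_on_pairs A B) (tensor_ideal A B)"

definition pure_tensor ::
  "'a star_algebra \<Rightarrow> 'b star_algebra \<Rightarrow> 'a \<Rightarrow> 'b \<Rightarrow> ('a \<times> 'b \<Rightarrow>\<^sub>0 complex) set" where
  "pure_tensor A B x y =
     tensor_ideal A B +>\<^bsub>free_on_pairs A B\<^esub> Poly_Mapping.single (x, y) 1"


section \<open>Quantum weighted Heegaard spheres\<close>

datatype heegaard_gen = Ga | Gb

definition heegaard_relators :: "real \<Rightarrow> real \<Rightarrow> real \<Rightarrow> heegaard_gen star_poly set" where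
  "heegaard_relators p q \<theta> =
     (let F = free_star_algebra;
          a = free_gen Ga; b = free_gen Gb; a' = star F a; b' = star F b
      in {a \<otimes>\<^bsub>F\<^esub> b \<ominus>\<^bsub>F\<^esub> exp (2 * pi * \<i> * \<theta>) \<odot>\<^bsub>F\<^esub> (b \<otimes>\<^bsub>F\<^esub> a),
          a \<otimes>\<^bsub>F\<^esub> b' \<ominus>\<^bsub>F\<^esub> exp (- (2 * pi * \<i> * \<theta>)) \<odot>\<^bsub>F\<^esub> (b' \<otimes>\<^bsub>F\<^esub> a),
          (a' \<otimes>\<^bsub>F\<^esub> a \<ominus>\<^bsub>F\<^esub> p \<odot>\<^bsub>F\<^esub> (a \<otimes>\<^bsub>F\<^esub> a')) \<ominus>\<^bsub>F\<^esub> (1 - p) \<odot>\<^bsub>F\<^esub> \<one>\<^bsub>F\<^esub>,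
          (b' \<otimes>\<^bsub>F\<^esub> b \<ominus>\<^bsub>F\<^esub> q \<odot>\<^bsub>F\<^esub> (b \<otimes>\<^bsub>F\<^esub> b')) \<ominus>\<^bsub>F\<^esub> (1 - q) \<odot>\<^bsub>F\<^esub> \<one>\<^bsub>F\<^esub>,
          (\<one>\<^bsub>F\<^esub> \<ominus>\<^bsub>F\<^esub> a \<otimes>\<^bsub>F\<^esub> a') \<otimes>\<^bsub>F\<^esub> (\<one>\<^bsub>F\<^esub> \<ominus>\<^bsub>F\<^esub> b \<otimes>\<^bsub>F\<^esub> b')})"

definition O_S3 :: "real \<Rightarrow> real \<Rightarrow> real \<Rightarrow> heegaard_gen star_poly set star_algebra" where
  "O_S3 p q \<theta> = presented_star_algebra (heegaard_relators p q \<theta>)"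

definition S3_a :: "real \<Rightarrow> real \<Rightarrow> real \<Rightarrow> heegaard_gen star_poly set" where
  "S3_a p q \<theta> = presented_gen (heegaard_relators p q \<theta>) Ga"

definition S3_b :: "real \<Rightarrow> real \<Rightarrow> real \<Rightarrow> heegaard_gen star_poly set" where
  "S3_b p q \<theta> = presented_gen (heegaard_relators p q \<theta>) Gb"

definition unitary_relators :: "unit star_poly set" where
  "unitary_relators =
     (let F = free_star_algebra; u = free_gen (); u' = star F u
      in {u \<otimes>\<^bsub>F\<^esub> u' \<ominus>\<^bsub>F\<^esub> \<one>\<^bsub>F\<^esub>, u' \<otimes>\<^bsub>F\<^esub> u \<ominus>\<^bsub>F\<^esub> \<one>\<^bsub>F\<^esub>})"

definition O_U1 :: "unit star_poly set star_algebra" where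
  "O_U1 = presented_star_algebra unitary_relators"

definition U1_u :: "unit star_poly set" where
  "U1_u = presented_gen unitary_relators ()"

text \<open>The star-algebra map determined by \<open>a \<mapsto> a \<otimes> u\<^sup>k\<close>, \<open>b \<mapsto> b \<otimes> u\<^sup>l\<close>; extensionality only
  pins down the irrelevant values outside the carrier. The exponents are integers: negative
  powers are powers of the inverse of \<open>u\<close>.\<close>

definition coaction :: "real \<Rightarrow> real \<Rightarrow> real \<Rightarrow> int \<Rightarrow> int \<Rightarrow> heegaard_gen star_poly set
    \<Rightarrow> (heegaard_gen star_poly set \<times> unit star_poly set \<Rightarrow>\<^sub>0 complex) set" where
  "coaction p q \<theta> k l = (THE \<phi>.
     \<phi> \<in> star_algebra_hom (O_S3 p q \<theta>) (tensor_algebra (O_S3 p q \<theta>) O_U1) \<and>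
     \<phi> \<in> extensional (carrier (O_S3 p q \<theta>)) \<and>
     \<phi> (S3_a p q \<theta>) = pure_tensor (O_S3 p q \<theta>) O_U1 (S3_a p q \<theta>) (U1_u [^]\<^bsub>O_U1\<^esub> k) \<and>
     \<phi> (S3_b p q \<theta>) = pure_tensor (O_S3 p q \<theta>) O_U1 (S3_b p q \<theta>) (U1_u [^]\<^bsub>O_U1\<^esub> l))"

text \<open>This is the algebra of the sphere \<open>(k, l\<^sup>+)\<close> for \<open>l > 0\<close> and of the
  sphere \<open>(k, l\<^sup>-)\<close> for \<open>l < 0\<close>.\<close>

definition O_S2 ::
  "real \<Rightarrow> real \<Rightarrow> real \<Rightarrow> int \<Rightarrow> int \<Rightarrow> heegaard_gen star_poly set star_algebra" where
  "O_S2 p q \<theta> k l = (O_S3 p q \<theta>)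
     \<lparr>carrier := {x \<in> carrier (O_S3 p q \<theta>).
        coaction p q \<theta> k l x = pure_tensor (O_S3 p q \<theta>) O_U1 x \<one>\<^bsub>O_U1\<^esub>}\<rparr>"


section \<open>Generalised Weyl algebras of degree one\<close>

datatype 'd gwa_letter = Coeff 'd | XPlus | XMinus

type_synonym 'd gwa_poly = "'d gwa_letter list \<Rightarrow>\<^sub>0 int"

definition gwa_free :: "('d, 'm) ring_scheme \<Rightarrow> 'd gwa_poly ring" where
  "gwa_free D = monoid_ring (words (Coeff ` carrier D \<union> {XPlus, XMinus}))"

text \<open>The first three sets of relators make the generators \<open>Coeff d\<close> a
  homomorphic image of the ring \<open>D\<close>; the remaining ones are the defining relations.\<close>

definition gwa_relators ::
  "('d, 'm) ring_scheme \<Rightarrow> ('d \<Rightarrow> 'd) \<Rightarrow> 'd \<Rightarrow> 'd gwa_poly set" where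
  "gwa_relators D \<sigma> a =
     (let F = gwa_free D;
          \<iota> = (\<lambda>d. Poly_Mapping.single [Coeff d] 1);
          xp = Poly_Mapping.single [XPlus] 1;
          xm = Poly_Mapping.single [XMinus] 1;
          \<sigma>' = inv_into (carrier D) \<sigma>
      in {\<iota> \<one>\<^bsub>D\<^esub> \<ominus>\<^bsub>F\<^esub> \<one>\<^bsub>F\<^esub>} \<union>
         {\<iota> (c \<oplus>\<^bsub>D\<^esub> d) \<ominus>\<^bsub>F\<^esub> (\<iota> c \<oplus>\<^bsub>F\<^esub> \<iota> d) | c d. c \<in> carrier D \<and> d \<in> carrier D} \<union>
         {\<iota> (c \<otimes>\<^bsub>D\<^esub> d) \<ominus>\<^bsub>F\<^esub> \<iota> c \<otimes>\<^bsub>F\<^esub> \<iota> d | c d. c \<in> carrier D \<and> d \<in> carrier D} \<union>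
         {xm \<otimes>\<^bsub>F\<^esub> xp \<ominus>\<^bsub>F\<^esub> \<iota> a, xp \<otimes>\<^bsub>F\<^esub> xm \<ominus>\<^bsub>F\<^esub> \<iota> (\<sigma> a)} \<union>
         {xp \<otimes>\<^bsub>F\<^esub> \<iota> d \<ominus>\<^bsub>F\<^esub> \<iota> (\<sigma> d) \<otimes>\<^bsub>F\<^esub> xp | d. d \<in> carrier D} \<union>
         {xm \<otimes>\<^bsub>F\<^esub> \<iota> d \<ominus>\<^bsub>F\<^esub> \<iota> (\<sigma>' d) \<otimes>\<^bsub>F\<^esub> xm | d. d \<in> carrier D})"

definition gwa_ideal ::
  "('d, 'm) ring_scheme \<Rightarrow> ('d \<Rightarrow> 'd) \<Rightarrow> 'd \<Rightarrow> 'd gwa_poly set" where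
  "gwa_ideal D \<sigma> a = Idl\<^bsub>gwa_free D\<^esub> (gwa_relators D \<sigma> a)"

definition gwa :: "('d, 'm) ring_scheme \<Rightarrow> ('d \<Rightarrow> 'd) \<Rightarrow> 'd \<Rightarrow> 'd gwa_poly set ring" where
  "gwa D \<sigma> a = gwa_free D Quot gwa_ideal D \<sigma> a"

definition gwa_coeff ::
  "('d, 'm) ring_scheme \<Rightarrow> ('d \<Rightarrow> 'd) \<Rightarrow> 'd \<Rightarrow> 'd \<Rightarrow> 'd gwa_poly set" where
  "gwa_coeff D \<sigma> a d = gwa_ideal D \<sigma> a +>\<^bsub>gwa_free D\<^esub> Poly_Mapping.single [Coeff d] 1"

definition complex_field :: "complex ring" where
  "complex_field = \<lparr>carrier = UNIV, mult = (*), one = 1, zero = 0, add = (+)\<rparr>"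

text \<open>A unital associative complex algebra, not necessarily commutative; the library's locale
  of algebras covers commutative ones only.\<close>

definition complex_algebra :: "(complex, 'a, 'm) module_scheme \<Rightarrow> bool" where
  "complex_algebra A \<longleftrightarrow> ring A \<and> Module.module complex_field A \<and>
     (\<forall>c. \<forall>x\<in>carrier A. \<forall>y\<in>carrier A.
        (c \<odot>\<^bsub>A\<^esub> x) \<otimes>\<^bsub>A\<^esub> y = c \<odot>\<^bsub>A\<^esub> (x \<otimes>\<^bsub>A\<^esub> y) \<and>
        x \<otimes>\<^bsub>A\<^esub> (c \<odot>\<^bsub>A\<^esub> y) = c \<odot>\<^bsub>A\<^esub> (x \<otimes>\<^bsub>A\<^esub> y))"

text \<open>A complex algebra \<open>A\<close> is a degree one generalised Weyl algebra if, as an algebra, it is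
  isomorphic to \<open>D(\<sigma>, a)\<close> for a complex algebra \<open>D\<close> and a complex-linear automorphism \<open>\<sigma>\<close>;
  the scalars act on \<open>D(\<sigma>, a)\<close> through \<open>D\<close>, so a ring isomorphism is complex-linear if and
  only if it is so on \<open>D\<close>. Taking \<open>D\<close> on the element type of \<open>A\<close> is no restriction, because
  \<open>D\<close> embeds into \<open>D(\<sigma>, a)\<close>.\<close>

definition is_degree_one_gwa :: "(complex, 'a, 'm) module_scheme \<Rightarrow> bool" where
  "is_degree_one_gwa A \<longleftrightarrow> complex_algebra A \<and>
     (\<exists>(D :: (complex, 'a) module) \<sigma> a f.
        complex_algebra D \<and>
        \<sigma> \<in> ring_iso D D \<and> (\<forall>c. \<forall>d\<in>carrier D. \<sigma> (c \<odot>\<^bsub>D\<^esub> d) = c \<odot>\<^bsub>D\<^esub> \<sigma> d) \<and>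
        a \<in> carrier D \<and> a \<noteq> \<zero>\<^bsub>D\<^esub> \<and> (\<forall>d\<in>carrier D. a \<otimes>\<^bsub>D\<^esub> d = d \<otimes>\<^bsub>D\<^esub> a) \<and>
        f \<in> ring_iso (gwa D \<sigma> a) A \<and>
        (\<forall>c. \<forall>d\<in>carrier D. f (gwa_coeff D \<sigma> a (c \<odot>\<^bsub>D\<^esub> d)) = c \<odot>\<^bsub>A\<^esub> f (gwa_coeff D \<sigma> a d)))"

end

theory Submission
  imports Defs
begin

text \<open>Let \<open>R\<close> be the algebra of the quantum three-sphere, \<open>A = 1 - aa\<^sup>*\<close> and
  \<open>B = 1 - bb\<^sup>*\<close>, so that \<open>AB = BA = 0\<close>. Multiplying \<open>A\<close> or \<open>B\<close> past any of
  \<open>a, a\<^sup>*, b, b\<^sup>*\<close> only costs a non-zero scalar, products such as \<open>aa\<^sup>*\<close> and \<open>a\<^sup>*a\<close> are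
  polynomials in \<open>A\<close>, and the letters of \<open>a\<close> commute with those of \<open>b\<close> up to a phase. Hence,
  with \<open>D\<close> the commutative algebra spanned by the powers of \<open>A\<close> and of \<open>B\<close> and with
  negative powers read as powers of the adjoint, every word of bidegree \<open>(i, j)\<close> lies in
  \<open>D a\<^sup>i b\<^sup>j\<close> (\<open>normal_form\<close>), and \<open>R\<close> is the sum of these spaces.

  The sum is direct and \<open>d a\<^sup>i b\<^sup>j = 0\<close> forces \<open>d = 0\<close>. This is read off from a
  representation (\<open>rep\<close>) in which \<open>a\<close> and \<open>b\<close> shift two integer coordinates while \<open>A\<close> and
  \<open>B\<close> multiply by functions of a real parameter; every word moves a vacuum vector to the
  position given by its bidegree, with a coefficient that vanishes nowhere
  (\<open>rep_word_vac\<close>, \<open>graded_sum_eq_zero\<close>).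

  The coaction multiplies a word of bidegree \<open>(i, j)\<close> by \<open>u\<close> to the power \<open>ki + lj\<close>
  (\<open>coaction_word\<close>). Evaluating \<open>u\<close> at the number 2 shows that the fixed points are exactly
  the sums of parts with \<open>ki + lj = 0\<close> (\<open>fixed_expansion\<close>). As \<open>k\<close> and \<open>l\<close> are coprime,
  then \<open>(i, j) = s(l, -k)\<close>, and \<open>a\<^sup>i b\<^sup>j\<close> is a scalar multiple of a power of
  \<open>X\<^sup>+ = a\<^sup>l b\<^sup>-\<^sup>k\<close> or of \<open>X\<^sup>- = a\<^sup>-\<^sup>l b\<^sup>k\<close>. So the fixed point algebra is the direct sum
  of the free rank one \<open>D\<close>-modules on the powers of \<open>X\<^sup>+\<close> and of \<open>X\<^sup>-\<close>.

  The automorphism \<open>\<sigma>\<close> is determined by \<open>X\<^sup>+ d = \<sigma>(d) X\<^sup>+\<close>, and the central element is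
  \<open>X\<^sup>- X\<^sup>+ \<in> D\<close>; the remaining defining relations follow by cancellation, without an explicit
  formula for either of them. The generalised Weyl algebra therefore maps to the fixed point
  algebra. It is itself spanned over \<open>D\<close> by the powers of its two generators
  (\<open>gwa_span\<close>), and these go to linearly independent generators of the image, so the
  map is bijective (\<open>gwa_iso_exists\<close>).\<close>

section \<open>Monoid rings\<close>

abbreviation "single \<equiv> Poly_Mapping.single"
abbreviation "keys \<equiv> Poly_Mapping.keys"
abbreviation "lookup \<equiv> Poly_Mapping.lookup"
abbreviation "scale c \<equiv> Poly_Mapping.map ((*) (c :: 'c::comm_ring_1))"

lemma sum_singles_keys: "(\<Sum>w\<in>keys f. single w (lookup f w)) = f"
  by (rule poly_mapping_eqI)
     (auto simp: lookup_sum lookup_single when_def sum.delta[OF finite_keys] in_keys_iff)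

lemma carrier_monoid_ring: "carrier (monoid_ring G) = {f. keys f \<subseteq> carrier G}"
  by (simp add: monoid_ring_def)

lemma single_in_monoid_ring [simp]:
  "w \<in> carrier G \<Longrightarrow> single w c \<in> carrier (monoid_ring G)"
  by (simp add: carrier_monoid_ring)

lemma monoid_ring_induct [consumes 1, case_names zero single add]:
  assumes f: "f \<in> carrier (monoid_ring G)"
    and 0: "P 0"
    and 1: "\<And>w c. w \<in> carrier G \<Longrightarrow> P (single w c)"
    and 2: "\<And>f g. f \<in> carrier (monoid_ring G) \<Longrightarrow> g \<in> carrier (monoid_ring G) \<Longrightarrow> P f \<Longrightarrow> P g \<Longrightarrow> P (f + g)"
  shows "P f"
proof -
  have "(\<Sum>w\<in>S. single w (lookup f w)) \<in> carrier (monoid_ring G) \<and>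
        P (\<Sum>w\<in>S. single w (lookup f w))"
    if "finite S" "S \<subseteq> carrier G" for S
    using that
  proof (induction S)
    case empty
    show ?case using 0 by (simp add: carrier_monoid_ring)
  next
    case (insert w S)
    then show ?case using 1 2 keys_add
      by (auto simp: carrier_monoid_ring dest!: subsetD[OF keys_add] simp: split: if_splits)
  qed
  from this[of "keys f"] f show ?thesis
    by (simp add: sum_singles_keys carrier_monoid_ring)
qed

lemma poly_map_scale_add:
  "scale c (f + g) = scale c f + scale c g"
  by (rule poly_mapping_eqI) (auto simp: map.rep_eq lookup_add when_def simp flip: distrib_left)

lemma poly_map_scale_add_left:
  "scale (c + d) f = scale c f + scale d f"
  by (rule poly_mapping_eqI) (auto simp: map.rep_eq lookup_add when_def distrib_right)

lemma poly_map_scale_scale: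
  "scale c (scale d f) = scale (c * d) f"
  by (rule poly_mapping_eqI) (auto simp: map.rep_eq when_def mult.assoc)

lemma poly_map_scale_single [simp]:
  "scale c (single w d) = single w (c * d)"
  by (simp add: when_def)

lemma poly_map_scale_zero [simp]: "scale c 0 = 0"
  by (simp add: map_eq_zero_iff)

lemma poly_map_scale_closed:
  "f \<in> carrier (monoid_ring G) \<Longrightarrow> scale c f \<in> carrier (monoid_ring G)"
  by (auto simp: carrier_monoid_ring in_keys_iff map.rep_eq when_def split: if_splits)

lemma monoid_ring_mult_superset:
  assumes "finite S" "finite T" "keys f \<subseteq> S" "keys g \<subseteq> T"
  shows "monoid_ring_mult G f g = (\<Sum>v\<in>S. \<Sum>w\<in>T.
    single (v \<otimes>\<^bsub>G\<^esub> w) (lookup f v * lookup g w))"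
proof -
  have "(\<Sum>w\<in>keys g. single (v \<otimes>\<^bsub>G\<^esub> w) (lookup f v * lookup g w))
     = (\<Sum>w\<in>T. single (v \<otimes>\<^bsub>G\<^esub> w) (lookup f v * lookup g w))" for v
    using assms by (intro sum.mono_neutral_left) (auto simp: in_keys_iff)
  then show ?thesis
    unfolding monoid_ring_mult_def
    using assms by (auto intro!: sum.mono_neutral_left simp: in_keys_iff)
qed

lemma monoid_ring_mult_add_left:
  "monoid_ring_mult G (f + f') g = monoid_ring_mult G f g + monoid_ring_mult G f' g"
proof -
  define S where "S = keys f \<union> keys f'"
  have S: "finite S" "keys f \<subseteq> S" "keys f' \<subseteq> S" "keys (f + f') \<subseteq> S"
    using keys_add[of f f'] by (auto simp: S_def)
  show ?thesis
    using S by (simp add: monoid_ring_mult_superset[of S "keys g"] lookup_add distrib_right single_add sum.distrib)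
qed

lemma monoid_ring_mult_add_right:
  "monoid_ring_mult G f (g + g') = monoid_ring_mult G f g + monoid_ring_mult G f g'"
proof -
  define S where "S = keys g \<union> keys g'"
  have S: "finite S" "keys g \<subseteq> S" "keys g' \<subseteq> S" "keys (g + g') \<subseteq> S"
    using keys_add[of g g'] by (auto simp: S_def)
  show ?thesis
    using S by (simp add: monoid_ring_mult_superset[of "keys f" S] lookup_add distrib_left single_add sum.distrib)
qed

lemma monoid_ring_mult_single [simp]:
  "monoid_ring_mult G (single v c) (single w d) = single (v \<otimes>\<^bsub>G\<^esub> w) (c * d)"
  by (subst monoid_ring_mult_superset[of "{v}" "{w}"]) auto

lemma monoid_ring_mult_zero [simp]: "monoid_ring_mult G 0 g = 0" "monoid_ring_mult G f 0 = 0"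
  by (simp_all add: monoid_ring_mult_def)

lemma monoid_ring_sel:
  "mult (monoid_ring G) = monoid_ring_mult G"
  "one (monoid_ring G) = single \<one>\<^bsub>G\<^esub> 1"
  "zero (monoid_ring G) = 0"
  "add (monoid_ring G) = (+)"
  by (simp_all add: monoid_ring_def)

lemma monoid_ring_add_closed:
  "f \<in> carrier (monoid_ring G) \<Longrightarrow> g \<in> carrier (monoid_ring G) \<Longrightarrow> f + g \<in> carrier (monoid_ring G)"
  using keys_add[of f g] by (auto simp: carrier_monoid_ring)

lemma monoid_ring_mult_closed:
  assumes "monoid G" "f \<in> carrier (monoid_ring G)" "g \<in> carrier (monoid_ring G)"
  shows "monoid_ring_mult G f g \<in> carrier (monoid_ring G)"
proof -
  interpret monoid G by fact
  show ?thesis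
    using assms(2)
  proof (induction f rule: monoid_ring_induct)
    case (single w c)
    show ?case using assms(3)
    proof (induction g rule: monoid_ring_induct)
      case zero then show ?case by (simp add: carrier_monoid_ring)
    next
      case (single w' c') then show ?case using \<open>w \<in> carrier G\<close> by simp
    next
      case (add f g) then show ?case by (simp add: monoid_ring_mult_add_right monoid_ring_add_closed)
    qed
  qed (simp_all add: monoid_ring_mult_add_left monoid_ring_add_closed, simp add: carrier_monoid_ring)
qed

lemma monoid_ring_mult_assoc:
  assumes "monoid G" "f \<in> carrier (monoid_ring G)" "g \<in> carrier (monoid_ring G)" "h \<in> carrier (monoid_ring G)"
  shows "monoid_ring_mult G (monoid_ring_mult G f g) h = monoid_ring_mult G f (monoid_ring_mult G g h)"
proof -
  interpret monoid G by fact
  show ?thesis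
    using assms(2)
  proof (induction f rule: monoid_ring_induct)
    case (single u c)
    note u = single
    show ?case using assms(3)
    proof (induction g rule: monoid_ring_induct)
      case (single v d)
      note v = single
      show ?case using assms(4)
        by (induction h rule: monoid_ring_induct)
           (use u v in \<open>simp_all add: m_assoc mult.assoc monoid_ring_mult_add_right\<close>)
    qed (simp_all add: monoid_ring_mult_add_left monoid_ring_mult_add_right)
  qed (simp_all add: monoid_ring_mult_add_left)
qed

lemma monoid_ring_ring:
  assumes "monoid G"
  shows "ring (monoid_ring G :: ('w \<Rightarrow>\<^sub>0 'c::comm_ring_1) ring)"
proof -
  interpret monoid G by fact
  let ?M = "monoid_ring G :: ('w \<Rightarrow>\<^sub>0 'c::comm_ring_1) ring"
  have one_l: "monoid_ring_mult G (single \<one>\<^bsub>G\<^esub> 1) f = f" if "f \<in> carrier ?M" for f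
    using that by (induction f rule: monoid_ring_induct) (simp_all add: monoid_ring_mult_add_right)
  have one_r: "monoid_ring_mult G f (single \<one>\<^bsub>G\<^esub> 1) = f" if "f \<in> carrier ?M" for f
    using that by (induction f rule: monoid_ring_induct) (simp_all add: monoid_ring_mult_add_left)
  show ?thesis
  proof (intro ringI abelian_groupI monoidI)
    fix f assume "f \<in> carrier ?M"
    then have "- f \<in> carrier ?M" by (auto simp: carrier_monoid_ring in_keys_iff)
    then show "\<exists>g\<in>carrier ?M. g \<oplus>\<^bsub>?M\<^esub> f = \<zero>\<^bsub>?M\<^esub>"
      by (intro bexI[of _ "- f"]) (auto simp: monoid_ring_sel)
  qed (use assms in \<open>auto simp: monoid_ring_sel monoid_ring_add_closed monoid_ring_mult_closed monoid_ring_mult_assoc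
        one_l one_r monoid_ring_mult_add_left monoid_ring_mult_add_right add_ac\<close>,
       auto simp: carrier_monoid_ring)
qed

lemma words_sel [simp]:
  "carrier (words X) = lists X" "mult (words X) = (@)" "one (words X) = []"
  by (simp_all add: words_def)

lemma monoid_words: "monoid (words X)"
  by (rule monoidI) auto


section \<open>The universal property of monoid rings\<close>

text \<open>The scalars form a type and act by a function that is a parameter of its own: the same
  universal property then serves complex algebras, where they act by the module operation, and
  arbitrary rings, where the integers act by taking multiples.\<close>

locale scalar_ring = ring E for E (structure) +
  fixes sc :: "'c::comm_ring_1 \<Rightarrow> 'a \<Rightarrow> 'a"
  assumes sc_closed [simp, intro]: "x \<in> carrier E \<Longrightarrow> sc c x \<in> carrier E"
    and sc_add_left: "x \<in> carrier E \<Longrightarrow> sc (c + d) x = sc c x \<oplus> sc d x"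
    and sc_add_right: "x \<in> carrier E \<Longrightarrow> y \<in> carrier E \<Longrightarrow> sc c (x \<oplus> y) = sc c x \<oplus> sc c y"
    and sc_sc: "x \<in> carrier E \<Longrightarrow> sc c (sc d x) = sc (c * d) x"
    and sc_one [simp]: "x \<in> carrier E \<Longrightarrow> sc 1 x = x"
    and sc_mult_left: "x \<in> carrier E \<Longrightarrow> y \<in> carrier E \<Longrightarrow> sc c x \<otimes> y = sc c (x \<otimes> y)"
    and sc_mult_right: "x \<in> carrier E \<Longrightarrow> y \<in> carrier E \<Longrightarrow> x \<otimes> sc c y = sc c (x \<otimes> y)"
begin

lemma sc_0 [simp]: "x \<in> carrier E \<Longrightarrow> sc 0 x = \<zero>"
  using sc_add_left[of x 0 0] by (metis add_0 add.l_cancel_one sc_closed)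

lemma sc_zero [simp]: "sc c \<zero> = \<zero>"
  using sc_mult_left[of \<one> \<zero> c] by auto

lemma sc_minus: "x \<in> carrier E \<Longrightarrow> sc (- c) x = \<ominus> sc c x"
  using sc_add_left[of x "-c" c] by (simp add: minus_equality)

lemma sc_a_inv: "x \<in> carrier E \<Longrightarrow> sc c (\<ominus> x) = \<ominus> sc c x"
  using sc_add_right[of "\<ominus> x" x c] by (simp add: l_neg minus_equality)

definition lin_ext :: "('w \<Rightarrow> 'a) \<Rightarrow> ('w \<Rightarrow>\<^sub>0 'c) \<Rightarrow> 'a" where
  "lin_ext h f = (\<Oplus>w\<in>keys f. sc (lookup f w) (h w))"

lemma lin_ext_superset:
  assumes "finite S" "keys f \<subseteq> S" "h \<in> S \<rightarrow> carrier E"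
  shows "lin_ext h f = (\<Oplus>w\<in>S. sc (lookup f w) (h w))"
  unfolding lin_ext_def using assms
  by (intro add.finprod_mono_neutral_cong_left) (auto simp: in_keys_iff Pi_iff)

lemma lin_ext_zero [simp]: "lin_ext h 0 = \<zero>"
  by (simp add: lin_ext_def)

lemma lin_ext_single [simp]: "h w \<in> carrier E \<Longrightarrow> lin_ext h (single w c) = sc c (h w)"
  by (subst lin_ext_superset[of "{w}"]) auto

context
  fixes G :: "('w, 'm) monoid_scheme" and h
  assumes h: "h \<in> carrier G \<rightarrow> carrier E"
begin

lemma lin_ext_closed: "f \<in> carrier (monoid_ring G) \<Longrightarrow> lin_ext h f \<in> carrier E"
  using h unfolding lin_ext_def by (intro finsum_closed) (auto simp: carrier_monoid_ring)

lemma lin_ext_add: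
  assumes "f \<in> carrier (monoid_ring G)" "g \<in> carrier (monoid_ring G)"
  shows "lin_ext h (f + g) = lin_ext h f \<oplus> lin_ext h g"
proof -
  define S where "S = keys f \<union> keys g"
  have S: "finite S" "keys f \<subseteq> S" "keys g \<subseteq> S" "keys (f + g) \<subseteq> S"
    using keys_add[of f g] by (auto simp: S_def)
  have "h \<in> S \<rightarrow> carrier E" using h assms by (auto simp: S_def carrier_monoid_ring)
  then show ?thesis
    using S by (simp add: lin_ext_superset[of S] lookup_add sc_add_left Pi_iff flip: finsum_addf cong: finsum_cong)
qed

lemma lin_ext_scale:
  assumes "f \<in> carrier (monoid_ring G)"
  shows "lin_ext h (scale c f) = sc c (lin_ext h f)"
  using assms
proof (induction f rule: monoid_ring_induct)
  case (single w d)
  then have "h w \<in> carrier E" using h by auto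
  then show ?case by (simp add: sc_sc del: map_single)
next
  case (add f g)
  then show ?case
    by (simp add: poly_map_scale_add poly_map_scale_closed lin_ext_add sc_add_right lin_ext_closed)
qed simp

lemma lin_ext_mult:
  assumes G: "monoid G"
    and hm: "\<And>v w. v \<in> carrier G \<Longrightarrow> w \<in> carrier G \<Longrightarrow> h (v \<otimes>\<^bsub>G\<^esub> w) = h v \<otimes> h w"
    and f: "f \<in> carrier (monoid_ring G)" and g: "g \<in> carrier (monoid_ring G)"
  shows "lin_ext h (monoid_ring_mult G f g) = lin_ext h f \<otimes> lin_ext h g"
  using f
proof (induction f rule: monoid_ring_induct)
  case zero
  then show ?case using g by (simp add: lin_ext_closed)
next
  case (single v c)
  note v = single
  interpret G: monoid G by fact
  have hc: "h w \<in> carrier E" if "w \<in> carrier G" for w using h that by auto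
  show ?case using g
  proof (induction g rule: monoid_ring_induct)
    case (single w d)
    then show ?case using v
      by (simp add: hm hc sc_mult_left sc_mult_right sc_sc mult.commute)
  qed (use v in \<open>simp_all add: hc monoid_ring_mult_add_right lin_ext_add lin_ext_closed G
        monoid_ring_mult_closed r_distr\<close>)
next
  case (add f f')
  then show ?case using g G
    by (simp add: monoid_ring_mult_add_left lin_ext_add lin_ext_closed l_distr monoid_ring_mult_closed)
qed

lemma lin_ext_ring_hom:
  assumes G: "monoid G"
    and hm: "\<And>v w. v \<in> carrier G \<Longrightarrow> w \<in> carrier G \<Longrightarrow> h (v \<otimes>\<^bsub>G\<^esub> w) = h v \<otimes> h w"
    and h1: "h \<one>\<^bsub>G\<^esub> = \<one>"
  shows "lin_ext h \<in> ring_hom (monoid_ring G) E"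
  using lin_ext_mult[OF G hm] h1
  by (intro ring_hom_memI) (auto simp: monoid_ring_sel lin_ext_add lin_ext_closed)

end

end

lemma (in ring) int_scalar_ring: "scalar_ring R (\<lambda>n::int. add_pow R n)"
  by unfold_locales
     (auto simp: add.int_pow_mult add.int_pow_distrib add_pow_ldistr_int add_pow_rdistr_int
        add.int_pow_pow mult.commute)

section \<open>Star-algebras and their quotients\<close>

lemma ring_cong:
  assumes "ring R" "carrier S = carrier R" "mult S = mult R" "one S = one R" "zero S = zero R" "add S = add R"
  shows "ring S"
proof -
  interpret R: ring R by fact
  show ?thesis
    by (intro ringI abelian_groupI monoidI; unfold assms(2-6))
       (auto simp: R.a_ac R.m_assoc R.l_distr R.r_distr intro!: bexI[of _ "\<ominus>\<^bsub>R\<^esub> x" for x] R.l_neg)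
qed

lemma (in ring) minus_eq_zeroD:
  assumes "x \<in> carrier R" "y \<in> carrier R" "x \<ominus> y = \<zero>"
  shows "x = y"
  using assms minus_equality[of x "\<ominus> y"] by (simp add: a_minus_def)

locale star_alg = scalar_ring A "smult A" for A :: "('a, 'm) star_algebra_scheme" (structure) +
  assumes star_closed [simp, intro]: "x \<in> carrier A \<Longrightarrow> star A x \<in> carrier A"
    and star_add: "x \<in> carrier A \<Longrightarrow> y \<in> carrier A \<Longrightarrow> star A (x \<oplus> y) = star A x \<oplus> star A y"
    and star_mult: "x \<in> carrier A \<Longrightarrow> y \<in> carrier A \<Longrightarrow> star A (x \<otimes> y) = star A y \<otimes> star A x"
    and star_smult: "x \<in> carrier A \<Longrightarrow> star A (c \<odot> x) = cnj c \<odot> star A x"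
    and star_star [simp]: "x \<in> carrier A \<Longrightarrow> star A (star A x) = x"
begin

lemma star_one [simp]: "star A \<one> = \<one>"
  by (metis one_closed r_one l_one star_closed star_mult star_star)

lemma star_zero [simp]: "star A \<zero> = \<zero>"
  using star_smult[of "\<zero>" 0] by auto

lemma star_a_inv: "x \<in> carrier A \<Longrightarrow> star A (\<ominus> x) = \<ominus> star A x"
  using star_add[of "\<ominus> x" x] by (simp add: l_neg minus_equality)

lemma star_minus: "x \<in> carrier A \<Longrightarrow> y \<in> carrier A \<Longrightarrow> star A (x \<ominus> y) = star A x \<ominus> star A y"
  by (simp add: a_minus_def star_add star_a_inv)

lemma smult_ideal:
  assumes "ideal I A" "x \<in> I"
  shows "c \<odot> x \<in> I"
proof -
  interpret I: ideal I A by fact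
  have "(c \<odot> \<one>) \<otimes> x \<in> I" using assms by (intro I.I_l_closed) auto
  then show ?thesis using assms I.a_Hcarr by (simp add: sc_mult_left)
qed

text \<open>The elements whose star lies in the ideal again form an ideal, and it contains the
  generators.\<close>

lemma star_genideal:
  assumes R: "R \<subseteq> carrier A" and s: "star A ` R \<subseteq> Idl R" and x: "x \<in> Idl R"
  shows "star A x \<in> Idl R"
proof -
  interpret I: ideal "Idl R" A using genideal_ideal[OF R] .
  have "ideal {x \<in> carrier A. star A x \<in> Idl R} A"
  proof (intro idealI ring_axioms subgroup.intro)
    fix x assume "x \<in> {x \<in> carrier A. star A x \<in> Idl R}"
    then show "inv\<^bsub>add_monoid A\<^esub> x \<in> {x \<in> carrier A. star A x \<in> Idl R}"
      by (auto simp: star_a_inv simp flip: a_inv_def)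
  qed (auto simp: star_add star_mult I.I_l_closed I.I_r_closed)
  then have "Idl R \<subseteq> {x \<in> carrier A. star A x \<in> Idl R}"
    by (rule genideal_minimal) (use R s in auto)
  then show ?thesis using x by auto
qed

end

text \<open>Any representative of the coset will do once \<open>H\<close> vanishes on the ideal.\<close>

definition quot_lift :: "('a \<Rightarrow> 'b) \<Rightarrow> 'a set \<Rightarrow> 'b" where
  "quot_lift H X = H (SOME x. x \<in> X)"

context ideal
begin

lemma quot_carrier: "carrier (R Quot I) = (+>) I ` carrier R"
  unfolding FactRing_def A_RCOSETS_def' partial_object.simps by blast

lemma coset_sub: "y \<in> I +> x \<Longrightarrow> x \<in> carrier R \<Longrightarrow> y \<in> carrier R \<and> y \<ominus> x \<in> I"
  using a_rcos_module_minus[OF ring_axioms, of x y] a_elemrcos_carrier[of x y] by blast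

lemma coset_cong: "\<lbrakk>x \<in> carrier R; y \<in> carrier R; x \<ominus> y \<in> I\<rbrakk> \<Longrightarrow> I +> x = I +> y"
  using quotient_eq_iff_same_a_r_cos[OF ideal_axioms, of x y] by simp

text \<open>Scalar multiplication and star of a quotient star-algebra are defined as unions over a
  coset; such a union consists of equal cosets.\<close>

lemma union_coset_map:
  assumes x: "x \<in> carrier R" and g: "g \<in> carrier R \<rightarrow> carrier R"
    and sub: "\<And>x y. x \<in> carrier R \<Longrightarrow> y \<in> carrier R \<Longrightarrow> x \<ominus> y \<in> I \<Longrightarrow> g x \<ominus> g y \<in> I"
  shows "(\<Union>y\<in>I +> x. I +> g y) = I +> g x"
proof -
  have "I +> g y = I +> g x" if "y \<in> I +> x" for y
    using coset_sub[OF that x] x g sub by (intro coset_cong) blast+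
  moreover have "x \<in> I +> x" using a_rcos_self[OF x] .
  ultimately show ?thesis by blast
qed

lemma quot_lift:
  assumes H: "H \<in> ring_hom R S" and S: "ring S" and ker: "\<And>x. x \<in> I \<Longrightarrow> H x = \<zero>\<^bsub>S\<^esub>"
  shows "x \<in> carrier R \<Longrightarrow> quot_lift H (I +> x) = H x"
    and "quot_lift H \<in> ring_hom (R Quot I) S"
proof -
  interpret H: ring_hom_ring R S H
    using H S ring_axioms by (intro ring_hom_ringI2)
  have eq: "quot_lift H (I +> x) = H x" if x: "x \<in> carrier R" for x
  proof -
    define y where "y = (SOME y. y \<in> I +> x)"
    have "y \<in> I +> x" unfolding y_def using a_rcos_self[OF x] by (rule someI)
    then have y: "y \<in> carrier R" "y \<ominus> x \<in> I" using coset_sub[OF _ x] by blast+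
    then have "H y \<ominus>\<^bsub>S\<^esub> H x = \<zero>\<^bsub>S\<^esub>" using ker[OF y(2)] x by (simp add: a_minus_def)
    then have "H y = H x"
      by (rule ring.minus_eq_zeroD[OF S H.hom_closed[OF y(1)] H.hom_closed[OF x]])
    then show ?thesis by (simp add: quot_lift_def y_def)
  qed
  then show "x \<in> carrier R \<Longrightarrow> quot_lift H (I +> x) = H x" by simp
  interpret \<pi>: ring_hom_ring R "R Quot I" "(+>) I" by (rule rcos_ring_hom_ring)
  show "quot_lift H \<in> ring_hom (R Quot I) S"
  proof (rule ring_hom_memI)
    show "quot_lift H \<one>\<^bsub>R Quot I\<^esub> = \<one>\<^bsub>S\<^esub>"
      using eq[of \<one>] by (simp flip: \<pi>.hom_one)
  qed (auto simp: quot_carrier eq simp flip: \<pi>.hom_mult \<pi>.hom_add)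
qed

end

lemma ring_hom_kernel_genideal:
  assumes "H \<in> ring_hom R S" "ring R" "ring S" "X \<subseteq> carrier R" "\<And>x. x \<in> X \<Longrightarrow> H x = \<zero>\<^bsub>S\<^esub>"
    and x: "x \<in> genideal R X"
  shows "H x = \<zero>\<^bsub>S\<^esub>"
proof -
  interpret H: ring_hom_ring R S H
    using assms by (intro ring_hom_ringI2)
  have "genideal R X \<subseteq> a_kernel R S H"
    using assms(4,5) by (intro H.R.genideal_minimal[OF H.kernel_is_ideal]) (unfold a_kernel_def', blast)
  then show ?thesis using x unfolding a_kernel_def' by blast
qed

lemma quotient_star_algebra_sel:
  "carrier (quotient_star_algebra A I) = carrier (A Quot I)"
  "mult (quotient_star_algebra A I) = mult (A Quot I)"
  "one (quotient_star_algebra A I) = one (A Quot I)"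
  "zero (quotient_star_algebra A I) = zero (A Quot I)"
  "add (quotient_star_algebra A I) = add (A Quot I)"
  by (simp_all add: quotient_star_algebra_def)

lemma ring_hom_quotient_star_algebra [simp]:
  "ring_hom R (quotient_star_algebra A I) = ring_hom R (A Quot I)"
  "ring_hom (quotient_star_algebra A I) R = ring_hom (A Quot I) R"
  by (simp_all add: ring_hom_def quotient_star_algebra_sel)

locale star_ideal = star_alg A + ideal I A for A :: "('a, 'm) star_algebra_scheme" (structure) and I +
  assumes star_I: "x \<in> I \<Longrightarrow> star A x \<in> I"
begin

abbreviation "Q \<equiv> quotient_star_algebra A I"

lemma Q_carrier: "carrier Q = (+>) I ` carrier A"
  by (simp add: quotient_star_algebra_sel quot_carrier)

lemma Q_smult: "x \<in> carrier A \<Longrightarrow> c \<odot>\<^bsub>Q\<^esub> (I +> x) = I +> (c \<odot> x)"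
  unfolding quotient_star_algebra_def module.simps
proof (rule union_coset_map)
  fix x y assume "x \<in> carrier A" "y \<in> carrier A" "x \<ominus> y \<in> I"
  then show "c \<odot> x \<ominus> c \<odot> y \<in> I"
    using smult_ideal[OF ideal_axioms, of "x \<ominus> y" c] by (simp add: a_minus_def sc_add_right sc_a_inv)
qed auto

lemma Q_star: "x \<in> carrier A \<Longrightarrow> star Q (I +> x) = I +> star A x"
  unfolding quotient_star_algebra_def star_algebra.simps
proof (rule union_coset_map)
  fix x y assume "x \<in> carrier A" "y \<in> carrier A" "x \<ominus> y \<in> I"
  then show "star A x \<ominus> star A y \<in> I"
    using star_I[of "x \<ominus> y"] by (simp add: star_minus)
qed auto

lemma Q_ring: "ring Q"
  by (rule ring_cong[OF quotient_is_ring]) (simp_all add: quotient_star_algebra_sel)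

lemma Q_hom: "ring_hom_ring A Q ((+>) I)"
  using Q_ring ring_axioms rcos_ring_hom by (intro ring_hom_ringI2) auto

lemma Q_star_alg: "star_alg Q"
proof -
  interpret \<pi>: ring_hom_ring A Q "(+>) I" by (rule Q_hom)
  show ?thesis
    by unfold_locales
       (auto simp: Q_carrier Q_smult Q_star sc_add_left sc_add_right sc_sc sc_mult_left sc_mult_right
         star_add star_mult star_smult simp flip: \<pi>.hom_add \<pi>.hom_mult)
qed

end

section \<open>Star-algebras given by generators and relations\<close>

lemma star_monoid_algebra_sel:
  "carrier (star_monoid_algebra G s) = carrier (monoid_ring G)"
  "mult (star_monoid_algebra G s) = monoid_ring_mult G"
  "one (star_monoid_algebra G s) = single \<one>\<^bsub>G\<^esub> 1"
  "zero (star_monoid_algebra G s) = 0"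
  "add (star_monoid_algebra G s) = (+)"
  "smult (star_monoid_algebra G s) c = scale c"
  by (simp_all add: star_monoid_algebra_def monoid_ring_sel)

lemma ring_hom_star_monoid_algebra [simp]:
  "ring_hom (star_monoid_algebra G s) R = ring_hom (monoid_ring G) R"
  by (simp add: ring_hom_def star_monoid_algebra_sel monoid_ring_sel)

lemma star_monoid_algebra_star_superset:
  assumes "finite S" "keys f \<subseteq> S"
  shows "star (star_monoid_algebra G s) f = (\<Sum>w\<in>S. single (s w) (cnj (lookup f w)))"
  unfolding star_monoid_algebra_def star_algebra.simps
  using assms by (intro sum.mono_neutral_left) (auto simp: in_keys_iff)

lemma star_monoid_algebra_star_add:
  "star (star_monoid_algebra G s) (f + g) = star (star_monoid_algebra G s) f + star (star_monoid_algebra G s) g"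
proof -
  define S where "S = keys f \<union> keys g"
  have S: "finite S" "keys f \<subseteq> S" "keys g \<subseteq> S" "keys (f + g) \<subseteq> S"
    using keys_add[of f g] by (auto simp: S_def)
  show ?thesis
    using S by (simp add: star_monoid_algebra_star_superset[of S] lookup_add single_add sum.distrib)
qed

lemma star_monoid_algebra_star_single [simp]:
  "star (star_monoid_algebra G s) (single w c) = single (s w) (cnj c)"
  by (subst star_monoid_algebra_star_superset[of "{w}"]) auto

lemma star_monoid_algebra_star_zero [simp]: "star (star_monoid_algebra G s) 0 = 0"
  by (simp add: star_monoid_algebra_def)

lemma star_monoid_algebra_star_alg:
  fixes G :: "('w, 'm) monoid_scheme"
  assumes "monoid G"
    and s_closed: "\<And>w. w \<in> carrier G \<Longrightarrow> s w \<in> carrier G"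
    and s_mult: "\<And>v w. v \<in> carrier G \<Longrightarrow> w \<in> carrier G \<Longrightarrow> s (v \<otimes>\<^bsub>G\<^esub> w) = s w \<otimes>\<^bsub>G\<^esub> s v"
    and s_s: "\<And>w. w \<in> carrier G \<Longrightarrow> s (s w) = w"
  shows "star_alg (star_monoid_algebra G s)"
proof -
  interpret G: monoid G by fact
  let ?A = "star_monoid_algebra G s"
  let ?C = "carrier (monoid_ring G) :: ('w \<Rightarrow>\<^sub>0 complex) set"
  interpret A: ring ?A
    by (rule ring_cong[OF monoid_ring_ring[OF assms(1)]]) (simp_all add: star_monoid_algebra_sel monoid_ring_sel)
  have cl: "star ?A f \<in> ?C" if "f \<in> ?C" for f
    using that by (induction f rule: monoid_ring_induct)
      (auto simp: star_monoid_algebra_star_add monoid_ring_add_closed s_closed, simp add: carrier_monoid_ring)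
  have scl: "monoid_ring_mult G (scale c f) g = scale c (monoid_ring_mult G f g)"
    if f: "f \<in> ?C" and g: "g \<in> ?C" for f g c
    using f
  proof (induction f rule: monoid_ring_induct)
    case (single v d)
    from g show ?case
      by (induction g rule: monoid_ring_induct)
         (simp_all add: monoid_ring_mult_add_right poly_map_scale_add mult.assoc)
  qed (simp_all add: monoid_ring_mult_add_left poly_map_scale_add)
  have scr: "monoid_ring_mult G f (scale c g) = scale c (monoid_ring_mult G f g)"
    if f: "f \<in> ?C" and g: "g \<in> ?C" for f g c
    using f
  proof (induction f rule: monoid_ring_induct)
    case (single v d)
    from g show ?case
      by (induction g rule: monoid_ring_induct)
         (simp_all add: monoid_ring_mult_add_right poly_map_scale_add mult.left_commute)
  qed (simp_all add: monoid_ring_mult_add_left poly_map_scale_add)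
  have sm: "star ?A (monoid_ring_mult G f g) = monoid_ring_mult G (star ?A g) (star ?A f)"
    if f: "f \<in> ?C" and g: "g \<in> ?C" for f g
    using f
  proof (induction f rule: monoid_ring_induct)
    case (single v d)
    note v = single
    from g show ?case
      by (induction g rule: monoid_ring_induct)
         (use v in \<open>simp_all add: monoid_ring_mult_add_right monoid_ring_mult_add_left
           star_monoid_algebra_star_add s_mult mult.commute\<close>)
  qed (simp_all add: monoid_ring_mult_add_left monoid_ring_mult_add_right star_monoid_algebra_star_add)
  have ssc: "star ?A (scale c f) = scale (cnj c) (star ?A f)"
    if f: "f \<in> ?C" for f c
    using f by (induction f rule: monoid_ring_induct)
      (simp_all add: star_monoid_algebra_star_add poly_map_scale_add)
  have ss: "star ?A (star ?A f) = f"
    if f: "f \<in> ?C" for f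
    using f by (induction f rule: monoid_ring_induct)
      (simp_all add: star_monoid_algebra_star_add s_s)
  have s1: "scale 1 f = f" for f :: "'w \<Rightarrow>\<^sub>0 complex"
    by (rule poly_mapping_eqI) (simp add: map.rep_eq when_def)
  show ?thesis
    by unfold_locales
       (simp_all add: star_monoid_algebra_sel poly_map_scale_closed cl scl scr sm ssc ss s1
         poly_map_scale_add poly_map_scale_add_left poly_map_scale_scale star_monoid_algebra_star_add)
qed

lemma letter_adj_adj [simp]: "letter_adj (letter_adj x) = x"
  by (cases x) auto

interpretation free: star_alg "free_star_algebra :: 'g star_poly star_algebra"
  unfolding free_star_algebra_def
  by (rule star_monoid_algebra_star_alg[OF monoid_words]) (auto simp: rev_map o_def)

lemma free_carrier [simp]: "carrier free_star_algebra = UNIV"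
  by (simp add: free_star_algebra_def star_monoid_algebra_sel carrier_monoid_ring)

lemma free_sel:
  "one free_star_algebra = single [] 1"
  "zero free_star_algebra = 0"
  "add free_star_algebra = (+)"
  "mult free_star_algebra = monoid_ring_mult (words UNIV)"
  "smult free_star_algebra c = scale c"
  by (simp_all add: free_star_algebra_def star_monoid_algebra_sel)

lemma free_star_gen: "star free_star_algebra (free_gen g) = single [Adj g] 1"
  by (simp add: free_star_algebra_def free_gen_def)

lemma star_ideal_relation_ideal: "star_ideal free_star_algebra (relation_ideal R)"
proof -
  let ?F = "free_star_algebra :: 'a star_poly star_algebra"
  let ?S = "R \<union> star ?F ` R"
  have sub: "?S \<subseteq> carrier ?F" by auto
  have "star ?F ` ?S \<subseteq> ?S" by (auto simp: image_iff)
  then have "star ?F ` ?S \<subseteq> Idl\<^bsub>?F\<^esub> ?S" using free.genideal_self[OF sub] by blast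
  then show ?thesis
    unfolding star_ideal_def star_ideal_axioms_def relation_ideal_def
    using free.genideal_ideal[OF sub] free.star_genideal[OF sub] free.star_alg_axioms by blast
qed

definition cls :: "'g star_poly set \<Rightarrow> 'g letter list \<Rightarrow> 'g star_poly set" where
  "cls R w = relation_ideal R +>\<^bsub>free_star_algebra\<^esub> single w 1"

definition word_val :: "('b, 'm) monoid_scheme \<Rightarrow> ('x \<Rightarrow> 'b) \<Rightarrow> 'x list \<Rightarrow> 'b" where
  "word_val E h w = foldr (\<lambda>L x. h L \<otimes>\<^bsub>E\<^esub> x) w \<one>\<^bsub>E\<^esub>"

lemma word_val_simps [simp]:
  "word_val E h [] = \<one>\<^bsub>E\<^esub>" "word_val E h (L # w) = h L \<otimes>\<^bsub>E\<^esub> word_val E h w"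
  by (simp_all add: word_val_def)

lemma (in monoid) word_val_closed: "h ` set w \<subseteq> carrier G \<Longrightarrow> word_val G h w \<in> carrier G"
  by (induction w) auto

lemma (in monoid) word_val_append:
  "h ` set v \<subseteq> carrier G \<Longrightarrow> h ` set w \<subseteq> carrier G \<Longrightarrow>
    word_val G h (v @ w) = word_val G h v \<otimes> word_val G h w"
  by (induction v) (auto simp: word_val_closed m_assoc)

context
  fixes R :: "'g star_poly set"
begin

interpretation I: star_ideal "free_star_algebra :: 'g star_poly star_algebra" "relation_ideal R"
  by (rule star_ideal_relation_ideal)

abbreviation (input) "P \<equiv> presented_star_algebra R"

lemma presented_star_alg: "star_alg P"
  unfolding presented_star_algebra_def by (rule I.Q_star_alg)

interpretation P: star_alg P by (rule presented_star_alg)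

lemma cls_carrier [simp]: "cls R w \<in> carrier P"
  by (auto simp: cls_def presented_star_algebra_def I.Q_carrier)

lemma presented_hom: "ring_hom_ring free_star_algebra P ((+>\<^bsub>free_star_algebra\<^esub>) (relation_ideal R))"
  unfolding presented_star_algebra_def by (rule I.Q_hom)

interpretation \<pi>: ring_hom_ring free_star_algebra P "(+>\<^bsub>free_star_algebra\<^esub>) (relation_ideal R)"
  by (rule presented_hom)

lemma cls_append: "cls R (v @ w) = cls R v \<otimes>\<^bsub>P\<^esub> cls R w"
  by (simp add: cls_def free_sel flip: \<pi>.hom_mult)

lemma cls_Nil: "cls R [] = \<one>\<^bsub>P\<^esub>"
  using \<pi>.hom_one by (simp add: cls_def free_sel)

lemma cls_star: "star P (cls R w) = cls R (rev (map letter_adj w))"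
  unfolding cls_def presented_star_algebra_def
  by (subst I.Q_star) (simp_all, simp add: free_star_algebra_def)

lemma presented_smult:
  "c \<odot>\<^bsub>P\<^esub> (relation_ideal R +>\<^bsub>free_star_algebra\<^esub> x) = relation_ideal R +>\<^bsub>free_star_algebra\<^esub> (c \<odot>\<^bsub>free_star_algebra\<^esub> x)"
  unfolding presented_star_algebra_def by (rule I.Q_smult) simp

lemma presented_gen_cls: "presented_gen R g = cls R [Gen g]"
  by (simp add: presented_gen_def cls_def free_gen_def)

lemma presented_star_gen: "star P (presented_gen R g) = cls R [Adj g]"
  by (simp add: presented_gen_cls cls_star)

lemma presented_relation:
  "r \<in> R \<Longrightarrow> relation_ideal R +>\<^bsub>free_star_algebra\<^esub> r = \<zero>\<^bsub>P\<^esub>"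
proof -
  assume "r \<in> R"
  then have "r \<in> relation_ideal R"
    unfolding relation_ideal_def using free.genideal_self[of "R \<union> star free_star_algebra ` R"] by auto
  then show ?thesis
    using I.a_rcos_const[of r]
    by (simp only: presented_star_algebra_def quotient_star_algebra_sel FactRing_def ring.simps)
qed

text \<open>Elements of the quotient are linear combinations of classes of words.\<close>

lemma presented_induct [consumes 1, case_names word add]:
  assumes x: "x \<in> carrier P"
    and 1: "\<And>c w. Q (c \<odot>\<^bsub>P\<^esub> cls R w)"
    and 2: "\<And>x y. x \<in> carrier P \<Longrightarrow> y \<in> carrier P \<Longrightarrow> Q x \<Longrightarrow> Q y \<Longrightarrow> Q (x \<oplus>\<^bsub>P\<^esub> y)"
  shows "Q x"
proof -
  obtain f where f: "x = relation_ideal R +>\<^bsub>free_star_algebra\<^esub> f"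
    using x by (auto simp: presented_star_algebra_def I.Q_carrier)
  have "f \<in> carrier (monoid_ring (words UNIV))" by (simp add: carrier_monoid_ring)
  then have "Q (relation_ideal R +>\<^bsub>free_star_algebra\<^esub> f)"
  proof (induction f rule: monoid_ring_induct)
    case zero
    have "Q (0 \<odot>\<^bsub>P\<^esub> cls R [])" by (rule 1)
    then show ?case using \<pi>.hom_zero by (simp add: free_sel)
  next
    case (single w c)
    have "Q (c \<odot>\<^bsub>P\<^esub> cls R w)" by (rule 1)
    then show ?case by (simp add: cls_def presented_smult free_sel)
  next
    case (add f g)
    then show ?case using 2 \<pi>.hom_add[of f g] by (simp add: free_sel)
  qed
  then show ?thesis using f by simp
qed

text \<open>The values at the formal adjoints are prescribed independently of those at the
  generators, because two of the targets below (operators, and the complex numbers with \<open>u\<close>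
  sent to 2) carry no suitable star. This is why the map also has to kill the stars of the
  relators.\<close>

lemma presented_hom_exists:
  fixes E :: "('b, 'm) ring_scheme"
  assumes "scalar_ring E sc"
    and h: "\<And>L. h L \<in> carrier E"
    and rel: "\<And>H r. ring_hom_ring (free_star_algebra :: 'g star_poly star_algebra) E H \<Longrightarrow>
       (\<And>c x. H (c \<odot>\<^bsub>free_star_algebra\<^esub> x) = sc c (H x)) \<Longrightarrow>
       (\<And>L. H (single [L] 1) = h L) \<Longrightarrow> r \<in> R \<Longrightarrow>
       H r = \<zero>\<^bsub>E\<^esub> \<and> H (star free_star_algebra r) = \<zero>\<^bsub>E\<^esub>"
  obtains H where "ring_hom_ring P E H" "\<And>c x. x \<in> carrier P \<Longrightarrow> H (c \<odot>\<^bsub>P\<^esub> x) = sc c (H x)"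
    "\<And>L. H (cls R [L]) = h L"
proof -
  interpret E: scalar_ring E sc by fact
  let ?F = "free_star_algebra :: 'g star_poly star_algebra"
  let ?v = "word_val E h"
  have vc: "?v \<in> carrier (words UNIV) \<rightarrow> carrier E"
    by (auto intro!: E.word_val_closed h)
  have vm: "?v (w @ w') = ?v w \<otimes>\<^bsub>E\<^esub> ?v w'" for w w'
    by (rule E.word_val_append) (use h in auto)
  have all: "f \<in> carrier (monoid_ring (words UNIV))" for f :: "'g star_poly"
    by (simp add: carrier_monoid_ring)
  define H0 where "H0 = E.lin_ext ?v"
  have "H0 \<in> ring_hom (monoid_ring (words UNIV)) E"
    unfolding H0_def by (rule E.lin_ext_ring_hom[OF vc monoid_words]) (auto simp: vm)
  then have H0: "H0 \<in> ring_hom ?F E" by (simp add: free_star_algebra_def)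
  have hom: "ring_hom_ring ?F E H0"
    by (rule ring_hom_ringI2[OF free.ring_axioms E.ring_axioms H0])
  have sm: "H0 (c \<odot>\<^bsub>?F\<^esub> x) = sc c (H0 x)" for c x
    using E.lin_ext_scale[OF vc all] by (simp add: H0_def free_sel)
  have gen: "H0 (single [L] 1) = h L" for L
    using h by (simp add: H0_def)
  have ker: "H0 x = \<zero>\<^bsub>E\<^esub>" if "x \<in> relation_ideal R" for x
    using ring_hom_kernel_genideal[OF H0 free.ring_axioms E.ring_axioms, of "R \<union> star ?F ` R" x]
      that rel[OF hom sm gen] unfolding relation_ideal_def by auto
  note lift = I.quot_lift[OF H0 E.ring_axioms ker]
  have "ring_hom_ring P E (quot_lift H0)"
    using lift(2) unfolding presented_star_algebra_def
    by (intro ring_hom_ringI2 I.Q_ring E.ring_axioms) simp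
  moreover have "quot_lift H0 (c \<odot>\<^bsub>P\<^esub> x) = sc c (quot_lift H0 x)" if "x \<in> carrier P" for c x
    using that by (auto simp: presented_star_algebra_def I.Q_carrier I.Q_smult lift(1) sm)
  moreover have "quot_lift H0 (cls R [L]) = h L" for L
    by (simp add: cls_def lift(1) gen)
  ultimately show ?thesis using that by blast
qed

lemma presented_hom_eqI:
  assumes "ring_hom_ring P E H" "ring_hom_ring P E H'"
    and "\<And>c x. x \<in> carrier P \<Longrightarrow> H (c \<odot>\<^bsub>P\<^esub> x) = sc c (H x)"
    and "\<And>c x. x \<in> carrier P \<Longrightarrow> H' (c \<odot>\<^bsub>P\<^esub> x) = sc c (H' x)"
    and gen: "\<And>L. H (cls R [L]) = H' (cls R [L])" and x: "x \<in> carrier P"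
  shows "H x = H' x"
proof -
  interpret H: ring_hom_ring P E H by fact
  interpret H': ring_hom_ring P E H' by fact
  have w: "H (cls R w) = H' (cls R w)" for w
  proof (induction w)
    case (Cons L w)
    have "cls R (L # w) = cls R [L] \<otimes>\<^bsub>P\<^esub> cls R w" using cls_append[of "[L]" w] by simp
    then show ?case using Cons gen by simp
  qed (simp add: cls_Nil)
  from x show ?thesis
    by (induction x rule: presented_induct) (simp_all add: assms w)
qed

end

lemma free_single_append:
  "single (v @ w) 1 =
     single v 1 \<otimes>\<^bsub>free_star_algebra\<^esub> (single w 1 :: 'g star_poly)"
  by (simp add: free_sel)

text \<open>Both sides are antilinear and reverse products, so they agree if they agree on letters.
  Consequently a relator and its star are killed together whenever the target is a
  star-algebra.\<close>

lemma free_hom_star: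
  fixes E :: "('b, 'm) star_algebra_scheme" and H :: "'g star_poly \<Rightarrow> 'b"
  assumes "star_alg E" and H: "ring_hom_ring free_star_algebra E H"
    and sm: "\<And>c x. H (c \<odot>\<^bsub>free_star_algebra\<^esub> x) = c \<odot>\<^bsub>E\<^esub> H x"
    and gen: "\<And>L. H (single [letter_adj L] 1) = star E (H (single [L] 1))"
  shows "H (star free_star_algebra x) = star E (H x)"
proof -
  interpret E: star_alg E by fact
  interpret H: ring_hom_ring free_star_algebra E H by fact
  let ?F = "free_star_algebra :: 'g star_poly star_algebra"
  have word: "H (single (rev (map letter_adj w)) 1) = star E (H (single w 1))" for w
  proof (induction w)
    case Nil
    then show ?case using H.hom_one by (simp add: free_sel)
  next
    case (Cons L w)
    then show ?case
      using free_single_append[of "[L]" w] free_single_append[of "rev (map letter_adj w)" "[letter_adj L]"]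
      by (simp add: gen E.star_mult)
  qed
  have scaled: "single w c = c \<odot>\<^bsub>?F\<^esub> single w 1" for w c
    by (simp add: free_sel)
  have "x \<in> carrier (monoid_ring (words UNIV))" by (simp add: carrier_monoid_ring)
  then show ?thesis
  proof (induction x rule: monoid_ring_induct)
    case zero
    have "H (star ?F \<zero>\<^bsub>?F\<^esub>) = star E (H \<zero>\<^bsub>?F\<^esub>)"
      by (simp only: free.star_zero H.hom_zero E.star_zero)
    then show ?case by (simp only: free_sel(2))
  next
    case (single w c)
    have "star ?F (single w c) = cnj c \<odot>\<^bsub>?F\<^esub> single (rev (map letter_adj w)) 1"
      by (simp add: free_sel) (simp add: free_star_algebra_def)
    then show ?case unfolding scaled[of w c] by (simp only: sm word E.star_smult H.hom_closed free_carrier UNIV_I)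
  next
    case (add f g)
    have "f + g = f \<oplus>\<^bsub>?F\<^esub> g" by (simp add: free_sel)
    then show ?case using add by (simp add: free.star_add E.star_add)
  qed
qed

lemma presented_hom_star:
  fixes E :: "('b, 'm) star_algebra_scheme" and R :: "'g star_poly set"
  assumes "star_alg E" and H: "ring_hom_ring (presented_star_algebra R) E H"
    and sm: "\<And>c x. x \<in> carrier (presented_star_algebra R) \<Longrightarrow> H (c \<odot>\<^bsub>presented_star_algebra R\<^esub> x) = c \<odot>\<^bsub>E\<^esub> H x"
    and gen: "\<And>L. H (cls R [letter_adj L]) = star E (H (cls R [L]))"
    and x: "x \<in> carrier (presented_star_algebra R)"
  shows "H (star (presented_star_algebra R) x) = star E (H x)"
proof -
  interpret P: star_alg "presented_star_algebra R" by (rule presented_star_alg)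
  interpret E: star_alg E by fact
  interpret H: ring_hom_ring "presented_star_algebra R" E H by fact
  have word: "H (cls R (rev (map letter_adj w))) = star E (H (cls R w))" for w
  proof (induction w)
    case (Cons L w)
    then show ?case
      using cls_append[of R "[L]" w] cls_append[of R "rev (map letter_adj w)" "[letter_adj L]"]
      by (simp add: gen E.star_mult)
  qed (simp add: cls_Nil)
  from x show ?thesis
    by (induction x rule: presented_induct) (simp_all add: P.star_smult cls_star sm word E.star_smult P.star_add E.star_add)
qed

section \<open>The tensor product of star-algebras\<close>

locale star_alg_pair = A: star_alg A + B: star_alg B
  for A :: "'a star_algebra" and B :: "'b star_algebra"
begin

abbreviation "F \<equiv> free_on_pairs A B"
abbreviation "T \<equiv> tensor_algebra A B"
abbreviation "pt \<equiv> pure_tensor A B"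
abbreviation pr :: "'a \<Rightarrow> 'b \<Rightarrow> complex \<Rightarrow> 'a \<times> 'b \<Rightarrow>\<^sub>0 complex"
  where "pr x y c \<equiv> single (x, y) c"

lemma DirProd_sel [simp]:
  "carrier (A \<times>\<times> B) = carrier A \<times> carrier B" "one (A \<times>\<times> B) = (\<one>\<^bsub>A\<^esub>, \<one>\<^bsub>B\<^esub>)"
  "(x, y) \<otimes>\<^bsub>A \<times>\<times> B\<^esub> (x', y') = (x \<otimes>\<^bsub>A\<^esub> x', y \<otimes>\<^bsub>B\<^esub> y')"
  by (simp_all add: DirProd_def)

lemma monoid_pairs: "monoid (A \<times>\<times> B)"
  by (rule DirProd_monoid) (rule A.monoid_axioms, rule B.monoid_axioms)

lemma F_star_alg: "star_alg F"
  unfolding free_on_pairs_def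
  by (rule star_monoid_algebra_star_alg[OF monoid_pairs]) (auto simp: A.star_mult B.star_mult)

sublocale F: star_alg F by (rule F_star_alg)

lemma F_sel:
  "carrier F = carrier (monoid_ring (A \<times>\<times> B))"
  "mult F = monoid_ring_mult (A \<times>\<times> B)"
  "one F = pr \<one>\<^bsub>A\<^esub> \<one>\<^bsub>B\<^esub> 1"
  "zero F = 0"
  "add F = (+)"
  "smult F c = scale c"
  by (simp_all add: free_on_pairs_def star_monoid_algebra_sel)

lemma pr_closed [simp]: "x \<in> carrier A \<Longrightarrow> y \<in> carrier B \<Longrightarrow> pr x y c \<in> carrier F"
  by (simp add: F_sel)

lemma F_minus_closed: "f \<in> carrier F \<Longrightarrow> g \<in> carrier F \<Longrightarrow> f - g \<in> carrier F"
  using keys_diff[of f g] by (auto simp: F_sel carrier_monoid_ring)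

lemma F_star_minus: "star F (f - g) = star F f - star F g"
  using star_monoid_algebra_star_add[of "A \<times>\<times> B" "\<lambda>(x, y). (star A x, star B y)" "f - g" g]
  by (simp add: free_on_pairs_def algebra_simps)

lemma F_star_pr [simp]: "star F (pr x y c) = pr (star A x) (star B y) (cnj c)"
  by (simp add: free_on_pairs_def)

lemma bilinearity_relators_cases:
  assumes "r \<in> bilinearity_relators A B"
  obtains x x' y where "x \<in> carrier A" "x' \<in> carrier A" "y \<in> carrier B" "r = pr (x \<oplus>\<^bsub>A\<^esub> x') y 1 - pr x y 1 - pr x' y 1"
  | x y y' where "x \<in> carrier A" "y \<in> carrier B" "y' \<in> carrier B" "r = pr x (y \<oplus>\<^bsub>B\<^esub> y') 1 - pr x y 1 - pr x y' 1"
  | c x y where "x \<in> carrier A" "y \<in> carrier B" "r = pr (c \<odot>\<^bsub>A\<^esub> x) y 1 - pr x y c"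
  | c x y where "x \<in> carrier A" "y \<in> carrier B" "r = pr x (c \<odot>\<^bsub>B\<^esub> y) 1 - pr x y c"
  using assms unfolding bilinearity_relators_def Let_def
  by (elim UnE CollectE exE conjE) (erule that; assumption)+

lemma bilinearity_relatorsI:
  "\<lbrakk>x \<in> carrier A; x' \<in> carrier A; y \<in> carrier B\<rbrakk> \<Longrightarrow> pr (x \<oplus>\<^bsub>A\<^esub> x') y 1 - pr x y 1 - pr x' y 1 \<in> bilinearity_relators A B"
  "\<lbrakk>x \<in> carrier A; y \<in> carrier B; y' \<in> carrier B\<rbrakk> \<Longrightarrow> pr x (y \<oplus>\<^bsub>B\<^esub> y') 1 - pr x y 1 - pr x y' 1 \<in> bilinearity_relators A B"
  "\<lbrakk>x \<in> carrier A; y \<in> carrier B\<rbrakk> \<Longrightarrow> pr (c \<odot>\<^bsub>A\<^esub> x) y 1 - pr x y c \<in> bilinearity_relators A B"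
  "\<lbrakk>x \<in> carrier A; y \<in> carrier B\<rbrakk> \<Longrightarrow> pr x (c \<odot>\<^bsub>B\<^esub> y) 1 - pr x y c \<in> bilinearity_relators A B"
  unfolding bilinearity_relators_def Let_def
  subgoal by (rule UnI1, rule UnI1, rule UnI1) blast
  subgoal by (rule UnI1, rule UnI1, rule UnI2) blast
  subgoal by (rule UnI1, rule UnI2) blast
  subgoal by (rule UnI2) blast
  done

lemma bilinearity_relators_closed: "bilinearity_relators A B \<subseteq> carrier F"
proof
  fix r assume "r \<in> bilinearity_relators A B"
  then show "r \<in> carrier F"
    by (cases rule: bilinearity_relators_cases) (auto intro!: F_minus_closed)
qed

text \<open>The star maps each of the four families of relators to itself.\<close>

lemma bilinearity_relators_star: "star F ` bilinearity_relators A B \<subseteq> bilinearity_relators A B"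
proof clarify
  fix r assume "r \<in> bilinearity_relators A B"
  then show "star F r \<in> bilinearity_relators A B"
    by (cases rule: bilinearity_relators_cases)
       (auto simp: F_star_minus A.star_add B.star_add A.star_smult B.star_smult intro: bilinearity_relatorsI)
qed

lemma tensor_star_ideal: "star_ideal F (tensor_ideal A B)"
proof -
  have "star F ` bilinearity_relators A B \<subseteq> tensor_ideal A B"
    unfolding tensor_ideal_def using bilinearity_relators_star F.genideal_self[OF bilinearity_relators_closed]
    by (rule subset_trans)
  then show ?thesis
    unfolding star_ideal_def star_ideal_axioms_def tensor_ideal_def
    using F.genideal_ideal[OF bilinearity_relators_closed] F.star_genideal[OF bilinearity_relators_closed]
      F.star_alg_axioms by blast
qed

sublocale I: star_ideal F "tensor_ideal A B"
  by (rule tensor_star_ideal)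

lemma tensor_star_alg: "star_alg T"
  unfolding tensor_algebra_def by (rule I.Q_star_alg)

sublocale T: star_alg T by (rule tensor_star_alg)

lemma tensor_hom: "ring_hom_ring F T ((+>\<^bsub>F\<^esub>) (tensor_ideal A B))"
  unfolding tensor_algebra_def by (rule I.Q_hom)

interpretation \<pi>: ring_hom_ring F T "(+>\<^bsub>F\<^esub>) (tensor_ideal A B)"
  by (rule tensor_hom)

lemma pt_closed [simp]: "x \<in> carrier A \<Longrightarrow> y \<in> carrier B \<Longrightarrow> pt x y \<in> carrier T"
  by (simp add: pure_tensor_def)

lemma pt_mult:
  "\<lbrakk>x \<in> carrier A; y \<in> carrier B; x' \<in> carrier A; y' \<in> carrier B\<rbrakk> \<Longrightarrow>
    pt x y \<otimes>\<^bsub>T\<^esub> pt x' y' = pt (x \<otimes>\<^bsub>A\<^esub> x') (y \<otimes>\<^bsub>B\<^esub> y')"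
  using \<pi>.hom_mult[of "pr x y 1" "pr x' y' 1"] by (simp add: pure_tensor_def F_sel(2))

lemma pt_one: "pt \<one>\<^bsub>A\<^esub> \<one>\<^bsub>B\<^esub> = \<one>\<^bsub>T\<^esub>"
  using \<pi>.hom_one by (simp add: pure_tensor_def F_sel(3))

lemma pt_star: "x \<in> carrier A \<Longrightarrow> y \<in> carrier B \<Longrightarrow> star T (pt x y) = pt (star A x) (star B y)"
  using I.Q_star[of "pr x y 1"] by (simp add: pure_tensor_def tensor_algebra_def)

lemma pr_coset_smult: "x \<in> carrier A \<Longrightarrow> y \<in> carrier B \<Longrightarrow>
    c \<odot>\<^bsub>T\<^esub> pt x y = tensor_ideal A B +>\<^bsub>F\<^esub> pr x y c"
  using I.Q_smult[of "pr x y 1" c] by (simp add: pure_tensor_def tensor_algebra_def F_sel(6) del: map_single)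

lemma relator_coset:
  assumes "f - g \<in> bilinearity_relators A B" "f \<in> carrier F" "g \<in> carrier F"
  shows "tensor_ideal A B +>\<^bsub>F\<^esub> f = tensor_ideal A B +>\<^bsub>F\<^esub> g"
proof (rule I.coset_cong)
  have "f \<ominus>\<^bsub>F\<^esub> g = f - g"
    using F.minus_equality[of "- g" g] F_minus_closed[of 0 g] F.zero_closed assms(3)
    by (simp add: a_minus_def F_sel(4,5))
  then show "f \<ominus>\<^bsub>F\<^esub> g \<in> tensor_ideal A B"
    using assms(1) F.genideal_self[OF bilinearity_relators_closed] by (auto simp: tensor_ideal_def)
qed fact+

lemma pt_add_left:
  assumes "x \<in> carrier A" "x' \<in> carrier A" "y \<in> carrier B"
  shows "pt (x \<oplus>\<^bsub>A\<^esub> x') y = pt x y \<oplus>\<^bsub>T\<^esub> pt x' y"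
  using relator_coset[of "pr (x \<oplus>\<^bsub>A\<^esub> x') y 1" "pr x y 1 + pr x' y 1"]
    bilinearity_relatorsI(1)[OF assms] \<pi>.hom_add[of "pr x y 1" "pr x' y 1"] assms
  by (simp add: pure_tensor_def F_sel(5) diff_diff_eq F_sel(1) monoid_ring_add_closed)

lemma pt_smult_left:
  assumes "x \<in> carrier A" "y \<in> carrier B"
  shows "pt (c \<odot>\<^bsub>A\<^esub> x) y = c \<odot>\<^bsub>T\<^esub> pt x y"
  using relator_coset[of "pr (c \<odot>\<^bsub>A\<^esub> x) y 1" "pr x y c"]
    bilinearity_relatorsI(3)[OF assms] assms pr_coset_smult
  by (simp add: pure_tensor_def)

text \<open>Multiplicativity of \<open>g\<close> makes its linear extension to pairs a ring homomorphism, and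
  the remaining hypotheses say that this homomorphism kills the bilinearity relators.\<close>

lemma tensor_hom_exists:
  fixes E :: "('e, 'm) ring_scheme"
  assumes "scalar_ring E sc"
    and g: "\<And>x y. x \<in> carrier A \<Longrightarrow> y \<in> carrier B \<Longrightarrow> g x y \<in> carrier E"
    and g_mult: "\<And>x y x' y'. \<lbrakk>x \<in> carrier A; y \<in> carrier B; x' \<in> carrier A; y' \<in> carrier B\<rbrakk> \<Longrightarrow>
       g (x \<otimes>\<^bsub>A\<^esub> x') (y \<otimes>\<^bsub>B\<^esub> y') = g x y \<otimes>\<^bsub>E\<^esub> g x' y'"
    and g_one: "g \<one>\<^bsub>A\<^esub> \<one>\<^bsub>B\<^esub> = \<one>\<^bsub>E\<^esub>"
    and g_add_left: "\<And>x x' y. \<lbrakk>x \<in> carrier A; x' \<in> carrier A; y \<in> carrier B\<rbrakk> \<Longrightarrow> g (x \<oplus>\<^bsub>A\<^esub> x') y = g x y \<oplus>\<^bsub>E\<^esub> g x' y"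
    and g_add_right: "\<And>x y y'. \<lbrakk>x \<in> carrier A; y \<in> carrier B; y' \<in> carrier B\<rbrakk> \<Longrightarrow> g x (y \<oplus>\<^bsub>B\<^esub> y') = g x y \<oplus>\<^bsub>E\<^esub> g x y'"
    and g_smult_left: "\<And>c x y. \<lbrakk>x \<in> carrier A; y \<in> carrier B\<rbrakk> \<Longrightarrow> g (c \<odot>\<^bsub>A\<^esub> x) y = sc c (g x y)"
    and g_smult_right: "\<And>c x y. \<lbrakk>x \<in> carrier A; y \<in> carrier B\<rbrakk> \<Longrightarrow> g x (c \<odot>\<^bsub>B\<^esub> y) = sc c (g x y)"
  obtains H where "ring_hom_ring T E H"
    "\<And>c x. x \<in> carrier T \<Longrightarrow> H (c \<odot>\<^bsub>T\<^esub> x) = sc c (H x)"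
    "\<And>x y. x \<in> carrier A \<Longrightarrow> y \<in> carrier B \<Longrightarrow> H (pt x y) = g x y"
proof -
  interpret E: scalar_ring E sc by fact
  let ?v = "\<lambda>(x, y). g x y"
  have vc: "?v \<in> carrier (A \<times>\<times> B) \<rightarrow> carrier E" using g by auto
  define H0 where "H0 = E.lin_ext ?v"
  have "H0 \<in> ring_hom (monoid_ring (A \<times>\<times> B)) E"
    unfolding H0_def by (rule E.lin_ext_ring_hom[OF vc monoid_pairs]) (auto simp: g_mult g_one)
  then have H0: "H0 \<in> ring_hom F E" by (simp add: free_on_pairs_def)
  interpret H0: ring_hom_ring F E H0
    by (rule ring_hom_ringI2[OF F.ring_axioms E.ring_axioms H0])
  have pr: "H0 (pr x y c) = sc c (g x y)" if "x \<in> carrier A" "y \<in> carrier B" for x y c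
    using that g by (simp add: H0_def)
  have minus: "H0 (f - k) = \<zero>\<^bsub>E\<^esub>" if "f \<in> carrier F" "k \<in> carrier F" "H0 f = H0 k" for f k
    using H0.hom_add[of "f - k" k] that F_minus_closed[of f k]
    by (simp add: F_sel(5))
  have add: "H0 (f + k) = H0 f \<oplus>\<^bsub>E\<^esub> H0 k" if "f \<in> carrier F" "k \<in> carrier F" for f k
    using H0.hom_add[of f k] that by (simp add: F_sel(5))
  have addc: "f + k \<in> carrier F" if "f \<in> carrier F" "k \<in> carrier F" for f k
    using F.add.m_closed[of f k] that by (simp add: F_sel(5))
  have rel: "H0 r = \<zero>\<^bsub>E\<^esub>" if "r \<in> bilinearity_relators A B" for r
    using that
    by (cases rule: bilinearity_relators_cases)
       (auto simp: diff_diff_eq add addc pr g g_add_left g_add_right g_smult_left g_smult_right intro!: minus)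
  have ker: "H0 x = \<zero>\<^bsub>E\<^esub>" if "x \<in> tensor_ideal A B" for x
    using ring_hom_kernel_genideal[OF H0 F.ring_axioms E.ring_axioms bilinearity_relators_closed rel]
      that unfolding tensor_ideal_def by auto
  note lift = I.quot_lift[OF H0 E.ring_axioms ker]
  have "ring_hom_ring T E (quot_lift H0)"
    using lift(2) unfolding tensor_algebra_def
    by (intro ring_hom_ringI2 I.Q_ring E.ring_axioms) simp
  moreover have "quot_lift H0 (c \<odot>\<^bsub>T\<^esub> x) = sc c (quot_lift H0 x)" if "x \<in> carrier T" for c x
  proof -
    have "H0 (c \<odot>\<^bsub>F\<^esub> f) = sc c (H0 f)" if "f \<in> carrier F" for f
      using E.lin_ext_scale[OF vc, of f c] that by (simp add: F_sel H0_def)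
    then show ?thesis using that by (auto simp: tensor_algebra_def I.Q_carrier I.Q_smult lift(1))
  qed
  moreover have "quot_lift H0 (pt x y) = g x y" if "x \<in> carrier A" "y \<in> carrier B" for x y
    using that g by (simp add: pure_tensor_def lift(1) pr)
  ultimately show ?thesis using that by blast
qed

end

section \<open>The quantum three-sphere\<close>

fun letter_deg :: "'g \<Rightarrow> 'g letter \<Rightarrow> int" where
  "letter_deg g (Gen h) = (if h = g then 1 else 0)"
| "letter_deg g (Adj h) = (if h = g then -1 else 0)"

definition word_deg :: "'g \<Rightarrow> 'g letter list \<Rightarrow> int" where
  "word_deg g w = sum_list (map (letter_deg g) w)"

lemma word_deg_simps [simp]:
  "word_deg g [] = 0" "word_deg g (L # w) = letter_deg g L + word_deg g w"
  "word_deg g (v @ w) = word_deg g v + word_deg g w"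
  by (simp_all add: word_deg_def)

text \<open>Integer powers, with the adjoint in place of the inverse.\<close>

definition gen_pow :: "'g \<Rightarrow> int \<Rightarrow> 'g letter list" where
  "gen_pow g i = (if i \<ge> 0 then replicate (nat i) (Gen g) else replicate (nat (- i)) (Adj g))"

lemma set_gen_pow: "set (gen_pow g i) \<subseteq> {Gen g, Adj g}"
  by (auto simp: gen_pow_def)

lemma word_deg_gen_pow [simp]: "word_deg h (gen_pow g i) = (if h = g then i else 0)"
  by (auto simp: gen_pow_def word_deg_def sum_list_replicate)

lemma gen_pow_0 [simp]: "gen_pow g 0 = []"
  by (simp add: gen_pow_def)

lemma gen_pow_succ: "i \<ge> 0 \<Longrightarrow> gen_pow g (i + 1) = Gen g # gen_pow g i"
  by (simp add: gen_pow_def nat_add_distrib)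

lemma gen_pow_pred: "i \<le> 0 \<Longrightarrow> gen_pow g (i - 1) = Adj g # gen_pow g i"
proof -
  assume "i \<le> 0"
  then have "nat (- (i - 1)) = Suc (nat (- i))" by simp
  then show ?thesis using \<open>i \<le> 0\<close> by (cases "i = 0") (simp_all add: gen_pow_def)
qed

text \<open>The algebra is a structure parameter, so that operations without subscript are its
  operations.\<close>

locale heegaard =
  fixes p q \<theta> :: real and R (structure)
  assumes p: "0 < p" "p < 1" and q: "0 < q" "q < 1"
    and R_def: "R = O_S3 p q \<theta>"
begin

definition \<omega> :: complex where "\<omega> = exp (2 * pi * \<i> * \<theta>)"

lemma \<omega>_nz [simp]: "\<omega> \<noteq> 0" by (simp add: \<omega>_def)

lemma cnj_\<omega>: "cnj \<omega> = inverse \<omega>"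
proof -
  have "\<omega> = cis (2 * pi * \<theta>)" by (simp add: \<omega>_def cis_conv_exp mult_ac)
  then show ?thesis by (simp add: cis_cnj)
qed

abbreviation "rels \<equiv> heegaard_relators p q \<theta>"
abbreviation "K \<equiv> cls rels"

lemma R_star_alg: "star_alg R"
  unfolding R_def O_S3_def by (rule presented_star_alg)

sublocale R: star_alg R by (rule R_star_alg)

lemma K_carrier [simp]: "K w \<in> carrier R"
  unfolding R_def O_S3_def by simp

lemma K_append: "K (v @ w) = K v \<otimes> K w"
  unfolding R_def O_S3_def by (rule cls_append)

lemma K_Nil [simp]: "K [] = \<one>"
  unfolding R_def O_S3_def by (rule cls_Nil)

lemma K_star: "star R (K w) = K (rev (map letter_adj w))"
  unfolding R_def O_S3_def by (rule cls_star)

lemma R_induct [consumes 1, case_names word add]: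
  assumes "x \<in> carrier R"
    and "\<And>c w. Q (c \<odot> K w)"
    and "\<And>x y. x \<in> carrier R \<Longrightarrow> y \<in> carrier R \<Longrightarrow> Q x \<Longrightarrow> Q y \<Longrightarrow> Q (x \<oplus> y)"
  shows "Q x"
  using assms unfolding R_def O_S3_def by (rule presented_induct)

lemma R_hom_exists:
  assumes "scalar_ring E sc" and "\<And>L. h L \<in> carrier E"
    and rel: "\<And>H r. ring_hom_ring free_star_algebra E H \<Longrightarrow>
       (\<And>c x. H (c \<odot>\<^bsub>free_star_algebra\<^esub> x) = sc c (H x)) \<Longrightarrow>
       (\<And>L. H (single [L] 1) = h L) \<Longrightarrow> r \<in> rels \<Longrightarrow>
       H r = \<zero>\<^bsub>E\<^esub> \<and> H (star free_star_algebra r) = \<zero>\<^bsub>E\<^esub>"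
  shows "\<exists>H. ring_hom_ring R E H \<and> (\<forall>c. \<forall>x\<in>carrier R. H (c \<odot> x) = sc c (H x)) \<and> (\<forall>L. H (K [L]) = h L)"
proof -
  obtain H where "ring_hom_ring (presented_star_algebra rels) E H"
    "\<And>c x. x \<in> carrier (presented_star_algebra rels) \<Longrightarrow> H (c \<odot>\<^bsub>presented_star_algebra rels\<^esub> x) = sc c (H x)"
    "\<And>L. H (K [L]) = h L"
    using presented_hom_exists[of E sc h rels, OF assms(1,2) rel] by blast
  then show ?thesis unfolding R_def O_S3_def by blast
qed

lemma R_hom_star:
  assumes "star_alg E" "ring_hom_ring R E H"
    and "\<And>c x. x \<in> carrier R \<Longrightarrow> H (c \<odot> x) = c \<odot>\<^bsub>E\<^esub> H x"
    and "\<And>L. H (K [letter_adj L]) = star E (H (K [L]))" and "x \<in> carrier R"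
  shows "H (star R x) = star E (H x)"
  using presented_hom_star[OF assms(1), of rels H x] assms(2-) unfolding R_def O_S3_def by blast

abbreviation "a \<equiv> K [Gen Ga]"
abbreviation "a' \<equiv> K [Adj Ga]"
abbreviation "b \<equiv> K [Gen Gb]"
abbreviation "b' \<equiv> K [Adj Gb]"

lemma S3_gens: "S3_a p q \<theta> = a" "S3_b p q \<theta> = b"
  by (simp_all add: S3_a_def S3_b_def presented_gen_cls)

definition "A0 = \<one> \<ominus> a \<otimes> a'"
definition "B0 = \<one> \<ominus> b \<otimes> b'"

lemma A0_carrier [simp]: "A0 \<in> carrier R" and B0_carrier [simp]: "B0 \<in> carrier R"
  by (simp_all add: A0_def B0_def)

lemma rels_cases:
  assumes "r \<in> rels"
  obtains "r = free_gen Ga \<otimes>\<^bsub>free_star_algebra\<^esub> free_gen Gb \<ominus>\<^bsub>free_star_algebra\<^esub> \<omega> \<odot>\<^bsub>free_star_algebra\<^esub> (free_gen Gb \<otimes>\<^bsub>free_star_algebra\<^esub> free_gen Ga)"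
  | "r = free_gen Ga \<otimes>\<^bsub>free_star_algebra\<^esub> star free_star_algebra (free_gen Gb) \<ominus>\<^bsub>free_star_algebra\<^esub> inverse \<omega> \<odot>\<^bsub>free_star_algebra\<^esub> (star free_star_algebra (free_gen Gb) \<otimes>\<^bsub>free_star_algebra\<^esub> free_gen Ga)"
  | "r = star free_star_algebra (free_gen Ga) \<otimes>\<^bsub>free_star_algebra\<^esub> free_gen Ga \<ominus>\<^bsub>free_star_algebra\<^esub> of_real p \<odot>\<^bsub>free_star_algebra\<^esub> (free_gen Ga \<otimes>\<^bsub>free_star_algebra\<^esub> star free_star_algebra (free_gen Ga))
        \<ominus>\<^bsub>free_star_algebra\<^esub> of_real (1 - p) \<odot>\<^bsub>free_star_algebra\<^esub> \<one>\<^bsub>free_star_algebra\<^esub>"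
  | "r = star free_star_algebra (free_gen Gb) \<otimes>\<^bsub>free_star_algebra\<^esub> free_gen Gb \<ominus>\<^bsub>free_star_algebra\<^esub> of_real q \<odot>\<^bsub>free_star_algebra\<^esub> (free_gen Gb \<otimes>\<^bsub>free_star_algebra\<^esub> star free_star_algebra (free_gen Gb))
        \<ominus>\<^bsub>free_star_algebra\<^esub> of_real (1 - q) \<odot>\<^bsub>free_star_algebra\<^esub> \<one>\<^bsub>free_star_algebra\<^esub>"
  | "r = (\<one>\<^bsub>free_star_algebra\<^esub> \<ominus>\<^bsub>free_star_algebra\<^esub> free_gen Ga \<otimes>\<^bsub>free_star_algebra\<^esub> star free_star_algebra (free_gen Ga)) \<otimes>\<^bsub>free_star_algebra\<^esub> (\<one>\<^bsub>free_star_algebra\<^esub> \<ominus>\<^bsub>free_star_algebra\<^esub> free_gen Gb \<otimes>\<^bsub>free_star_algebra\<^esub> star free_star_algebra (free_gen Gb))"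
proof -
  have exp: "exp (2 * pi * \<i> * \<theta>) = \<omega>" "exp (- (2 * pi * \<i> * \<theta>)) = inverse \<omega>"
    by (simp_all add: \<omega>_def exp_minus)
  show ?thesis using assms that unfolding heegaard_relators_def Let_def exp by auto
qed

lemma relations:
  "a \<otimes> b = \<omega> \<odot> (b \<otimes> a)"
  "a \<otimes> b' = inverse \<omega> \<odot> (b' \<otimes> a)"
  "a' \<otimes> a \<ominus> of_real p \<odot> (a \<otimes> a') = of_real (1 - p) \<odot> \<one>"
  "b' \<otimes> b \<ominus> of_real q \<odot> (b \<otimes> b') = of_real (1 - q) \<odot> \<one>"
  "A0 \<otimes> B0 = \<zero>"
proof -
  let ?F = "free_star_algebra :: heegaard_gen star_poly star_algebra"
  define \<pi> where "\<pi> = (+>\<^bsub>?F\<^esub>) (relation_ideal rels)"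
  interpret \<pi>: ring_hom_ring ?F R \<pi>
    unfolding \<pi>_def R_def O_S3_def by (rule presented_hom)
  have sm: "\<pi> (c \<odot>\<^bsub>?F\<^esub> x) = c \<odot> \<pi> x" for c x
    unfolding \<pi>_def R_def O_S3_def by (simp add: presented_smult)
  have gen: "\<pi> (free_gen g) = K [Gen g]" "\<pi> (star ?F (free_gen g)) = K [Adj g]" for g
    by (simp add: \<pi>_def cls_def free_gen_def, simp add: \<pi>_def cls_def free_star_gen)
  have rel: "\<pi> r = \<zero>" if "r \<in> rels" for r
    using presented_relation[OF that] by (simp add: \<pi>_def R_def O_S3_def)
  have minus: "\<pi> (x \<ominus>\<^bsub>?F\<^esub> y) = \<pi> x \<ominus> \<pi> y" for x y
    by (simp add: a_minus_def)
  note rels = rel[unfolded heegaard_relators_def Let_def]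
  note hom = minus sm gen \<pi>.hom_mult \<pi>.hom_one
  have "a \<otimes> b \<ominus> \<omega> \<odot> (b \<otimes> a) = \<zero>"
    using rels[OF insertI1] by (simp add: hom \<omega>_def)
  then show "a \<otimes> b = \<omega> \<odot> (b \<otimes> a)"
    by (rule R.minus_eq_zeroD[rotated 2]) auto
  have "a \<otimes> b' \<ominus> inverse \<omega> \<odot> (b' \<otimes> a) = \<zero>"
    using rels[OF insertI2[OF insertI1]] by (simp add: hom \<omega>_def exp_minus)
  then show "a \<otimes> b' = inverse \<omega> \<odot> (b' \<otimes> a)"
    by (rule R.minus_eq_zeroD[rotated 2]) auto
  have "(a' \<otimes> a \<ominus> of_real p \<odot> (a \<otimes> a')) \<ominus> of_real (1 - p) \<odot> \<one> = \<zero>"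
    using rels[OF insertI2[OF insertI2[OF insertI1]]] by (simp add: hom)
  then show "a' \<otimes> a \<ominus> of_real p \<odot> (a \<otimes> a') = of_real (1 - p) \<odot> \<one>"
    by (rule R.minus_eq_zeroD[rotated 2]) auto
  have "(b' \<otimes> b \<ominus> of_real q \<odot> (b \<otimes> b')) \<ominus> of_real (1 - q) \<odot> \<one> = \<zero>"
    using rels[OF insertI2[OF insertI2[OF insertI2[OF insertI1]]]] by (simp add: hom)
  then show "b' \<otimes> b \<ominus> of_real q \<odot> (b \<otimes> b') = of_real (1 - q) \<odot> \<one>"
    by (rule R.minus_eq_zeroD[rotated 2]) auto
  show "A0 \<otimes> B0 = \<zero>"
    using rels[OF insertI2[OF insertI2[OF insertI2[OF insertI2[OF insertI1]]]]]
    by (simp add: hom A0_def B0_def)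
qed

lemma star_gens [simp]: "star R a = a'" "star R b = b'" "star R a' = a" "star R b' = b"
  by (simp_all add: K_star)

lemma star_A0 [simp]: "star R A0 = A0" and star_B0 [simp]: "star R B0 = B0"
  by (simp_all add: A0_def B0_def R.star_minus R.star_mult)

lemma smult_cancel: "x \<in> carrier R \<Longrightarrow> c \<noteq> 0 \<Longrightarrow> inverse c \<odot> (c \<odot> x) = x"
  by (simp add: R.sc_sc)

text \<open>The first two are the given relations, the other two their adjoints.\<close>

lemma exchange:
  "b \<otimes> a = inverse \<omega> \<odot> (a \<otimes> b)"
  "b' \<otimes> a = \<omega> \<odot> (a \<otimes> b')"
  "b \<otimes> a' = \<omega> \<odot> (a' \<otimes> b)"
  "b' \<otimes> a' = inverse \<omega> \<odot> (a' \<otimes> b')"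
proof -
  show 1: "b \<otimes> a = inverse \<omega> \<odot> (a \<otimes> b)"
    by (simp add: relations(1) R.sc_sc)
  show 2: "b' \<otimes> a = \<omega> \<odot> (a \<otimes> b')"
    by (simp add: relations(2) R.sc_sc)
  have "star R (a \<otimes> b') = star R (inverse \<omega> \<odot> (b' \<otimes> a))" by (simp only: relations(2))
  then show "b \<otimes> a' = \<omega> \<odot> (a' \<otimes> b)"
    by (simp add: R.star_mult R.star_smult cnj_\<omega>)
  have "star R (a \<otimes> b) = star R (\<omega> \<odot> (b \<otimes> a))" by (simp only: relations(1))
  then show "b' \<otimes> a' = inverse \<omega> \<odot> (a' \<otimes> b')"
    by (simp add: R.star_mult R.star_smult cnj_\<omega>)
qed

lemma aa': "a \<otimes> a' = \<one> \<ominus> A0" and bb': "b \<otimes> b' = \<one> \<ominus> B0"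
  by (simp_all add: A0_def B0_def a_minus_def R.minus_add R.r_neg R.r_neg1 flip: R.a_assoc)

text \<open>The relation \<open>a\<^sup>*a - p aa\<^sup>* = 1 - p\<close> solved for \<open>a\<^sup>*a\<close> in terms of \<open>1 - aa\<^sup>*\<close>.\<close>

lemma adjoint_product:
  assumes x: "x \<in> carrier R" and y: "y \<in> carrier R" and z: "z = \<one> \<ominus> x"
    and eq: "y \<ominus> c \<odot> x = (1 - c) \<odot> \<one>"
  shows "y = \<one> \<ominus> c \<odot> z"
proof -
  have "y = (1 - c) \<odot> \<one> \<oplus> c \<odot> x"
    using x y eq by (simp add: a_minus_def R.a_assoc R.l_neg flip: eq)
  also have "(1 - c) \<odot> \<one> = \<one> \<ominus> c \<odot> \<one>"
    using R.sc_add_left[of "\<one>" 1 "- c"] by (simp add: R.sc_minus a_minus_def)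
  finally show ?thesis
    using x by (simp add: z a_minus_def R.sc_add_right R.sc_a_inv R.minus_add R.a_assoc)
qed

lemma a'a: "a' \<otimes> a = \<one> \<ominus> of_real p \<odot> A0"
  by (rule adjoint_product[OF _ _ A0_def]) (use relations(3) in simp_all)

lemma b'b: "b' \<otimes> b = \<one> \<ominus> of_real q \<odot> B0"
  by (rule adjoint_product[OF _ _ B0_def]) (use relations(4) in simp_all)

text \<open>Conjugation by such an element rescales \<open>A\<close> and \<open>B\<close>. The property passes to products,
  so that it is enough to check it on the four letters.\<close>

definition normalises :: "heegaard_gen star_poly set \<Rightarrow> bool" where
  "normalises t \<longleftrightarrow> t \<in> carrier R \<and> (\<exists>c c'. c \<noteq> 0 \<and> c' \<noteq> 0 \<and>
     t \<otimes> A0 = c \<odot> (A0 \<otimes> t) \<and> t \<otimes> B0 = c' \<odot> (B0 \<otimes> t))"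

text \<open>With \<open>z = 1 - xx\<^sup>*\<close>, both \<open>x (1 - x\<^sup>*x)\<close> and \<open>(1 - xx\<^sup>*) x\<close> equal \<open>x - xx\<^sup>*x\<close>.\<close>

lemma complement_rescaled:
  assumes "x \<in> carrier R" "x' \<in> carrier R" and z: "z = \<one> \<ominus> x \<otimes> x'"
    and "x' \<otimes> x = \<one> \<ominus> c \<odot> z" and c: "c \<noteq> 0"
  shows "x \<otimes> z = inverse c \<odot> (z \<otimes> x)" "x' \<otimes> z = c \<odot> (z \<otimes> x')"
proof -
  have zc: "z \<in> carrier R" using assms by simp
  have cz: "c \<odot> z = \<one> \<ominus> x' \<otimes> x"
    using assms(4) zc by (simp add: a_minus_def R.minus_add R.r_neg2)
  have "c \<odot> (x \<otimes> z) = x \<otimes> (c \<odot> z)" using assms(1) zc by (simp add: R.sc_mult_right)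
  also have "\<dots> = z \<otimes> x"
    unfolding cz using assms(1,2) by (simp add: z a_minus_def R.l_distr R.r_distr R.l_minus R.r_minus R.m_assoc)
  finally show "x \<otimes> z = inverse c \<odot> (z \<otimes> x)"
    using smult_cancel[of "x \<otimes> z" c] assms(1) zc c by simp
  have "c \<odot> (z \<otimes> x') = (c \<odot> z) \<otimes> x'" using assms(2) zc by (simp add: R.sc_mult_left)
  also have "\<dots> = x' \<otimes> z"
    unfolding cz using assms(1,2) by (simp add: z a_minus_def R.l_distr R.r_distr R.l_minus R.r_minus R.m_assoc)
  finally show "x' \<otimes> z = c \<odot> (z \<otimes> x')" by simp
qed

text \<open>The phases picked up on the way past \<open>y\<close> and past \<open>y\<^sup>*\<close> cancel.\<close>

lemma complement_commutes:
  assumes x: "x \<in> carrier R" "y \<in> carrier R" "y' \<in> carrier R" and c: "c \<noteq> 0"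
    and "x \<otimes> y = c \<odot> (y \<otimes> x)" "x \<otimes> y' = inverse c \<odot> (y' \<otimes> x)"
  shows "x \<otimes> (\<one> \<ominus> y \<otimes> y') = 1 \<odot> ((\<one> \<ominus> y \<otimes> y') \<otimes> x)"
proof -
  have "x \<otimes> (y \<otimes> y') = c \<odot> (y \<otimes> (x \<otimes> y'))"
    using x assms(5) by (simp add: R.sc_mult_left R.m_assoc flip: R.m_assoc[of x y y'])
  also have "\<dots> = y \<otimes> y' \<otimes> x"
    using x assms(6) c by (simp add: R.sc_mult_right R.sc_sc R.m_assoc)
  finally show ?thesis
    using x by (simp add: a_minus_def R.l_distr R.r_distr R.l_minus R.r_minus)
qed

lemma normalises_letter: "normalises (K [L])"
proof (cases L)
  case (Gen g)
  show ?thesis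
  proof (cases g)
    case Ga
    have "a \<otimes> B0 = 1 \<odot> (B0 \<otimes> a)"
      unfolding B0_def by (rule complement_commutes[of _ _ _ \<omega>]) (use relations in simp_all)
    moreover have "a \<otimes> A0 = inverse (of_real p) \<odot> (A0 \<otimes> a)"
      by (rule complement_rescaled(1)[OF _ _ A0_def a'a]) (use p in simp_all)
    ultimately show ?thesis
      unfolding normalises_def \<open>L = Gen g\<close> \<open>g = Ga\<close> using p
      by (intro conjI K_carrier exI[of _ "inverse (of_real p)"] exI[of _ 1]) simp_all
  next
    case Gb
    have "b \<otimes> A0 = 1 \<odot> (A0 \<otimes> b)"
      unfolding A0_def by (rule complement_commutes[of _ _ _ "inverse \<omega>"]) (use exchange in simp_all)
    moreover have "b \<otimes> B0 = inverse (of_real q) \<odot> (B0 \<otimes> b)"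
      by (rule complement_rescaled(1)[OF _ _ B0_def b'b]) (use q in simp_all)
    ultimately show ?thesis
      unfolding normalises_def \<open>L = Gen g\<close> \<open>g = Gb\<close> using q
      by (intro conjI K_carrier exI[of _ "inverse (of_real q)"] exI[of _ 1]) simp_all
  qed
next
  case (Adj g)
  show ?thesis
  proof (cases g)
    case Ga
    have "a' \<otimes> B0 = 1 \<odot> (B0 \<otimes> a')"
      unfolding B0_def
      by (rule complement_commutes[of _ _ _ "inverse \<omega>"]) (simp_all add: exchange R.sc_sc)
    moreover have "a' \<otimes> A0 = of_real p \<odot> (A0 \<otimes> a')"
      by (rule complement_rescaled(2)[OF _ _ A0_def a'a]) (use p in simp_all)
    ultimately show ?thesis
      unfolding normalises_def \<open>L = Adj g\<close> \<open>g = Ga\<close> using p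
      by (intro conjI K_carrier exI[of _ "of_real p"] exI[of _ 1]) simp_all
  next
    case Gb
    have "b' \<otimes> A0 = 1 \<odot> (A0 \<otimes> b')"
      unfolding A0_def by (rule complement_commutes[of _ _ _ \<omega>]) (use exchange in simp_all)
    moreover have "b' \<otimes> B0 = of_real q \<odot> (B0 \<otimes> b')"
      by (rule complement_rescaled(2)[OF _ _ B0_def b'b]) (use q in simp_all)
    ultimately show ?thesis
      unfolding normalises_def \<open>L = Adj g\<close> \<open>g = Gb\<close> using q
      by (intro conjI K_carrier exI[of _ "of_real q"] exI[of _ 1]) simp_all
  qed
qed

lemma pass_mult:
  assumes "s \<in> carrier R" "t \<in> carrier R" "z \<in> carrier R"
    "s \<otimes> z = c \<odot> (z \<otimes> s)" "t \<otimes> z = d \<odot> (z \<otimes> t)"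
  shows "(s \<otimes> t) \<otimes> z = (c * d) \<odot> (z \<otimes> (s \<otimes> t))"
proof -
  have "(s \<otimes> t) \<otimes> z = d \<odot> (s \<otimes> (z \<otimes> t))"
    using assms by (simp add: R.m_assoc R.sc_mult_right)
  also have "s \<otimes> (z \<otimes> t) = (s \<otimes> z) \<otimes> t"
    using assms(1-3) by (simp only: R.m_assoc)
  finally show ?thesis using assms by (simp add: R.m_assoc R.sc_mult_left R.sc_sc mult.commute)
qed

lemma normalises_mult: "normalises s \<Longrightarrow> normalises t \<Longrightarrow> normalises (s \<otimes> t)"
  unfolding normalises_def
  apply (elim conjE exE)
  subgoal for c d c' d'
    by (intro conjI exI[of _ "c * d"] exI[of _ "c' * d'"] pass_mult) simp_all
  done

lemma normalises_word: "normalises (K w)"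
proof (induction w)
  case Nil
  show ?case by (auto simp: normalises_def intro!: exI[of _ 1])
next
  case (Cons L w)
  then show ?case using normalises_mult[OF normalises_letter[of L] Cons] K_append[of "[L]" w] by simp
qed

end

context heegaard
begin

section \<open>The coefficient algebra and normal forms\<close>

text \<open>The subalgebra generated by \<open>A\<close> and \<open>B\<close>. Mixed products of powers are absent from the
  spanning set because \<open>AB = BA = 0\<close>; closure under products is \<open>D_mult\<close>. It is a copy of the
  coordinate ring of two crossing lines.\<close>

inductive_set D :: "heegaard_gen star_poly set set" where
  D_A0_pow: "A0 [^] (n::nat) \<in> D"
| D_B0_pow: "B0 [^] (n::nat) \<in> D"
| D_add: "d \<in> D \<Longrightarrow> e \<in> D \<Longrightarrow> d \<oplus> e \<in> D"
| D_smult: "d \<in> D \<Longrightarrow> c \<odot> d \<in> D"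

lemma D_carrier [simp]: "d \<in> D \<Longrightarrow> d \<in> carrier R"
  by (induction rule: D.induct) auto

lemma D_one [simp]: "\<one> \<in> D"
  using D_A0_pow[of 0] by simp

lemma D_A0 [simp]: "A0 \<in> D" and D_B0 [simp]: "B0 \<in> D"
  using D_A0_pow[of 1] D_B0_pow[of 1] by simp_all

lemma D_zero [simp]: "\<zero> \<in> D"
  using D_smult[OF D_one, of 0] by simp

lemma D_a_inv: "d \<in> D \<Longrightarrow> \<ominus> d \<in> D"
  using D_smult[of d "-1"] by (simp add: R.sc_minus)

lemma D_minus: "d \<in> D \<Longrightarrow> e \<in> D \<Longrightarrow> d \<ominus> e \<in> D"
  by (simp add: a_minus_def D_add D_a_inv)

lemma B0_A0: "B0 \<otimes> A0 = \<zero>"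
  using arg_cong[OF relations(5), of "star R"] by (simp add: R.star_mult)

lemma A0_B0_pow:
  "A0 [^] Suc m \<otimes> B0 [^] Suc n = \<zero>"
  "B0 [^] Suc m \<otimes> A0 [^] Suc n = \<zero>"
proof -
  have *: "x [^] Suc m \<otimes> y [^] Suc n = \<zero>"
    if "x \<in> carrier R" "y \<in> carrier R" "x \<otimes> y = \<zero>" for x y
  proof -
    have "x [^] Suc m \<otimes> y [^] Suc n = x [^] m \<otimes> (x \<otimes> y) \<otimes> y [^] n"
      unfolding R.nat_pow_Suc2[OF that(2)] using that(1,2) by (simp add: R.m_assoc)
    then show ?thesis using that by simp
  qed
  show "A0 [^] Suc m \<otimes> B0 [^] Suc n = \<zero>"
    by (rule *) (simp_all add: relations)
  show "B0 [^] Suc m \<otimes> A0 [^] Suc n = \<zero>"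
    by (rule *) (simp_all add: B0_A0)
qed

lemma D_pow_mult:
  "A0 [^] (m::nat) \<otimes> B0 [^] (n::nat) \<in> D"
  "B0 [^] (m::nat) \<otimes> A0 [^] (n::nat) \<in> D"
  "A0 [^] (m::nat) \<otimes> B0 [^] (n::nat) = B0 [^] n \<otimes> A0 [^] m"
proof -
  have 0: "A0 [^] (0::nat) = \<one>" "B0 [^] (0::nat) = \<one>" by simp_all
  have pc: "A0 [^] m \<in> carrier R" "B0 [^] n \<in> carrier R" for m n :: nat by simp_all
  show "A0 [^] m \<otimes> B0 [^] n \<in> D"
    by (cases m; cases n) (simp_all only: A0_B0_pow 0 R.l_one R.r_one R.one_closed pc D_A0_pow D_B0_pow D_zero D_one)
  show "B0 [^] m \<otimes> A0 [^] n \<in> D"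
    by (cases m; cases n) (simp_all only: A0_B0_pow 0 R.l_one R.r_one R.one_closed pc D_A0_pow D_B0_pow D_zero D_one)
  show "A0 [^] m \<otimes> B0 [^] n = B0 [^] n \<otimes> A0 [^] m"
    by (cases m; cases n) (simp_all only: A0_B0_pow 0 R.l_one R.r_one R.one_closed pc)
qed

lemma D_mult:
  assumes "d \<in> D" "e \<in> D"
  shows "d \<otimes> e \<in> D"
  using assms(1)
proof (induction rule: D.induct)
  case (D_A0_pow m)
  from assms(2) show ?case
    by (induction rule: D.induct)
       (auto simp: R.nat_pow_mult D_pow_mult R.r_distr R.sc_mult_right intro: D.intros)
next
  case (D_B0_pow m)
  from assms(2) show ?case
    by (induction rule: D.induct)
       (auto simp: R.nat_pow_mult D_pow_mult R.r_distr R.sc_mult_right intro: D.intros)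
qed (use assms(2) in \<open>auto simp: R.l_distr R.sc_mult_left intro: D.intros\<close>)

lemma D_comm:
  assumes "d \<in> D" "e \<in> D"
  shows "d \<otimes> e = e \<otimes> d"
  using assms(1)
proof (induction rule: D.induct)
  case (D_A0_pow m)
  from assms(2) show ?case
    by (induction rule: D.induct)
       (auto simp: R.nat_pow_mult D_pow_mult(3) add.commute R.l_distr R.r_distr R.sc_mult_right R.sc_mult_left)
next
  case (D_B0_pow m)
  from assms(2) show ?case
    by (induction rule: D.induct)
       (auto simp: R.nat_pow_mult D_pow_mult(3) add.commute R.l_distr R.r_distr R.sc_mult_right R.sc_mult_left)
qed (use assms(2) in \<open>auto simp: R.l_distr R.r_distr R.sc_mult_left R.sc_mult_right\<close>)

lemma pass_pow:
  assumes "t \<in> carrier R" "z \<in> carrier R" "t \<otimes> z = c \<odot> (z \<otimes> t)"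
  shows "t \<otimes> z [^] (n::nat) = c ^ n \<odot> (z [^] n \<otimes> t)"
proof (induction n)
  case (Suc n)
  have "t \<otimes> z [^] Suc n = (t \<otimes> z [^] n) \<otimes> z"
    using assms by (simp add: R.m_assoc)
  also have "\<dots> = c ^ n \<odot> (z [^] n \<otimes> (t \<otimes> z))"
    using assms(1,2) Suc by (simp add: R.m_assoc R.sc_mult_left)
  finally show ?case
    using assms by (simp add: R.m_assoc R.sc_mult_right R.sc_sc mult.commute)
qed (use assms in simp)

text \<open>Conjugation by \<open>t\<close> rescales the spanning elements of \<open>D\<close> by non-zero factors, hence
  maps \<open>D\<close> onto itself.\<close>

lemma normalises_coefficients:
  assumes "normalises t" "d \<in> D"
  shows normalises_push: "\<exists>e\<in>D. t \<otimes> d = e \<otimes> t"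
    and normalises_pull: "\<exists>e\<in>D. t \<otimes> e = d \<otimes> t"
proof -
  obtain c c' where t: "t \<in> carrier R" and nz: "c \<noteq> 0" "c' \<noteq> 0"
    and c: "t \<otimes> A0 = c \<odot> (A0 \<otimes> t)" and c': "t \<otimes> B0 = c' \<odot> (B0 \<otimes> t)"
    using assms(1) unfolding normalises_def by blast
  have pow: "(\<exists>e\<in>D. t \<otimes> z [^] n = e \<otimes> t) \<and> (\<exists>e\<in>D. t \<otimes> e = z [^] n \<otimes> t)"
    if z: "z \<in> carrier R" "z [^] n \<in> D" "t \<otimes> z = u \<odot> (z \<otimes> t)" "u \<noteq> 0" for z u and n :: nat
  proof (intro conjI bexI)
    show "t \<otimes> z [^] n = (u ^ n \<odot> z [^] n) \<otimes> t"
      using pass_pow[OF t z(1,3)] t z(1) by (simp add: R.sc_mult_left)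
    show "t \<otimes> (inverse u ^ n \<odot> z [^] n) = z [^] n \<otimes> t"
      using pass_pow[OF t z(1,3)] t z(1,4)
      by (simp add: R.sc_mult_right R.sc_sc flip: power_mult_distrib)
  qed (use z(2) in \<open>auto intro: D_smult\<close>)
  have "(\<exists>e\<in>D. t \<otimes> d = e \<otimes> t) \<and> (\<exists>e\<in>D. t \<otimes> e = d \<otimes> t)"
    using assms(2)
  proof (induction rule: D.induct)
    case (D_A0_pow n)
    show ?case by (rule pow[OF A0_carrier D.D_A0_pow c nz(1)])
  next
    case (D_B0_pow n)
    show ?case by (rule pow[OF B0_carrier D.D_B0_pow c' nz(2)])
  next
    case (D_add d e)
    then obtain d1 e1 d2 e2 where "d1 \<in> D" "e1 \<in> D" "d2 \<in> D" "e2 \<in> D"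
      "t \<otimes> d = d1 \<otimes> t" "t \<otimes> e = e1 \<otimes> t" "t \<otimes> d2 = d \<otimes> t" "t \<otimes> e2 = e \<otimes> t" by blast
    then show ?case
      using t D_add by (intro conjI bexI[of _ "d1 \<oplus> e1"] bexI[of _ "d2 \<oplus> e2"])
        (auto simp: R.l_distr R.r_distr intro: D.intros)
  next
    case (D_smult d c)
    then obtain d1 d2 where "d1 \<in> D" "d2 \<in> D" "t \<otimes> d = d1 \<otimes> t" "t \<otimes> d2 = d \<otimes> t" by blast
    then show ?case
      using t D_smult by (intro conjI bexI[of _ "c \<odot> d1"] bexI[of _ "c \<odot> d2"])
        (auto simp: R.sc_mult_left R.sc_mult_right intro: D.intros)
  qed
  then show "\<exists>e\<in>D. t \<otimes> d = e \<otimes> t" "\<exists>e\<in>D. t \<otimes> e = d \<otimes> t" by blast+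
qed

lemmas K_push = normalises_push[OF normalises_word]
lemmas K_pull = normalises_pull[OF normalises_word]

text \<open>If the letter cancels against the first letter of the power, then the product of the two
  is \<open>1 - A\<close>, \<open>1 - pA\<close>, \<open>1 - B\<close> or \<open>1 - qB\<close>, an element of \<open>D\<close>.\<close>

lemma letter_gen_pow:
  assumes "L \<in> {Gen g, Adj g}"
  shows "\<exists>d\<in>D. K (L # gen_pow g i) = d \<otimes> K (gen_pow g (letter_deg g L + i))"
proof -
  have one: "\<exists>d\<in>D. K w = d \<otimes> K w" for w
    by (rule bexI[of _ "\<one>"]) auto
  have inD: "K [Gen g, Adj g] \<in> D" "K [Adj g, Gen g] \<in> D"
    using K_append[of "[Gen g]" "[Adj g]"] K_append[of "[Adj g]" "[Gen g]"]
    by (cases g; auto simp: aa' bb' a'a b'b intro!: D_minus D_smult)+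
  have two: "K (v @ w) = K v \<otimes> K w" for v w by (rule K_append)
  consider "L = Gen g" "i \<ge> 0" | "L = Gen g" "i < 0" | "L = Adj g" "i \<le> 0" | "L = Adj g" "i > 0"
    using assms by fastforce
  then show ?thesis
  proof cases
    case 1 then show ?thesis using one gen_pow_succ[of i g] by (simp add: add.commute)
  next
    case 2
    then have "gen_pow g i = Adj g # gen_pow g (i + 1)" using gen_pow_pred[of "i + 1" g] by simp
    then show ?thesis using 2 two[of "[Gen g, Adj g]" "gen_pow g (i + 1)"] inD
      by (auto simp: add.commute)
  next
    case 3 then show ?thesis using one gen_pow_pred[of i g] by simp
  next
    case 4
    then have "gen_pow g i = Gen g # gen_pow g (i - 1)" using gen_pow_succ[of "i - 1" g] by simp
    then show ?thesis using 4 two[of "[Adj g, Gen g]" "gen_pow g (i - 1)"] inD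
      by auto
  qed
qed

lemma letters_exchange:
  "L \<in> {Gen Gb, Adj Gb} \<Longrightarrow> M \<in> {Gen Ga, Adj Ga} \<Longrightarrow> \<exists>c. c \<noteq> 0 \<and> K [L] \<otimes> K [M] = c \<odot> (K [M] \<otimes> K [L])"
  using exchange \<omega>_nz inverse_nonzero_iff_nonzero[of \<omega>]
  by (elim insertE emptyE) (metis (no_types))+

lemma pass_word:
  assumes t: "t \<in> carrier R"
    and "\<And>M. M \<in> set w \<Longrightarrow> \<exists>c. c \<noteq> 0 \<and> t \<otimes> K [M] = c \<odot> (K [M] \<otimes> t)"
  shows "\<exists>c. c \<noteq> 0 \<and> t \<otimes> K w = c \<odot> (K w \<otimes> t)"
  using assms(2)
proof (induction w)
  case Nil
  show ?case using t by (intro exI[of _ 1]) simp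
next
  case (Cons M w)
  obtain c where c: "c \<noteq> 0" "t \<otimes> K w = c \<odot> (K w \<otimes> t)" using Cons by auto
  obtain d where d: "d \<noteq> 0" "t \<otimes> K [M] = d \<odot> (K [M] \<otimes> t)" using Cons.prems[of M] by auto
  have "t \<otimes> (K [M] \<otimes> K w) = (t \<otimes> K [M]) \<otimes> K w"
    using t by (simp add: R.m_assoc)
  also have "\<dots> = d \<odot> (K [M] \<otimes> (t \<otimes> K w))"
    unfolding d(2) using t by (simp add: R.m_assoc R.sc_mult_left)
  also have "\<dots> = (d * c) \<odot> ((K [M] \<otimes> K w) \<otimes> t)"
    unfolding c(2) using t by (simp add: R.m_assoc R.sc_mult_right R.sc_sc)
  finally show ?case
    using c d K_append[of "[M]" w] by (intro exI[of _ "d * c"]) simp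
qed

lemma exchange_sym:
  assumes "s \<in> carrier R" "t \<in> carrier R" "\<exists>c. c \<noteq> 0 \<and> s \<otimes> t = c \<odot> (t \<otimes> s)"
  shows "\<exists>c. c \<noteq> 0 \<and> t \<otimes> s = c \<odot> (s \<otimes> t)"
proof -
  obtain c where "c \<noteq> 0" "s \<otimes> t = c \<odot> (t \<otimes> s)" using assms(3) by blast
  then show ?thesis
    using assms(1,2) by (intro exI[of _ "inverse c"]) (simp add: R.sc_sc)
qed

lemma words_exchange:
  assumes "set v \<subseteq> {Gen Gb, Adj Gb}" "set w \<subseteq> {Gen Ga, Adj Ga}"
  shows "\<exists>c. c \<noteq> 0 \<and> K v \<otimes> K w = c \<odot> (K w \<otimes> K v)"
proof (rule pass_word)
  fix M assume M: "M \<in> set w"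
  have "\<exists>c. c \<noteq> 0 \<and> K [M] \<otimes> K v = c \<odot> (K v \<otimes> K [M])"
  proof (rule pass_word)
    fix L assume "L \<in> set v"
    then have "\<exists>c. c \<noteq> 0 \<and> K [L] \<otimes> K [M] = c \<odot> (K [M] \<otimes> K [L])"
      using assms M by (intro letters_exchange) blast+
    then show "\<exists>c. c \<noteq> 0 \<and> K [M] \<otimes> K [L] = c \<odot> (K [L] \<otimes> K [M])"
      by (rule exchange_sym[rotated 2]) simp_all
  qed simp
  then show "\<exists>c. c \<noteq> 0 \<and> K v \<otimes> K [M] = c \<odot> (K [M] \<otimes> K v)"
    by (rule exchange_sym[rotated 2]) simp_all
qed simp

text \<open>The word \<open>a\<^sup>i b\<^sup>j\<close>.\<close>

definition nf :: "int \<Rightarrow> int \<Rightarrow> heegaard_gen letter list" where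
  "nf i j = gen_pow Ga i @ gen_pow Gb j"

lemma word_deg_nf [simp]: "word_deg Ga (nf i j) = i" "word_deg Gb (nf i j) = j"
  by (simp_all add: nf_def)

text \<open>A further letter on the left is moved past the coefficient by \<open>K_push\<close>, and past the
  power of \<open>a\<close> if it belongs to \<open>b\<close>, until it meets the power of its own generator. The
  coefficient in \<open>D\<close> that appears there is moved back to the left end.\<close>

lemma normal_form:
  "\<exists>d\<in>D. K w = d \<otimes> K (nf (word_deg Ga w) (word_deg Gb w))"
proof (induction w)
  case Nil
  show ?case by (rule bexI[of _ "\<one>"]) (auto simp: nf_def)
next
  case (Cons L w)
  define i j where ij: "i = word_deg Ga w" "j = word_deg Gb w"
  obtain d where d: "d \<in> D" "K w = d \<otimes> K (nf i j)" using Cons unfolding ij by blast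
  obtain e where e: "e \<in> D" "K [L] \<otimes> d = e \<otimes> K [L]" using K_push d(1) by blast
  have "K (L # w) = K [L] \<otimes> K w" using K_append[of "[L]" w] by simp
  also have "\<dots> = (K [L] \<otimes> d) \<otimes> K (nf i j)" using d by (simp add: R.m_assoc)
  also have "\<dots> = e \<otimes> (K [L] \<otimes> K (gen_pow Ga i) \<otimes> K (gen_pow Gb j))"
    unfolding e(2) using e(1) by (simp add: R.m_assoc nf_def K_append)
  finally have eq: "K (L # w) = e \<otimes> (K [L] \<otimes> K (gen_pow Ga i) \<otimes> K (gen_pow Gb j))" .
  have app: "K [L] \<otimes> K v = K (L # v)" for v using K_append[of "[L]" v] by simp
  consider "L \<in> {Gen Ga, Adj Ga}" | "L \<in> {Gen Gb, Adj Gb}"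
    by (cases L; use heegaard_gen.exhaust in blast)
  then show ?case
  proof cases
    case 1
    obtain f where f: "f \<in> D" "K (L # gen_pow Ga i) = f \<otimes> K (gen_pow Ga (letter_deg Ga L + i))"
      using letter_gen_pow[OF 1] by blast
    have "letter_deg Gb L = 0" using 1 by auto
    then have "K (L # w) = (e \<otimes> f) \<otimes> K (nf (word_deg Ga (L # w)) (word_deg Gb (L # w)))"
      unfolding eq app f(2) using e(1) f(1) by (simp add: R.m_assoc nf_def K_append ij)
    then show ?thesis using D_mult e(1) f(1) by blast
  next
    case 2
    obtain c where c: "K [L] \<otimes> K (gen_pow Ga i) = c \<odot> (K (gen_pow Ga i) \<otimes> K [L])"
      using words_exchange[of "[L]" "gen_pow Ga i"] 2 set_gen_pow[of Ga i] by auto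
    obtain f where f: "f \<in> D" "K (L # gen_pow Gb j) = f \<otimes> K (gen_pow Gb (letter_deg Gb L + j))"
      using letter_gen_pow[OF 2] by blast
    obtain f' where f': "f' \<in> D" "K (gen_pow Ga i) \<otimes> f = f' \<otimes> K (gen_pow Ga i)"
      using K_push[OF f(1)] by blast
    have deg: "letter_deg Ga L = 0" using 2 by auto
    have "K [L] \<otimes> K (gen_pow Ga i) \<otimes> K (gen_pow Gb j) =
        c \<odot> (K (gen_pow Ga i) \<otimes> K (L # gen_pow Gb j))"
      unfolding c by (simp add: R.m_assoc R.sc_mult_left app)
    also have "\<dots> = c \<odot> ((K (gen_pow Ga i) \<otimes> f) \<otimes> K (gen_pow Gb (letter_deg Gb L + j)))"
      unfolding f(2) using f(1) by (simp add: R.m_assoc)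
    also have "\<dots> = (c \<odot> f') \<otimes> K (nf i (letter_deg Gb L + j))"
      unfolding f'(2) using f'(1) by (simp add: R.m_assoc R.sc_mult_left nf_def K_append)
    finally have "K (L # w) = (e \<otimes> (c \<odot> f')) \<otimes> K (nf (word_deg Ga (L # w)) (word_deg Gb (L # w)))"
      unfolding eq using deg e(1) f'(1) by (simp add: R.m_assoc ij)
    then show ?thesis using D_mult[OF e(1) D_smult[OF f'(1)]] by blast
  qed
qed

end

section \<open>A faithful representation\<close>

definition lin_ops :: "(('s \<Rightarrow> complex) \<Rightarrow> ('s \<Rightarrow> complex)) ring" where
  "lin_ops = \<lparr>carrier = {T. (\<forall>\<phi> \<psi>. T (\<lambda>s. \<phi> s + \<psi> s) = (\<lambda>s. T \<phi> s + T \<psi> s)) \<and>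
                         (\<forall>c \<psi>. T (\<lambda>s. c * \<psi> s) = (\<lambda>s. c * T \<psi> s))},
     mult = (\<circ>), one = id, zero = (\<lambda>\<psi> s. 0), add = (\<lambda>S T \<psi> s. S \<psi> s + T \<psi> s)\<rparr>"

lemma lin_ops_sel:
  "mult lin_ops = (\<circ>)" "one lin_ops = id" "zero lin_ops = (\<lambda>\<psi> s. 0)"
  "add lin_ops = (\<lambda>S T \<psi> s. S \<psi> s + T \<psi> s)"
  by (simp_all add: lin_ops_def)

lemma lin_opsI:
  assumes "\<And>\<phi> \<psi> s. T (\<lambda>s. \<phi> s + \<psi> s) s = T \<phi> s + T \<psi> s" "\<And>c \<psi> s. T (\<lambda>s. c * \<psi> s) s = c * T \<psi> s"
  shows "T \<in> carrier lin_ops"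
  using assms by (auto simp: lin_ops_def)

lemma lin_opsD:
  assumes "T \<in> carrier lin_ops"
  shows "T (\<lambda>s. \<phi> s + \<psi> s) = (\<lambda>s. T \<phi> s + T \<psi> s)" "T (\<lambda>s. c * \<psi> s) = (\<lambda>s. c * T \<psi> s)"
    "T (\<lambda>s. 0) = (\<lambda>s. 0)"
proof -
  show "T (\<lambda>s. \<phi> s + \<psi> s) = (\<lambda>s. T \<phi> s + T \<psi> s)" and *: "T (\<lambda>s. c * \<psi> s) = (\<lambda>s. c * T \<psi> s)" for c \<psi>
    using assms by (auto simp: lin_ops_def)
  show "T (\<lambda>s. 0) = (\<lambda>s. 0)" using *[of 0] by simp
qed

interpretation lin_ops: scalar_ring lin_ops "\<lambda>c T \<psi> s. c * T \<psi> s"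
proof -
  interpret ring "lin_ops :: (('s \<Rightarrow> complex) \<Rightarrow> ('s \<Rightarrow> complex)) ring"
  proof (intro ringI abelian_groupI monoidI)
    fix T :: "('s \<Rightarrow> complex) \<Rightarrow> ('s \<Rightarrow> complex)" assume T: "T \<in> carrier lin_ops"
    have "(\<lambda>\<psi> s. - T \<psi> s) \<in> carrier lin_ops"
      by (rule lin_opsI) (auto simp: lin_opsD[OF T])
    then show "\<exists>y\<in>carrier lin_ops. y \<oplus>\<^bsub>lin_ops\<^esub> T = \<zero>\<^bsub>lin_ops\<^esub>"
      by (rule bexI[rotated]) (auto simp: lin_ops_sel)
  qed (auto intro!: lin_opsI simp: lin_opsD lin_ops_sel algebra_simps fun_eq_iff)
  show "scalar_ring lin_ops (\<lambda>c (T::('s \<Rightarrow> complex) \<Rightarrow> ('s \<Rightarrow> complex)) \<psi> s. c * T \<psi> s)"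
    by unfold_locales
       (auto intro!: lin_opsI simp: lin_opsD lin_ops_sel algebra_simps fun_eq_iff)
qed

lemma lin_ops_minus:
  assumes "S \<in> carrier lin_ops" "T \<in> carrier lin_ops"
  shows "S \<ominus>\<^bsub>lin_ops\<^esub> T = (\<lambda>\<psi> s. S \<psi> s - T \<psi> s)"
proof -
  have "(\<lambda>\<psi> s. - T \<psi> s) \<in> carrier lin_ops"
    by (rule lin_opsI) (auto simp: lin_opsD[OF assms(2)])
  then have "\<ominus>\<^bsub>lin_ops\<^esub> T = (\<lambda>\<psi> s. - T \<psi> s)"
    by (intro lin_ops.minus_equality assms(2)) (auto simp: lin_ops_sel)
  then show ?thesis by (simp add: a_minus_def lin_ops_sel)
qed

type_synonym model_point = "real \<times> int \<times> int"

context heegaard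
begin

text \<open>The eigenvalues of \<open>A\<close> and \<open>B\<close> in the representation. As \<open>t\<close> runs through the reals,
  \<open>(min t 0, min (- t) 0)\<close> runs through the pairs of non-positive numbers with product 0: the
  product has to vanish because \<open>AB = 0\<close>, the sign keeps \<open>1 - A\<close> and \<open>1 - B\<close> away from 0, and
  both half lines are infinite, so that polynomials are determined by their values there.\<close>

definition A_val :: "real \<Rightarrow> int \<Rightarrow> complex" where
  "A_val t i = of_real (p powi i * min t 0)"

definition B_val :: "real \<Rightarrow> int \<Rightarrow> complex" where
  "B_val t j = of_real (q powi j * min (- t) 0)"

lemma A_B_val: "A_val t i * B_val t j = 0"
  by (cases "t \<le> 0") (auto simp: A_val_def B_val_def min_def)

lemma A_val_succ: "A_val t (i + 1) = of_real p * A_val t i" and B_val_succ: "B_val t (i + 1) = of_real q * B_val t i"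
  using p q by (simp_all add: A_val_def B_val_def power_int_add)

lemma val_nz: "1 - A_val t i \<noteq> 0" "1 - B_val t i \<noteq> 0"
proof -
  have "p powi i * min t 0 \<le> 0" "q powi i * min (- t) 0 \<le> 0"
    using p q by (auto intro!: mult_nonneg_nonpos)
  then have "p powi i * min t 0 \<noteq> 1" "q powi i * min (- t) 0 \<noteq> 1" by linarith+
  then show "1 - A_val t i \<noteq> 0" "1 - B_val t i \<noteq> 0"
    unfolding A_val_def B_val_def by (metis eq_iff_diff_eq_0 of_real_eq_1_iff)+
qed

text \<open>The representation comes from the skew Laurent ring over \<open>D\<close>: \<open>a\<close> is an invertible shift
  \<open>U\<close> and \<open>a\<^sup>*\<close> acts as \<open>(1 - pA) U\<^sup>-\<^sup>1\<close>, which is not its adjoint; likewise for \<open>b\<close>, with a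
  phase that depends on the first coordinate and produces the commutation of \<open>a\<close> with \<open>b\<close>.\<close>

fun letter_op :: "heegaard_gen letter \<Rightarrow> (model_point \<Rightarrow> complex) \<Rightarrow> model_point \<Rightarrow> complex" where
  "letter_op (Gen Ga) \<psi> (t, i, j) = \<psi> (t, i - 1, j)"
| "letter_op (Adj Ga) \<psi> (t, i, j) = (1 - A_val t (i + 1)) * \<psi> (t, i + 1, j)"
| "letter_op (Gen Gb) \<psi> (t, i, j) = \<omega> powi (- i) * \<psi> (t, i, j - 1)"
| "letter_op (Adj Gb) \<psi> (t, i, j) = \<omega> powi i * (1 - B_val t (j + 1)) * \<psi> (t, i, j + 1)"

lemma letter_op_lin: "letter_op L \<in> carrier lin_ops"
proof (rule lin_opsI)
  fix \<phi> \<psi> :: "model_point \<Rightarrow> complex" and c and s :: model_point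
  obtain t i j where s: "s = (t, i, j)" by (cases s)
  show "letter_op L (\<lambda>s. \<phi> s + \<psi> s) s = letter_op L \<phi> s + letter_op L \<psi> s"
    unfolding s by (cases "(L, \<psi>, t, i, j)" rule: letter_op.cases) (auto simp: algebra_simps)
  show "letter_op L (\<lambda>s. c * \<psi> s) s = c * letter_op L \<psi> s"
    unfolding s by (cases "(L, \<psi>, t, i, j)" rule: letter_op.cases) (auto simp: algebra_simps)
qed

abbreviation op_scale :: "complex \<Rightarrow> ((model_point \<Rightarrow> complex) \<Rightarrow> model_point \<Rightarrow> complex) \<Rightarrow> (model_point \<Rightarrow> complex) \<Rightarrow> model_point \<Rightarrow> complex"
  where "op_scale \<equiv> \<lambda>c T \<psi> s. c * T \<psi> s"

lemma rep_exists:
  "\<exists>H. ring_hom_ring R lin_ops H \<and> (\<forall>c. \<forall>x\<in>carrier R. H (c \<odot> x) = op_scale c (H x)) \<and>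
       (\<forall>L. H (K [L]) = letter_op L)"
proof -
  let ?F = "free_star_algebra :: heegaard_gen star_poly star_algebra"
  have rel: "H r = \<zero>\<^bsub>lin_ops\<^esub> \<and> H (star ?F r) = \<zero>\<^bsub>lin_ops\<^esub>"
    if "ring_hom_ring ?F lin_ops H"
    and sm: "\<And>c x. H (c \<odot>\<^bsub>?F\<^esub> x) = op_scale c (H x)"
    and gen: "\<And>L. H (single [L] 1) = letter_op L" and r: "r \<in> rels" for H r
  proof -
  interpret H: ring_hom_ring ?F lin_ops H by fact
  have Hc: "H x \<in> carrier lin_ops" for x by simp
  have minus: "H (x \<ominus>\<^bsub>?F\<^esub> y) = (\<lambda>\<psi> s. H x \<psi> s - H y \<psi> s)" for x y
    using lin_ops_minus[OF Hc Hc, of x y] by (simp add: a_minus_def)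
  have mult: "H (x \<otimes>\<^bsub>?F\<^esub> y) = H x \<circ> H y" for x y
    using H.hom_mult[of x y] by (simp add: lin_ops_sel)
  have one: "H \<one>\<^bsub>?F\<^esub> = id" using H.hom_one by (simp add: lin_ops_sel)
  have gens: "H (free_gen g) = letter_op (Gen g)" "H (star ?F (free_gen g)) = letter_op (Adj g)" for g
    by (simp_all add: gen free_star_gen, simp add: free_gen_def gen)
  have sub: "letter_op L (\<lambda>s. \<phi> s - \<psi> s) = (\<lambda>s. letter_op L \<phi> s - letter_op L \<psi> s)" for L \<phi> \<psi>
    using lin_opsD(1)[OF letter_op_lin, of L "\<lambda>s. \<phi> s - \<psi> s" \<psi>] by (simp add: fun_eq_iff algebra_simps)
  note star = free.star_minus free.star_mult free.star_smult
  note eval = minus mult one gens sm cnj_\<omega> lin_ops_sel fun_eq_iff power_int_add power_int_diff power_int_minus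
    A_val_succ B_val_succ sub
  from r show "H r = \<zero>\<^bsub>lin_ops\<^esub> \<and> H (star ?F r) = \<zero>\<^bsub>lin_ops\<^esub>"
  proof (cases rule: rels_cases)
    case 1 then show ?thesis by (simp add: star eval) (simp add: field_simps)?
  next
    case 2 then show ?thesis by (simp add: star eval) (simp add: field_simps)?
  next
    case 3 then show ?thesis by (simp add: star eval) (simp add: field_simps)?
  next
    case 4 then show ?thesis by (simp add: star eval) (simp add: field_simps)?
  next
    case 5
    have "A_val t i = 0 \<or> B_val t j = 0" for t i j using A_B_val[of t i j] by simp
    note disj = this
    show ?thesis unfolding 5 by (simp add: star eval A_B_val, simp add: field_simps) (use disj in blast)
  qed
  qed
  show ?thesis
    by (rule R_hom_exists[OF lin_ops.scalar_ring_axioms letter_op_lin rel])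
qed

definition rep :: "heegaard_gen star_poly set \<Rightarrow> (model_point \<Rightarrow> complex) \<Rightarrow> model_point \<Rightarrow> complex" where
  "rep = (SOME H. ring_hom_ring R lin_ops H \<and> (\<forall>c. \<forall>x\<in>carrier R. H (c \<odot> x) = op_scale c (H x)) \<and>
       (\<forall>L. H (K [L]) = letter_op L))"

lemma rep_hom: "ring_hom_ring R lin_ops rep"
  and rep_smult: "x \<in> carrier R \<Longrightarrow> rep (c \<odot> x) = op_scale c (rep x)"
  and rep_letter: "rep (K [L]) = letter_op L"
  using someI_ex[OF rep_exists, folded rep_def] by blast+

lemma rep_add: "x \<in> carrier R \<Longrightarrow> y \<in> carrier R \<Longrightarrow> rep (x \<oplus> y) = (\<lambda>\<psi> s. rep x \<psi> s + rep y \<psi> s)"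
  and rep_mult: "x \<in> carrier R \<Longrightarrow> y \<in> carrier R \<Longrightarrow> rep (x \<otimes> y) \<psi> = rep x (rep y \<psi>)"
  and rep_one: "rep \<one> = id"
  and rep_zero: "rep \<zero> \<psi> s = 0"
proof -
  interpret rep: ring_hom_ring R lin_ops rep by (rule rep_hom)
  show "x \<in> carrier R \<Longrightarrow> y \<in> carrier R \<Longrightarrow> rep (x \<oplus> y) = (\<lambda>\<psi> s. rep x \<psi> s + rep y \<psi> s)"
    "x \<in> carrier R \<Longrightarrow> y \<in> carrier R \<Longrightarrow> rep (x \<otimes> y) \<psi> = rep x (rep y \<psi>)"
    "rep \<one> = id" "rep \<zero> \<psi> s = 0"
    by (simp_all add: lin_ops_sel)
qed

lemma rep_A0: "rep A0 \<psi> (t, i, j) = A_val t i * \<psi> (t, i, j)"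
  and rep_B0: "rep B0 \<psi> (t, i, j) = B_val t j * \<psi> (t, i, j)"
proof -
  have *: "rep (\<one> \<ominus> x) \<psi> s = \<psi> s - rep x \<psi> s" if x: "x \<in> carrier R" for x s
  proof -
    have "\<one> \<ominus> x = \<one> \<oplus> (-1) \<odot> x"
      using x by (simp add: a_minus_def R.sc_minus)
    then show ?thesis using x by (simp add: rep_add rep_smult rep_one)
  qed
  show "rep A0 \<psi> (t, i, j) = A_val t i * \<psi> (t, i, j)"
    by (simp add: A0_def * rep_mult rep_letter algebra_simps)
  show "rep B0 \<psi> (t, i, j) = B_val t j * \<psi> (t, i, j)"
    by (simp add: B0_def * rep_mult rep_letter power_int_minus field_simps)
qed

text \<open>A polynomial in \<open>z\<close> of degree at most \<open>n\<close>.\<close>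

definition pol :: "heegaard_gen star_poly set \<Rightarrow> nat \<Rightarrow> (nat \<Rightarrow> complex) \<Rightarrow> heegaard_gen star_poly set" where
  "pol z n f = (\<Oplus>k\<in>{..n}. f k \<odot> z [^] k)"

lemma pol_carrier [simp]: "z \<in> carrier R \<Longrightarrow> pol z n f \<in> carrier R"
  by (auto simp: pol_def)

lemma pol_pad: "n \<le> m \<Longrightarrow> z \<in> carrier R \<Longrightarrow> (\<And>k. k > n \<Longrightarrow> f k = 0) \<Longrightarrow> pol z n f = pol z m f"
  unfolding pol_def by (intro R.add.finprod_mono_neutral_cong_left) auto

lemma pol_add: "z \<in> carrier R \<Longrightarrow> pol z n (\<lambda>k. f k + g k) = pol z n f \<oplus> pol z n g"
  unfolding pol_def by (simp add: R.sc_add_left Pi_iff cong: R.finsum_cong)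

lemma pol_smult: "z \<in> carrier R \<Longrightarrow> pol z n (\<lambda>k. c * f k) = c \<odot> pol z n f"
proof (induction n)
  case (Suc n)
  then show ?case
    by (simp add: pol_def R.sc_add_right R.sc_sc Pi_iff del: R.nat_pow_Suc)
qed (simp add: pol_def R.sc_sc)

lemma pol_const: "z \<in> carrier R \<Longrightarrow> (\<And>k. 0 < k \<Longrightarrow> k \<le> n \<Longrightarrow> f k = 0) \<Longrightarrow> pol z n f = f 0 \<odot> \<one>"
proof (induction n)
  case (Suc n)
  then show ?case by (simp add: pol_def Pi_iff del: R.nat_pow_Suc)
qed (simp add: pol_def)

lemma rep_pol:
  assumes "z \<in> carrier R" "\<And>\<psi> i j. rep z \<psi> (t, i, j) = v i j * \<psi> (t, i, j)"
  shows "rep (pol z n f) \<psi> (t, i, j) = (\<Sum>k\<le>n. f k * v i j ^ k) * \<psi> (t, i, j)"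
proof -
  have pow: "rep (z [^] k) \<psi> (t, i, j) = v i j ^ k * \<psi> (t, i, j)" for k :: nat and \<psi>
    by (induction k arbitrary: \<psi>) (use assms in \<open>simp_all add: rep_one rep_mult\<close>)
  show ?thesis
    by (induction n) (use assms(1) pow in
      \<open>simp_all add: pol_def Pi_iff rep_add rep_smult rep_one rep_mult assms(2) distrib_right mult.left_commute\<close>)
qed

lemma D_pol:
  assumes "d \<in> D"
  shows "\<exists>n f g. (\<forall>k>n. f k = 0 \<and> g k = 0) \<and> d = pol A0 n f \<oplus> pol B0 n g"
  using assms
proof (induction rule: D.induct)
  case (D_A0_pow n)
  have "pol A0 n (\<lambda>k. if k = n then 1 else 0) = A0 [^] n"
  proof -
    have "pol A0 n (\<lambda>k. if k = n then 1 else 0) = (\<Oplus>k\<in>{..n}. if n = k then A0 [^] k else \<zero>)"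
      unfolding pol_def by (rule R.finsum_cong') auto
    then show ?thesis using R.add.finprod_singleton[of n "{..n}" "\<lambda>k. A0 [^] k"] by simp
  qed
  then show ?case
    by (intro exI[of _ n] exI[of _ "\<lambda>k. if k = n then 1 else 0"] exI[of _ "\<lambda>k. 0"]) (simp add: pol_const)
next
  case (D_B0_pow n)
  have "pol B0 n (\<lambda>k. if k = n then 1 else 0) = B0 [^] n"
  proof -
    have "pol B0 n (\<lambda>k. if k = n then 1 else 0) = (\<Oplus>k\<in>{..n}. if n = k then B0 [^] k else \<zero>)"
      unfolding pol_def by (rule R.finsum_cong') auto
    then show ?thesis using R.add.finprod_singleton[of n "{..n}" "\<lambda>k. B0 [^] k"] by simp
  qed
  then show ?case
    by (intro exI[of _ n] exI[of _ "\<lambda>k. 0"] exI[of _ "\<lambda>k. if k = n then 1 else 0"]) (simp add: pol_const)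
next
  case (D_add d e)
  then obtain n f g m f' g' where d: "\<forall>k>n. f k = 0 \<and> g k = 0" "d = pol A0 n f \<oplus> pol B0 n g"
    and e: "\<forall>k>m. f' k = 0 \<and> g' k = 0" "e = pol A0 m f' \<oplus> pol B0 m g'" by blast
  have "d = pol A0 (max n m) f \<oplus> pol B0 (max n m) g"
    unfolding d(2) using pol_pad[of n "max n m"] d(1) by simp
  moreover have "e = pol A0 (max n m) f' \<oplus> pol B0 (max n m) g'"
    unfolding e(2) using pol_pad[of m "max n m"] e(1) by simp
  ultimately have "d \<oplus> e = pol A0 (max n m) (\<lambda>k. f k + f' k) \<oplus> pol B0 (max n m) (\<lambda>k. g k + g' k)"
    by (simp add: pol_add R.a_ac)
  then show ?case using d(1) e(1)
    by (intro exI[of _ "max n m"] exI[of _ "\<lambda>k. f k + f' k"] exI[of _ "\<lambda>k. g k + g' k"]) auto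
next
  case (D_smult d c)
  then obtain n f g where d: "\<forall>k>n. f k = 0 \<and> g k = 0" "d = pol A0 n f \<oplus> pol B0 n g" by blast
  then show ?case
    by (intro exI[of _ n] exI[of _ "\<lambda>k. c * f k"] exI[of _ "\<lambda>k. c * g k"]) (simp add: pol_smult R.sc_add_right)
qed

text \<open>The polynomial \<open>f + c\<close> has infinitely many roots.\<close>

lemma poly_fun_const_on_nonpos:
  fixes f :: "nat \<Rightarrow> complex"
  assumes "\<And>x::real. x \<le> 0 \<Longrightarrow> (\<Sum>k\<le>n. f k * of_real x ^ k) + c = 0" "0 < k" "k \<le> n"
  shows "f k = 0"
proof (rule ccontr)
  assume nz: "f k \<noteq> 0"
  define f' where "f' k = (if k = 0 then f 0 + c else f k)" for k
  have "(\<Sum>k\<le>n. f' k * z ^ k) = (\<Sum>k\<le>n. f k * z ^ k) + c" for z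
    by (induction n) (auto simp: f'_def)
  then have "of_real ` {..(0::real)} \<subseteq> {z. (\<Sum>k\<le>n. f' k * z ^ k) = 0}"
    using assms(1) by auto
  moreover have "finite {z. (\<Sum>k\<le>n. f' k * z ^ k) = 0}"
  proof -
    have "\<exists>i\<le>n. f' i \<noteq> 0" using nz assms(2,3) by (intro exI[of _ k]) (simp add: f'_def)
    then show ?thesis using polyfun_finite_roots[of f' n] by blast
  qed
  ultimately have "finite (of_real ` {..(0::real)} :: complex set)" by (rule finite_subset)
  then have "finite {..(0::real)}" by (rule finite_imageD) (simp add: inj_on_def)
  then show False using infinite_Iic by blast
qed

text \<open>An element \<open>f(A) + g(B)\<close> acts by multiplication. If the multiplier vanishes at one
  position \<open>(i, j)\<close> for all \<open>t\<close>, then \<open>f(x) + g(0) = 0\<close> and \<open>f(0) + g(y) = 0\<close> for all \<open>x, y \<le> 0\<close>;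
  hence \<open>f\<close> and \<open>g\<close> are constants with sum 0.\<close>

lemma D_values:
  assumes "d \<in> D"
  obtains F where "\<And>\<psi> t i j. rep d \<psi> (t, i, j) = F t i j * \<psi> (t, i, j)"
    "\<And>i j. (\<And>t. F t i j = 0) \<Longrightarrow> d = \<zero>"
proof -
  obtain n f g where d: "d = pol A0 n f \<oplus> pol B0 n g" using D_pol[OF assms] by blast
  define F where "F t i j = (\<Sum>k\<le>n. f k * A_val t i ^ k) + (\<Sum>k\<le>n. g k * B_val t j ^ k)" for t i j
  have "rep d \<psi> (t, i, j) = F t i j * \<psi> (t, i, j)" for \<psi> t i j
    using rep_pol[of A0 t "\<lambda>i j. A_val t i" n f \<psi> i j] rep_pol[of B0 t "\<lambda>i j. B_val t j" n g \<psi> i j]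
    by (simp add: d rep_add rep_A0 rep_B0 F_def distrib_right)
  moreover have "d = \<zero>" if F: "\<And>t. F t i j = 0" for i j
  proof -
    have pos: "p powi i > 0" "q powi j > 0" using p q by auto
    have sum0: "(\<Sum>k\<le>n. h k * 0 ^ k) = h 0" for h :: "nat \<Rightarrow> complex"
      by (induction n) auto
    have x: "(\<Sum>k\<le>n. f k * of_real x ^ k) + g 0 = 0" if "x \<le> 0" for x :: real
    proof -
      \<comment> \<open>the parameter at which \<open>A\<close> has the value \<open>x\<close> and \<open>B\<close> the value 0\<close>
      define t where "t = x / p powi i"
      have "t \<le> 0" using that pos by (simp add: t_def divide_nonpos_pos)
      then have "A_val t i = of_real x" "B_val t j = 0" using pos p q by (simp_all add: A_val_def B_val_def t_def)
      then show ?thesis using F[of t] by (simp add: F_def sum0)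
    qed
    have y: "(\<Sum>k\<le>n. g k * of_real y ^ k) + f 0 = 0" if "y \<le> 0" for y :: real
    proof -
      define t where "t = - y / q powi j"
      have "t \<ge> 0" using that pos by (simp add: t_def divide_nonpos_pos)
      then have "B_val t j = of_real y" "A_val t i = 0" using pos p q by (simp_all add: A_val_def B_val_def t_def)
      then show ?thesis using F[of t] by (simp add: F_def sum0 add.commute)
    qed
    have "pol A0 n f = f 0 \<odot> \<one>" "pol B0 n g = g 0 \<odot> \<one>"
      using poly_fun_const_on_nonpos[OF x] poly_fun_const_on_nonpos[OF y] by (auto intro!: pol_const)
    moreover have "f 0 + g 0 = 0" using x[of 0] by (simp add: sum0)
    ultimately show ?thesis by (simp add: d flip: R.sc_add_left)
  qed
  ultimately show ?thesis using that by blast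
qed

text \<open>The vacuum vector: applying a word to it records the bidegree of the word.\<close>

definition vac :: "model_point \<Rightarrow> complex" where
  "vac = (\<lambda>(t, i, j). if i = 0 \<and> j = 0 then 1 else 0)"

text \<open>Each letter multiplies the coefficient by 1, by a power of \<open>\<omega>\<close>, or by one of the factors
  of \<open>val_nz\<close>.\<close>

lemma rep_word_vac:
  "\<exists>c. (\<forall>t. c t \<noteq> 0) \<and> (\<forall>t i j. rep (K w) vac (t, i, j) = (if i = word_deg Ga w \<and> j = word_deg Gb w then c t else 0))"
proof (induction w)
  case Nil
  show ?case by (intro exI[of _ "\<lambda>_. 1"]) (auto simp: rep_one vac_def)
next
  case (Cons L w)
  define m n where mn: "m = word_deg Ga w" "n = word_deg Gb w"
  obtain c where c: "\<And>t. c t \<noteq> 0"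
    "\<And>t i j. rep (K w) vac (t, i, j) = (if i = m \<and> j = n then c t else 0)"
    using Cons unfolding mn by blast
  have rw: "rep (K (L # w)) vac = letter_op L (rep (K w) vac)"
    using K_append[of "[L]" w] by (simp add: rep_mult rep_letter)
  show ?case
  proof (cases L)
    case (Gen g)
    show ?thesis
    proof (cases g)
      case Ga
      show ?thesis unfolding rw using c Gen Ga
        by (intro exI[of _ c]) (auto simp: mn)
    next
      case Gb
      show ?thesis unfolding rw using c Gen Gb
        by (intro exI[of _ "\<lambda>t. \<omega> powi (- m) * c t"]) (auto simp: mn)
    qed
  next
    case (Adj g)
    show ?thesis
    proof (cases g)
      case Ga
      show ?thesis unfolding rw using c Adj Ga val_nz
        by (intro exI[of _ "\<lambda>t. (1 - A_val t m) * c t"]) (auto simp: mn)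
    next
      case Gb
      show ?thesis unfolding rw using c Adj Gb val_nz
        by (intro exI[of _ "\<lambda>t. \<omega> powi m * (1 - B_val t n) * c t"]) (auto simp: mn)
    qed
  qed
qed

lemma rep_finsum:
  "finite S \<Longrightarrow> x \<in> S \<rightarrow> carrier R \<Longrightarrow> rep (\<Oplus>s\<in>S. x s) \<psi> u = (\<Sum>s\<in>S. rep (x s) \<psi> u)"
  by (induction S rule: finite_induct) (auto simp: rep_zero rep_add Pi_iff)

lemma D_word_eq_zero:
  assumes "d \<in> D" and zero: "\<And>t. rep (d \<otimes> K w) vac (t, word_deg Ga w, word_deg Gb w) = 0"
  shows "d = \<zero>"
proof -
  obtain F where F: "\<And>\<psi> t i j. rep d \<psi> (t, i, j) = F t i j * \<psi> (t, i, j)"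
    "\<And>i j. (\<And>t. F t i j = 0) \<Longrightarrow> d = \<zero>" using D_values[OF assms(1)] by blast
  obtain c where c: "\<And>t. c t \<noteq> 0"
    "\<And>t i j. rep (K w) vac (t, i, j) = (if i = word_deg Ga w \<and> j = word_deg Gb w then c t else 0)"
    using rep_word_vac by blast
  have "F t (word_deg Ga w) (word_deg Gb w) = 0" for t
  proof -
    have "rep (d \<otimes> K w) vac (t, word_deg Ga w, word_deg Gb w) = F t (word_deg Ga w) (word_deg Gb w) * c t"
      using assms(1) by (simp only: rep_mult D_carrier K_carrier F(1) c(2) simp_thms if_True)
    then show ?thesis using zero[of t] c(1)[of t] by simp
  qed
  then show ?thesis by (rule F(2))
qed

lemma rep_D_word_vac:
  assumes "d \<in> D" "i \<noteq> word_deg Ga w \<or> j \<noteq> word_deg Gb w"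
  shows "rep (d \<otimes> K w) vac (t, i, j) = 0"
proof -
  obtain F where F: "\<And>\<psi> t i j. rep d \<psi> (t, i, j) = F t i j * \<psi> (t, i, j)"
    "\<And>i j. (\<And>t. F t i j = 0) \<Longrightarrow> d = \<zero>" using D_values[OF assms(1)] by blast
  obtain c where "\<forall>t i j. rep (K w) vac (t, i, j) = (if i = word_deg Ga w \<and> j = word_deg Gb w then c t else 0)"
    using rep_word_vac[of w] by (elim exE conjE) (rule that)
  then have "rep (K w) vac (t, i, j) = (if i = word_deg Ga w \<and> j = word_deg Gb w then c t else 0)" by (elim allE)
  moreover have "\<not> (i = word_deg Ga w \<and> j = word_deg Gb w)" using assms(2) by blast
  ultimately have "rep (K w) vac (t, i, j) = 0" by (simp only: if_False)
  then show ?thesis using assms(1) by (simp only: rep_mult D_carrier K_carrier F(1) mult_zero_right)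
qed

lemma rep_graded_sum:
  assumes "finite S" "d \<in> S \<rightarrow> D" and inj: "inj_on (\<lambda>s. (word_deg Ga (w s), word_deg Gb (w s))) S" and s: "s \<in> S"
  shows "rep (\<Oplus>s\<in>S. d s \<otimes> K (w s)) vac (t, word_deg Ga (w s), word_deg Gb (w s)) =
    rep (d s \<otimes> K (w s)) vac (t, word_deg Ga (w s), word_deg Gb (w s))"
proof -
  have "rep (\<Oplus>s\<in>S. d s \<otimes> K (w s)) vac (t, word_deg Ga (w s), word_deg Gb (w s)) =
      (\<Sum>r\<in>S. rep (d r \<otimes> K (w r)) vac (t, word_deg Ga (w s), word_deg Gb (w s)))"
    using assms by (intro rep_finsum) (auto simp: Pi_iff)
  also have "\<dots> = (\<Sum>r\<in>{s}. rep (d r \<otimes> K (w r)) vac (t, word_deg Ga (w s), word_deg Gb (w s)))"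
  proof (rule sum.mono_neutral_right)
    show "\<forall>r\<in>S - {s}. rep (d r \<otimes> K (w r)) vac (t, word_deg Ga (w s), word_deg Gb (w s)) = 0"
    proof
      fix r assume r: "r \<in> S - {s}"
      then have "word_deg Ga (w s) \<noteq> word_deg Ga (w r) \<or> word_deg Gb (w s) \<noteq> word_deg Gb (w r)"
        using inj_onD[OF inj, of s r] s by auto
      then show "rep (d r \<otimes> K (w r)) vac (t, word_deg Ga (w s), word_deg Gb (w s)) = 0"
        using r assms(2) by (intro rep_D_word_vac) auto
    qed
  qed (use assms in auto)
  finally show ?thesis by simp
qed

text \<open>The summands move the vacuum to different positions, so they vanish one by one.\<close>

lemma graded_sum_eq_zero:
  assumes "finite S" "d \<in> S \<rightarrow> D" "inj_on (\<lambda>s. (word_deg Ga (w s), word_deg Gb (w s))) S"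
    and zero: "(\<Oplus>s\<in>S. d s \<otimes> K (w s)) = \<zero>" and s: "s \<in> S"
  shows "d s = \<zero>"
proof (rule D_word_eq_zero)
  show "rep (d s \<otimes> K (w s)) vac (t, word_deg Ga (w s), word_deg Gb (w s)) = 0" for t
    using rep_graded_sum[OF assms(1-3) s, of t] by (simp add: zero rep_zero)
qed (use assms in auto)

lemma D_word_cancel: "d \<in> D \<Longrightarrow> e \<in> D \<Longrightarrow> d \<otimes> K w = e \<otimes> K w \<Longrightarrow> d = e"
proof -
  assume d: "d \<in> D" and e: "e \<in> D" and eq: "d \<otimes> K w = e \<otimes> K w"
  have "(d \<ominus> e) \<otimes> K w = d \<otimes> K w \<ominus> e \<otimes> K w"
    using d e by (simp add: a_minus_def R.l_distr R.l_minus)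
  also have "\<dots> = \<zero>"
    unfolding eq using e by (simp add: a_minus_def R.r_neg)
  finally have "d \<ominus> e = \<zero>"
    by (intro D_word_eq_zero[of _ w] D_minus d e) (simp only: rep_zero)
  then show ?thesis by (rule R.minus_eq_zeroD[OF D_carrier[OF d] D_carrier[OF e]])
qed

lemma K_nonzero: "K w \<noteq> \<zero>"
proof
  assume zero: "K w = \<zero>"
  obtain c where "\<And>t. c t \<noteq> 0"
    "\<And>t i j. rep (K w) vac (t, i, j) = (if i = word_deg Ga w \<and> j = word_deg Gb w then c t else 0)"
    using rep_word_vac by blast
  from this(1)[of 0] this(2)[of 0 "word_deg Ga w" "word_deg Gb w"] show False
    unfolding zero rep_zero by simp
qed

end

section \<open>The coaction\<close>

interpretation U: star_alg O_U1
  unfolding O_U1_def by (rule presented_star_alg)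

abbreviation "u_adj \<equiv> star O_U1 U1_u"

lemma U1_u_closed [simp]: "U1_u \<in> carrier O_U1"
  by (simp add: U1_u_def O_U1_def presented_gen_cls)

lemma U1_relations: "U1_u \<otimes>\<^bsub>O_U1\<^esub> u_adj = \<one>\<^bsub>O_U1\<^esub>" "u_adj \<otimes>\<^bsub>O_U1\<^esub> U1_u = \<one>\<^bsub>O_U1\<^esub>"
proof -
  let ?F = "free_star_algebra :: unit star_poly star_algebra"
  define \<pi> where "\<pi> = (+>\<^bsub>?F\<^esub>) (relation_ideal unitary_relators)"
  interpret \<pi>: ring_hom_ring ?F O_U1 \<pi>
    unfolding \<pi>_def O_U1_def by (rule presented_hom)
  have gen: "\<pi> (free_gen ()) = U1_u" "\<pi> (star ?F (free_gen ())) = u_adj"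
    by (simp add: \<pi>_def U1_u_def presented_gen_def,
        simp add: \<pi>_def U1_u_def O_U1_def presented_star_gen cls_def free_star_gen)
  have rel: "\<pi> r = \<zero>\<^bsub>O_U1\<^esub>" if "r \<in> unitary_relators" for r
    using presented_relation[OF that] by (simp add: \<pi>_def O_U1_def)
  have minus: "\<pi> (x \<ominus>\<^bsub>?F\<^esub> y) = \<pi> x \<ominus>\<^bsub>O_U1\<^esub> \<pi> y" for x y
    by (simp add: a_minus_def)
  note rels = rel[unfolded unitary_relators_def Let_def]
  have "U1_u \<otimes>\<^bsub>O_U1\<^esub> u_adj \<ominus>\<^bsub>O_U1\<^esub> \<one>\<^bsub>O_U1\<^esub> = \<zero>\<^bsub>O_U1\<^esub>"
    using rels[OF insertI1] by (simp add: minus gen)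
  then show "U1_u \<otimes>\<^bsub>O_U1\<^esub> u_adj = \<one>\<^bsub>O_U1\<^esub>"
    by (rule U.minus_eq_zeroD[rotated 2]) simp_all
  have "u_adj \<otimes>\<^bsub>O_U1\<^esub> U1_u \<ominus>\<^bsub>O_U1\<^esub> \<one>\<^bsub>O_U1\<^esub> = \<zero>\<^bsub>O_U1\<^esub>"
    using rels[OF insertI2[OF insertI1]] by (simp add: minus gen)
  then show "u_adj \<otimes>\<^bsub>O_U1\<^esub> U1_u = \<one>\<^bsub>O_U1\<^esub>"
    by (rule U.minus_eq_zeroD[rotated 2]) simp_all
qed

abbreviation u_pow :: "int \<Rightarrow> unit star_poly set" where
  "u_pow n \<equiv> U1_u [^]\<^bsub>O_U1\<^esub> n"

lemma U1_u_unit: "U1_u \<in> Units O_U1"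
  unfolding Units_def
  by (intro CollectI conjI bexI[of _ u_adj] U1_u_closed U.star_closed) (rule U1_relations)+

text \<open>The inverse in the definition of integer powers is the inverse of a unit, so that the
  power laws of the group of units apply.\<close>

lemma u_pow_units: "u_pow n = U1_u [^]\<^bsub>units_of O_U1\<^esub> n"
proof -
  have nat: "U1_u [^]\<^bsub>units_of O_U1\<^esub> m = U1_u [^]\<^bsub>O_U1\<^esub> m" for m :: nat
    by (simp only: nat_pow_def units_of_one units_of_mult)
  have unit: "U1_u [^]\<^bsub>O_U1\<^esub> m \<in> Units O_U1" for m :: nat
    by (induction m) (simp_all only: U.nat_pow_0 U.nat_pow_Suc U.Units_one_closed U.Units_m_closed U1_u_unit)
  show ?thesis
    unfolding int_pow_def2 nat U.units_of_inv[OF unit] ..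
qed

lemma u_pow_closed [simp]: "u_pow n \<in> carrier O_U1"
proof -
  interpret G: group "units_of O_U1" by (rule U.units_group)
  show ?thesis
    using G.int_pow_closed[of U1_u n] U1_u_unit U.Units_closed by (simp add: u_pow_units units_of_carrier)
qed

lemma u_pow_add: "u_pow (m + n) = u_pow m \<otimes>\<^bsub>O_U1\<^esub> u_pow n"
proof -
  interpret G: group "units_of O_U1" by (rule U.units_group)
  show ?thesis
    using G.int_pow_mult[of U1_u m n] U1_u_unit by (simp add: u_pow_units units_of_carrier units_of_mult)
qed

lemma u_pow_star: "star O_U1 (u_pow n) = u_pow (- n)"
proof -
  have nat: "star O_U1 (u_pow (int m)) = u_pow (- int m)" for m
  proof (induction m)
    case (Suc m)
    have inv: "u_pow (- 1) = u_adj"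
      using U1_relations U.inv_char[of U1_u u_adj] by (simp add: int_pow_def2)
    have "star O_U1 (u_pow (int (Suc m))) = star O_U1 (u_pow 1 \<otimes>\<^bsub>O_U1\<^esub> u_pow (int m))"
      by (simp flip: u_pow_add)
    also have "\<dots> = u_pow (- int m) \<otimes>\<^bsub>O_U1\<^esub> u_pow (- 1)"
      by (simp add: U.star_mult Suc inv) (simp add: int_pow_def2)
    also have "\<dots> = u_pow (- int m + - 1)" by (rule u_pow_add[symmetric])
    also have "- int m + - 1 = - int (Suc m)" by simp
    finally show ?case .
  qed simp
  show ?thesis
  proof (cases "n \<ge> 0")
    case True then show ?thesis using nat[of "nat n"] by simp
  next
    case False
    then have "star O_U1 (star O_U1 (u_pow (- n))) = star O_U1 (u_pow n)" using nat[of "nat (- n)"] by simp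
    then show ?thesis by simp
  qed
qed

lemma complex_scalar_ring: "scalar_ring complex_field (*)"
proof -
  have sel: "carrier complex_field = UNIV" "mult complex_field = (*)" "one complex_field = 1"
    "zero complex_field = 0" "add complex_field = (+)"
    by (simp_all add: complex_field_def)
  interpret ring complex_field
  proof (intro ringI abelian_groupI monoidI)
    fix x :: complex assume "x \<in> carrier complex_field"
    show "\<exists>y\<in>carrier complex_field. y \<oplus>\<^bsub>complex_field\<^esub> x = \<zero>\<^bsub>complex_field\<^esub>"
      by (rule bexI[of _ "- x"]) (auto simp: sel)
  qed (auto simp: sel algebra_simps)
  show ?thesis by unfold_locales (auto simp: sel algebra_simps)
qed

text \<open>Evaluation at \<open>u = 2\<close> with \<open>u\<^sup>* = 1/2\<close>, which is an algebra homomorphism although not a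
  star homomorphism. Any non-zero number that is not a root of unity would do: the point is that
  different powers of \<open>u\<close> get different values.\<close>

lemma U1_character:
  obtains ev where "ring_hom_ring O_U1 complex_field ev"
    "\<And>c x. x \<in> carrier O_U1 \<Longrightarrow> ev (c \<odot>\<^bsub>O_U1\<^esub> x) = c * ev x" "\<And>n. ev (u_pow n) = 2 powi n"
proof -
  interpret C: scalar_ring complex_field "(*)" by (rule complex_scalar_ring)
  have sel: "carrier complex_field = UNIV" "mult complex_field = (*)" "one complex_field = 1"
    "zero complex_field = 0" "add complex_field = (+)"
    by (simp_all add: complex_field_def)
  let ?F = "free_star_algebra :: unit star_poly star_algebra"
  let ?h = "\<lambda>L. case L of Gen _ \<Rightarrow> 2 | Adj _ \<Rightarrow> (1/2 :: complex)"
  have rel: "H r = \<zero>\<^bsub>complex_field\<^esub> \<and> H (star ?F r) = \<zero>\<^bsub>complex_field\<^esub>"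
    if "ring_hom_ring ?F complex_field H" "\<And>c x. H (c \<odot>\<^bsub>?F\<^esub> x) = c * H x"
      "\<And>L. H (single [L] 1) = ?h L" and r: "r \<in> unitary_relators" for H r
  proof -
    interpret H: ring_hom_ring ?F complex_field H by fact
    have gens: "H (free_gen g) = 2" "H (star ?F (free_gen g)) = 1/2" for g
      by (simp_all add: that(3) free_star_gen, simp add: free_gen_def that(3))
    have minus: "H (x \<ominus>\<^bsub>?F\<^esub> y) = H x \<ominus>\<^bsub>complex_field\<^esub> H y" for x y by (simp add: a_minus_def)
    have zero: "(1::complex) \<ominus>\<^bsub>complex_field\<^esub> 1 = 0" using C.r_neg[of 1] by (simp add: a_minus_def sel)
    have one: "H \<one>\<^bsub>?F\<^esub> = 1" using H.hom_one by (simp only: sel)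
    have mult: "H (x \<otimes>\<^bsub>?F\<^esub> y) = H x * H y" for x y using H.hom_mult[of x y] by (simp add: sel)
    note ev = minus mult one gens zero free.star_minus free.star_mult free.star_star free.star_one
    consider "r = free_gen () \<otimes>\<^bsub>?F\<^esub> star ?F (free_gen ()) \<ominus>\<^bsub>?F\<^esub> \<one>\<^bsub>?F\<^esub>"
      | "r = star ?F (free_gen ()) \<otimes>\<^bsub>?F\<^esub> free_gen () \<ominus>\<^bsub>?F\<^esub> \<one>\<^bsub>?F\<^esub>"
      using r unfolding unitary_relators_def Let_def by blast
    then show ?thesis
      by cases (simp_all add: ev sel(3,4))
  qed
  have hc: "?h L \<in> carrier complex_field" for L by (simp only: sel UNIV_I)
  have "\<exists>ev. ring_hom_ring O_U1 complex_field ev \<and> (\<forall>c. \<forall>x\<in>carrier O_U1. ev (c \<odot>\<^bsub>O_U1\<^esub> x) = c * ev x) \<and>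
      (\<forall>L. ev (cls unitary_relators [L]) = ?h L)"
    unfolding O_U1_def
    by (rule presented_hom_exists[where R = unitary_relators and h = ?h, OF C.scalar_ring_axioms hc rel]) blast+
  then obtain ev where ev: "ring_hom_ring O_U1 complex_field ev"
    "\<And>c x. x \<in> carrier O_U1 \<Longrightarrow> ev (c \<odot>\<^bsub>O_U1\<^esub> x) = c * ev x" "\<And>L. ev (cls unitary_relators [L]) = ?h L"
    by blast
  interpret ev: ring_hom_ring O_U1 complex_field ev by (rule ev(1))
  have add: "ev (u_pow (m + n)) = ev (u_pow m) * ev (u_pow n)" for m n
    by (simp add: u_pow_add sel)
  have zero: "ev (u_pow 0) = 1" using ev.hom_one by (simp add: sel)
  have one: "ev (u_pow 1) = 2"
  proof -
    have "u_pow 1 = U1_u" by (simp add: int_pow_def2)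
    then show ?thesis using ev(3)[of "Gen ()"] by (simp add: U1_u_def presented_gen_cls)
  qed
  have nat: "ev (u_pow (int m)) = 2 ^ m" for m
  proof (induction m)
    case (Suc m)
    have "ev (u_pow (int (Suc m))) = ev (u_pow (1 + int m))" by simp
    then show ?case unfolding add using Suc one by simp
  qed (simp add: sel(3))
  have "ev (u_pow n) = 2 powi n" for n
  proof (cases "n \<ge> 0")
    case True
    then show ?thesis using nat[of "nat n"] by (simp add: power_int_def)
  next
    case False
    have "ev (u_pow n) * ev (u_pow (- n)) = 1" using add[of n "- n"] zero by simp
    then show ?thesis using False nat[of "nat (- n)"] by (simp add: power_int_def field_simps)
  qed
  then show ?thesis using that ev by blast
qed

context heegaard
begin

sublocale T: star_alg_pair R O_U1
  by (rule star_alg_pair.intro[OF R_star_alg U.star_alg_axioms])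

abbreviation "Te \<equiv> tensor_algebra R O_U1"
abbreviation "pt \<equiv> pure_tensor R O_U1"

lemma pt_zero_left: "y \<in> carrier O_U1 \<Longrightarrow> pt \<zero> y = \<zero>\<^bsub>Te\<^esub>"
  using T.pt_smult_left[of "\<zero>" y 0] by simp

lemma pt_minus_left:
  assumes "x \<in> carrier R" "x' \<in> carrier R" "y \<in> carrier O_U1"
  shows "pt (x \<ominus> x') y = pt x y \<ominus>\<^bsub>Te\<^esub> pt x' y"
proof -
  have "\<ominus> x' = (-1) \<odot> x'" "\<ominus>\<^bsub>Te\<^esub> pt x' y = (-1) \<odot>\<^bsub>Te\<^esub> pt x' y"
    using assms by (simp_all add: R.sc_minus T.T.sc_minus)
  then show ?thesis using assms by (simp add: a_minus_def T.pt_add_left T.pt_smult_left)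
qed

definition weight :: "int \<Rightarrow> int \<Rightarrow> heegaard_gen letter list \<Rightarrow> int" where
  "weight k l w = k * word_deg Ga w + l * word_deg Gb w"

lemma weight_simps [simp]:
  "weight k l [] = 0" "weight k l (v @ w) = weight k l v + weight k l w"
  "weight k l [Gen Ga] = k" "weight k l [Adj Ga] = - k" "weight k l [Gen Gb] = l" "weight k l [Adj Gb] = - l"
  by (simp_all add: weight_def algebra_simps)

lemma weight_adj: "weight k l [letter_adj L] = - weight k l [L]"
  by (cases L) (auto simp: weight_def)

text \<open>A relator only involves monomials of one weight, so its image is the relation itself
  tensored with a power of \<open>u\<close>.\<close>

lemma coaction_exists:
  "\<exists>H. ring_hom_ring R Te H \<and> (\<forall>c. \<forall>x\<in>carrier R. H (c \<odot> x) = c \<odot>\<^bsub>Te\<^esub> H x) \<and>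
     (\<forall>L. H (K [L]) = pt (K [L]) (u_pow (weight k l [L])))"
proof -
  let ?F = "free_star_algebra :: heegaard_gen star_poly star_algebra"
  let ?h = "\<lambda>L. pt (K [L]) (u_pow (weight k l [L]))"
  have h: "?h L \<in> carrier Te" for L by simp
  have rel: "H r = \<zero>\<^bsub>Te\<^esub> \<and> H (star ?F r) = \<zero>\<^bsub>Te\<^esub>"
    if H: "ring_hom_ring ?F Te H"
    and sm: "\<And>c x. H (c \<odot>\<^bsub>?F\<^esub> x) = c \<odot>\<^bsub>Te\<^esub> H x"
    and gen: "\<And>L. H (single [L] 1) = ?h L" and r: "r \<in> rels" for H r
  proof -
    interpret H: ring_hom_ring ?F Te H by fact
    have star: "H (star ?F x) = star Te (H x)" for x
    proof (rule free_hom_star[OF T.tensor_star_alg H sm])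
      show "H (single [letter_adj L] 1) = star Te (H (single [L] 1))" for L
        by (simp add: gen T.pt_star K_star u_pow_star weight_adj)
    qed
    have gens: "H (free_gen g) = ?h (Gen g)" "H (star ?F (free_gen g)) = ?h (Adj g)" for g
      by (simp add: free_gen_def gen, simp add: free_star_gen gen)
    have minus: "H (x \<ominus>\<^bsub>?F\<^esub> y) = H x \<ominus>\<^bsub>Te\<^esub> H y" for x y by (simp add: a_minus_def)
    have one: "H \<one>\<^bsub>?F\<^esub> = pt \<one> \<one>\<^bsub>O_U1\<^esub>" using H.hom_one by (simp add: T.pt_one)
    have add: "u_pow m \<otimes>\<^bsub>O_U1\<^esub> u_pow n = u_pow (m + n)" for m n by (simp add: u_pow_add)
    have zero: "pt x y \<ominus>\<^bsub>Te\<^esub> pt x y = \<zero>\<^bsub>Te\<^esub>" if "x \<in> carrier R" "y \<in> carrier O_U1" for x y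
      using that T.T.r_neg[of "pt x y"] by (simp add: a_minus_def)
    have scalar: "c \<odot>\<^bsub>Te\<^esub> \<one>\<^bsub>Te\<^esub> = pt (c \<odot> \<one>) \<one>\<^bsub>O_U1\<^esub>" for c
      by (simp add: T.pt_smult_left T.pt_one)
    note ev = gens minus sm one H.hom_mult T.pt_mult add
    have "H r = \<zero>\<^bsub>Te\<^esub>"
      using r
    proof (cases rule: rels_cases)
      case 1
      then show ?thesis
        by (simp add: ev add.commute zero relations(1) flip: T.pt_smult_left)
    next
      case 2
      then show ?thesis
        by (simp add: ev add.commute zero relations(2) flip: T.pt_smult_left)
    next
      case 3
      then show ?thesis
        by (simp add: ev zero scalar relations(3) flip: T.pt_smult_left pt_minus_left)
    next
      case 4
      then show ?thesis
        by (simp add: ev zero scalar relations(4) flip: T.pt_smult_left pt_minus_left)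
    next
      case 5
      have "\<one>\<^bsub>Te\<^esub> \<ominus>\<^bsub>Te\<^esub> pt x \<one>\<^bsub>O_U1\<^esub> = pt (\<one> \<ominus> x) \<one>\<^bsub>O_U1\<^esub>" if "x \<in> carrier R" for x
        using that by (simp add: pt_minus_left T.pt_one)
      then show ?thesis
        unfolding 5 by (simp add: ev relations(5) pt_zero_left flip: A0_def B0_def)
    qed
    then show ?thesis by (simp add: star)
  qed
  show ?thesis
    by (rule R_hom_exists[OF T.T.scalar_ring_axioms h rel])
qed

text \<open>The coaction is a definite description. Uniqueness holds because a star homomorphism is
  determined by its values at \<open>a\<close> and \<open>b\<close>, and outside the carrier extensionality fixes it.\<close>

lemma coaction_props:
  fixes k l :: int
  defines "\<phi> \<equiv> coaction p q \<theta> k l"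
  shows coaction_hom: "ring_hom_ring R Te \<phi>"
    and coaction_smult: "x \<in> carrier R \<Longrightarrow> \<phi> (c \<odot> x) = c \<odot>\<^bsub>Te\<^esub> \<phi> x"
    and coaction_letter: "\<phi> (K [L]) = pt (K [L]) (u_pow (weight k l [L]))"
proof -
  obtain H where H: "ring_hom_ring R Te H" "\<And>c x. x \<in> carrier R \<Longrightarrow> H (c \<odot> x) = c \<odot>\<^bsub>Te\<^esub> H x"
     "\<And>L. H (K [L]) = pt (K [L]) (u_pow (weight k l [L]))"
    using coaction_exists[of k l] by blast
  interpret H: ring_hom_ring R Te H by (rule H(1))
  have H_star: "H (star R x) = star Te (H x)" if "x \<in> carrier R" for x
    by (rule R_hom_star[OF T.tensor_star_alg H(1,2) _ that])
       (simp_all add: H(3) T.pt_star K_star u_pow_star weight_adj)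
  define H' where "H' = restrict H (carrier R)"
  have H'_eq: "H' x = H x" if "x \<in> carrier R" for x using that by (simp add: H'_def)
  have H'_hom: "H' \<in> ring_hom R Te"
    by (rule ring_hom_memI) (simp_all add: H'_eq)
  have spec: "H' \<in> star_algebra_hom R Te \<and> H' \<in> extensional (carrier R) \<and>
      H' (S3_a p q \<theta>) = pt (S3_a p q \<theta>) (u_pow k) \<and> H' (S3_b p q \<theta>) = pt (S3_b p q \<theta>) (u_pow l)"
    using H'_hom by (simp add: star_algebra_hom_def H'_eq H H_star S3_gens) (simp add: H'_def)
  have "\<phi> = H'"
    unfolding \<phi>_def coaction_def R_def[symmetric]
  proof (rule the_equality)
    show "H' \<in> star_algebra_hom R Te \<and> H' \<in> extensional (carrier R) \<and>
      H' (S3_a p q \<theta>) = pt (S3_a p q \<theta>) (u_pow k) \<and> H' (S3_b p q \<theta>) = pt (S3_b p q \<theta>) (u_pow l)"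
      by (rule spec)
    fix G assume G: "G \<in> star_algebra_hom R Te \<and> G \<in> extensional (carrier R) \<and>
      G (S3_a p q \<theta>) = pt (S3_a p q \<theta>) (u_pow k) \<and> G (S3_b p q \<theta>) = pt (S3_b p q \<theta>) (u_pow l)"
    have G_hom: "ring_hom_ring R Te G"
      using G by (intro ring_hom_ringI2 R.ring_axioms T.T.ring_axioms) (simp add: star_algebra_hom_def)
    have G_smult: "G (c \<odot> x) = c \<odot>\<^bsub>Te\<^esub> G x" and G_star: "G (star R x) = star Te (G x)"
      if "x \<in> carrier R" for c x
      using G that by (simp_all add: star_algebra_hom_def)
    have G_gen: "G (K [Gen g]) = H (K [Gen g])" for g
      using G by (cases g) (simp_all add: S3_gens H(3))
    have G_letter: "G (K [L]) = H (K [L])" for L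
    proof (cases L)
      case (Adj g)
      then have "K [L] = star R (K [Gen g])" by (simp add: K_star)
      then show ?thesis by (simp only: G_star H_star K_carrier G_gen)
    qed (simp add: G_gen)
    have "G x = H x" if "x \<in> carrier R" for x
      using presented_hom_eqI[of rels Te G H "smult Te" x] G_hom H(1,2) G_smult G_letter that
      unfolding R_def O_S3_def by blast
    then show "G = H'"
      using G spec by (intro extensionalityI[of _ "carrier R"]) (simp_all add: H'_eq)
  qed
  then have eq: "\<phi> x = H x" if "x \<in> carrier R" for x using H'_eq that by simp
  show "ring_hom_ring R Te \<phi>"
    using H'_hom \<open>\<phi> = H'\<close> by (intro ring_hom_ringI2 R.ring_axioms T.T.ring_axioms) simp
  show "x \<in> carrier R \<Longrightarrow> \<phi> (c \<odot> x) = c \<odot>\<^bsub>Te\<^esub> \<phi> x" "\<phi> (K [L]) = pt (K [L]) (u_pow (weight k l [L]))"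
    by (simp_all add: eq H)
qed

lemma coaction_word: "coaction p q \<theta> k l (K w) = pt (K w) (u_pow (weight k l w))"
proof (induction w)
  case Nil
  interpret \<phi>: ring_hom_ring R Te "coaction p q \<theta> k l" by (rule coaction_hom)
  show ?case using \<phi>.hom_one by (simp add: T.pt_one)
next
  case (Cons L w)
  interpret \<phi>: ring_hom_ring R Te "coaction p q \<theta> k l" by (rule coaction_hom)
  have "weight k l (L # w) = weight k l [L] + weight k l w"
    using weight_simps(2)[of k l "[L]" w] by simp
  then show ?case
    using Cons K_append[of "[L]" w] by (simp add: coaction_letter T.pt_mult u_pow_add)
qed

definition fixed :: "int \<Rightarrow> int \<Rightarrow> heegaard_gen star_poly set set" where
  "fixed k l = {x \<in> carrier R. coaction p q \<theta> k l x = pt x \<one>\<^bsub>O_U1\<^esub>}"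

lemma fixed_word: "weight k l w = 0 \<Longrightarrow> K w \<in> fixed k l"
  by (simp add: fixed_def coaction_word)

lemma fixed_one: "\<one> \<in> fixed k l"
  using fixed_word[of k l "[]"] by simp

lemma fixed_add: "x \<in> fixed k l \<Longrightarrow> y \<in> fixed k l \<Longrightarrow> x \<oplus> y \<in> fixed k l"
  and fixed_mult: "x \<in> fixed k l \<Longrightarrow> y \<in> fixed k l \<Longrightarrow> x \<otimes> y \<in> fixed k l"
proof -
  interpret \<phi>: ring_hom_ring R Te "coaction p q \<theta> k l" by (rule coaction_hom)
  show "x \<in> fixed k l \<Longrightarrow> y \<in> fixed k l \<Longrightarrow> x \<oplus> y \<in> fixed k l"
    "x \<in> fixed k l \<Longrightarrow> y \<in> fixed k l \<Longrightarrow> x \<otimes> y \<in> fixed k l"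
    by (simp_all add: fixed_def T.pt_add_left T.pt_mult)
qed

lemma fixed_smult: "x \<in> fixed k l \<Longrightarrow> c \<odot> x \<in> fixed k l"
  by (simp add: fixed_def coaction_smult T.pt_smult_left)

lemma fixed_carrier: "fixed k l \<subseteq> carrier R"
  by (auto simp: fixed_def)

lemma fixed_minus: "x \<in> fixed k l \<Longrightarrow> y \<in> fixed k l \<Longrightarrow> x \<ominus> y \<in> fixed k l"
  using fixed_add[of x k l "(-1) \<odot> y"] fixed_smult[of y k l "-1"] subsetD[OF fixed_carrier, of y k l]
  by (simp add: a_minus_def R.sc_minus)

text \<open>Used both for the fixed point algebra and for its coefficient algebra. Closure under
  negation comes from multiplication by the scalar -1.\<close>

lemma complex_algebra_restrict:
  fixes S :: "(complex, heegaard_gen star_poly set, 'm) module_scheme"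
  assumes S: "carrier S \<subseteq> carrier R" "mult S = mult R" "one S = one R" "zero S = zero R" "add S = add R" "smult S = smult R"
    and one: "\<one> \<in> carrier S"
    and add: "\<And>x y. x \<in> carrier S \<Longrightarrow> y \<in> carrier S \<Longrightarrow> x \<oplus> y \<in> carrier S"
    and mult: "\<And>x y. x \<in> carrier S \<Longrightarrow> y \<in> carrier S \<Longrightarrow> x \<otimes> y \<in> carrier S"
    and smult: "\<And>c x. x \<in> carrier S \<Longrightarrow> c \<odot> x \<in> carrier S"
  shows "complex_algebra S"
proof -
  have R: "x \<in> carrier R" if "x \<in> carrier S" for x using S(1) that by blast
  have zero: "\<zero> \<in> carrier S" using smult[OF one, of 0] by simp
  have neg: "\<exists>y\<in>carrier S. x \<oplus> y = \<zero>" if "x \<in> carrier S" for x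
    using smult[OF that, of "-1"] R[OF that]
    by (intro bexI[of _ "(-1) \<odot> x"]) (simp_all add: R.sc_minus R.r_neg)
  interpret S: ring S
    by (intro ringI abelian_groupI monoidI)
       (simp_all add: S(2-5) R neg one add mult zero R.a_ac R.m_assoc R.l_distr R.r_distr)
  interpret C: scalar_ring complex_field "(*)" by (rule complex_scalar_ring)
  have "Module.module complex_field S"
  proof (intro Module.module.intro Module.module_axioms.intro)
    show "cring complex_field"
      by (intro cring.intro comm_monoid.intro C.ring_axioms C.monoid_axioms comm_monoid_axioms.intro)
         (simp add: complex_field_def)
    show "abelian_group S" by (rule S.is_abelian_group)
  qed (simp_all add: S complex_field_def R smult R.sc_add_left R.sc_add_right R.sc_sc)
  then show ?thesis
    unfolding complex_algebra_def using S.ring_axioms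
    by (simp add: S R R.sc_mult_left R.sc_mult_right)
qed

lemma fixed_D: "d \<in> D \<Longrightarrow> d \<in> fixed k l"
proof -
  have AB: "A0 \<in> fixed k l" "B0 \<in> fixed k l"
    using fixed_word[of k l "[Gen Ga, Adj Ga]"] fixed_word[of k l "[Gen Gb, Adj Gb]"]
      K_append[of "[Gen Ga]" "[Adj Ga]"] K_append[of "[Gen Gb]" "[Adj Gb]"]
    by (simp_all add: weight_def A0_def B0_def fixed_minus fixed_one)
  have pow: "x [^] n \<in> fixed k l" if "x \<in> fixed k l" for x and n :: nat
    using that fixed_carrier by (induction n) (auto intro: fixed_one fixed_mult)
  show "d \<in> D \<Longrightarrow> d \<in> fixed k l"
    by (induction rule: D.induct) (auto intro: AB pow fixed_add fixed_smult)
qed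

end

section \<open>The fixed point algebra\<close>

text \<open>For a family of subgroups \<open>M i\<close> this is their sum.\<close>

definition graded_span :: "('a, 'm) ring_scheme \<Rightarrow> ('i \<Rightarrow> 'a set) \<Rightarrow> 'a set" where
  "graded_span G M = {\<Oplus>\<^bsub>G\<^esub>i\<in>S. m i | S m. finite S \<and> (\<forall>i\<in>S. m i \<in> M i)}"

context abelian_group
begin

lemma graded_span_single:
  assumes "x \<in> M i" "M i \<subseteq> carrier G"
  shows "x \<in> graded_span G M"
proof -
  have "x = (\<Oplus>i\<in>{i}. x)" using assms by (simp add: subset_iff)
  then show ?thesis unfolding graded_span_def using assms by (intro CollectI exI[of _ "{i}"] exI[of _ "\<lambda>_. x"]) simp
qed

lemma graded_span_add:
  assumes M: "\<And>i. M i \<subseteq> carrier G" "\<And>i. \<zero> \<in> M i" "\<And>i x y. x \<in> M i \<Longrightarrow> y \<in> M i \<Longrightarrow> x \<oplus> y \<in> M i"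
    and x: "x \<in> graded_span G M" and y: "y \<in> graded_span G M"
  shows "x \<oplus> y \<in> graded_span G M"
proof -
  obtain S m where S: "finite S" "\<forall>i\<in>S. m i \<in> M i" "x = (\<Oplus>i\<in>S. m i)" using x unfolding graded_span_def by blast
  obtain T n where T: "finite T" "\<forall>i\<in>T. n i \<in> M i" "y = (\<Oplus>i\<in>T. n i)" using y unfolding graded_span_def by blast
  define m' where "m' i = (if i \<in> S then m i else \<zero>)" for i
  define n' where "n' i = (if i \<in> T then n i else \<zero>)" for i
  have m'M: "m' i \<in> M i" and n'M: "n' i \<in> M i" for i using S T M(2) by (auto simp: m'_def n'_def)
  have m'c: "m' i \<in> carrier G" and n'c: "n' i \<in> carrier G" for i using m'M n'M M(1) by blast+
  have "x = (\<Oplus>i\<in>S \<union> T. m' i)"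
    unfolding S(3) using S(1) T(1) S(2) M(1) m'c
    by (intro add.finprod_mono_neutral_cong_left) (auto simp: m'_def)
  moreover have "y = (\<Oplus>i\<in>S \<union> T. n' i)"
    unfolding T(3) using S(1) T(1) T(2) M(1) n'c
    by (intro add.finprod_mono_neutral_cong_left) (auto simp: n'_def)
  ultimately have "x \<oplus> y = (\<Oplus>i\<in>S \<union> T. m' i \<oplus> n' i)"
    using m'c n'c by (simp add: Pi_iff)
  moreover have "m' i \<oplus> n' i \<in> M i" for i using M(3) m'M n'M .
  ultimately show ?thesis unfolding graded_span_def using S(1) T(1)
    by (intro CollectI exI[of _ "S \<union> T"] exI[of _ "\<lambda>i. m' i \<oplus> n' i"]) simp
qed

end

context heegaard
begin

text \<open>By \<open>normal_form\<close> every word lies in one of the spaces \<open>D a\<^sup>i b\<^sup>j\<close>.\<close>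

lemma R_expansion:
  assumes "x \<in> carrier R"
  obtains S d where "finite S" "\<And>s. d s \<in> D" "x = (\<Oplus>s\<in>S. d s \<otimes> K (nf (fst s) (snd s)))"
proof -
  define M where "M s = (\<lambda>d. d \<otimes> K (nf (fst s) (snd s))) ` D" for s
  have sub: "M s \<subseteq> carrier R" for s by (auto simp: M_def)
  have zero: "\<zero> \<in> M s" for s unfolding M_def by (rule image_eqI[of _ _ "\<zero>"]) simp_all
  have M_add: "x \<oplus> y \<in> M s" if xy: "x \<in> M s" "y \<in> M s" for x y s
  proof -
    obtain d e where "d \<in> D" "x = d \<otimes> K (nf (fst s) (snd s))" "e \<in> D" "y = e \<otimes> K (nf (fst s) (snd s))"
      using xy unfolding M_def by blast
    then show ?thesis unfolding M_def by (intro image_eqI[of _ _ "d \<oplus> e"]) (simp_all add: R.l_distr D_add)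
  qed
  have "x \<in> graded_span R M"
    using assms
  proof (induction x rule: R_induct)
    case (word c w)
    obtain d where d: "d \<in> D" "K w = d \<otimes> K (nf (word_deg Ga w) (word_deg Gb w))" using normal_form by blast
    have "c \<odot> K w = (c \<odot> d) \<otimes> K (nf (word_deg Ga w) (word_deg Gb w))"
      unfolding d(2) using d(1) by (simp only: R.sc_mult_left D_carrier K_carrier)
    then have "c \<odot> K w \<in> M (word_deg Ga w, word_deg Gb w)" unfolding M_def using D_smult[OF d(1)] by auto
    then show ?case by (rule R.graded_span_single[where M = M, OF _ sub])
  next
    case (add x y)
    show ?case by (rule R.graded_span_add[where M = M, OF sub zero M_add add(3,4)])
  qed
  then obtain S m where S: "finite S" "\<forall>s\<in>S. m s \<in> M s" "x = (\<Oplus>s\<in>S. m s)"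
    unfolding graded_span_def by blast
  have "\<forall>s\<in>S. \<exists>d. d \<in> D \<and> m s = d \<otimes> K (nf (fst s) (snd s))" using S(2) unfolding M_def by blast
  then obtain d where d: "\<forall>s\<in>S. d s \<in> D \<and> m s = d s \<otimes> K (nf (fst s) (snd s))" by metis
  define d' where "d' s = (if s \<in> S then d s else \<zero>)" for s
  have "x = (\<Oplus>s\<in>S. d' s \<otimes> K (nf (fst s) (snd s)))"
    unfolding S(3) using d by (intro R.finsum_cong') (auto simp: d'_def)
  moreover have "d' s \<in> D" for s using d by (auto simp: d'_def)
  ultimately show ?thesis using S(1) that by blast
qed

lemma lin_rep_finsum:
  "ring_hom_ring R lin_ops H \<Longrightarrow> finite S \<Longrightarrow> x \<in> S \<rightarrow> carrier R \<Longrightarrow>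
    H (\<Oplus>s\<in>S. x s) \<psi> u = (\<Sum>s\<in>S. H (x s) \<psi> u)"
proof -
  assume "ring_hom_ring R lin_ops H"
  then interpret H: ring_hom_ring R lin_ops H .
  show "finite S \<Longrightarrow> x \<in> S \<rightarrow> carrier R \<Longrightarrow> ?thesis"
  proof (induction S rule: finite_induct)
    case empty
    show ?case using H.hom_zero by (simp add: lin_ops_sel)
  next
    case (insert s S)
    then show ?case by (simp add: Pi_iff lin_ops_sel)
  qed
qed

text \<open>The coaction followed by the representation on the left factor and evaluation at \<open>u = 2\<close>
  on the right factor.\<close>

lemma weighted_rep:
  obtains \<chi> where "ring_hom_ring R lin_ops \<chi>"
    "\<And>x. x \<in> fixed k l \<Longrightarrow> \<chi> x = rep x"
    "\<And>d w. d \<in> D \<Longrightarrow> \<chi> (d \<otimes> K w) = op_scale (2 powi weight k l w) (rep (d \<otimes> K w))"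
proof -
  obtain ev where ev: "ring_hom_ring O_U1 complex_field ev"
    "\<And>c x. x \<in> carrier O_U1 \<Longrightarrow> ev (c \<odot>\<^bsub>O_U1\<^esub> x) = c * ev x" "\<And>n. ev (u_pow n) = 2 powi n"
    by (rule U1_character) blast
  interpret ev: ring_hom_ring O_U1 complex_field ev by (rule ev(1))
  have rep_closed: "rep x \<in> carrier lin_ops" if "x \<in> carrier R" for x
    using ring_hom_closed[of rep R lin_ops x] rep_hom that by (simp add: ring_hom_ring_def ring_hom_ring_axioms_def)
  have sel: "mult complex_field = (*)" "one complex_field = 1" "add complex_field = (+)"
    by (simp_all add: complex_field_def)
  have evs: "ev (x \<otimes>\<^bsub>O_U1\<^esub> y) = ev x * ev y" "ev (x \<oplus>\<^bsub>O_U1\<^esub> y) = ev x + ev y" "ev \<one>\<^bsub>O_U1\<^esub> = 1"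
    if "x \<in> carrier O_U1" "y \<in> carrier O_U1" for x y
    using that ev.hom_mult[of x y] ev.hom_add[of x y] ev.hom_one by (simp_all only: sel)
  have lin: "rep x (\<lambda>s. c * \<psi> s) = (\<lambda>s. c * rep x \<psi> s)" if "x \<in> carrier R" for x c \<psi>
    using lin_opsD(2)[OF rep_closed[OF that]] .
  define g where "g x y = op_scale (ev y) (rep x)" for x y
  have g_closed: "g x y \<in> carrier lin_ops" if "x \<in> carrier R" for x y
    unfolding g_def using lin_ops.sc_closed[OF rep_closed[OF that]] .
  have g_mult: "g (x \<otimes> x') (y \<otimes>\<^bsub>O_U1\<^esub> y') = g x y \<otimes>\<^bsub>lin_ops\<^esub> g x' y'"
    if "x \<in> carrier R" "y \<in> carrier O_U1" "x' \<in> carrier R" "y' \<in> carrier O_U1" for x y x' y'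
    by (rule ext, rule ext) (use that in \<open>simp add: g_def sel rep_mult lin lin_ops_sel\<close>)
  have g_one: "g \<one> \<one>\<^bsub>O_U1\<^esub> = \<one>\<^bsub>lin_ops\<^esub>"
    by (rule ext, rule ext) (simp add: g_def sel rep_one lin_ops_sel)
  have g_add_left: "g (x \<oplus> x') y = g x y \<oplus>\<^bsub>lin_ops\<^esub> g x' y" if "x \<in> carrier R" "x' \<in> carrier R" for x x' y
    by (rule ext, rule ext) (use that in \<open>simp add: g_def rep_add lin_ops_sel algebra_simps\<close>)
  have g_add_right: "g x (y \<oplus>\<^bsub>O_U1\<^esub> y') = g x y \<oplus>\<^bsub>lin_ops\<^esub> g x y'" if "y \<in> carrier O_U1" "y' \<in> carrier O_U1" for x y y'
    by (rule ext, rule ext) (use that in \<open>simp add: g_def sel lin_ops_sel algebra_simps\<close>)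
  have g_smult_left: "g (c \<odot> x) y = op_scale c (g x y)" if "x \<in> carrier R" for c x y
    by (rule ext, rule ext) (use that in \<open>simp add: g_def rep_smult\<close>)
  have g_smult_right: "g x (c \<odot>\<^bsub>O_U1\<^esub> y) = op_scale c (g x y)" if "y \<in> carrier O_U1" for c x y
    by (rule ext, rule ext) (use that in \<open>simp add: g_def ev(2)\<close>)
  obtain \<Psi> where \<Psi>: "ring_hom_ring Te lin_ops \<Psi>"
    "\<And>x y. x \<in> carrier R \<Longrightarrow> y \<in> carrier O_U1 \<Longrightarrow> \<Psi> (pt x y) = op_scale (ev y) (rep x)"
  proof -
    obtain H where "ring_hom_ring Te lin_ops H" "\<forall>x\<in>carrier R. \<forall>y\<in>carrier O_U1. H (pt x y) = g x y"
      by (rule T.tensor_hom_exists[where g = g, OF lin_ops.scalar_ring_axioms])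
         (assumption | rule g_closed g_mult g_one g_add_left g_add_right g_smult_left g_smult_right | blast)+
    then show thesis by (intro that[of H]) (simp_all only: g_def)
  qed
  define \<chi> where "\<chi> = \<Psi> \<circ> coaction p q \<theta> k l"
  interpret \<phi>: ring_hom_ring R Te "coaction p q \<theta> k l" by (rule coaction_hom)
  interpret \<Psi>: ring_hom_ring Te lin_ops \<Psi> by (rule \<Psi>(1))
  have "ring_hom_ring R lin_ops \<chi>"
    by (intro ring_hom_ringI2 R.ring_axioms lin_ops.ring_axioms ring_hom_memI) (simp_all add: \<chi>_def)
  moreover have "\<chi> x = rep x" if x: "x \<in> fixed k l" for x
  proof -
    have "\<chi> x = op_scale (ev \<one>\<^bsub>O_U1\<^esub>) (rep x)"
      using x \<Psi>(2)[of x "\<one>\<^bsub>O_U1\<^esub>"] by (simp only: \<chi>_def o_def fixed_def mem_Collect_eq U.one_closed)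
    then show ?thesis using evs(3)[OF U.one_closed U.one_closed] by simp
  qed
  moreover have "\<chi> (d \<otimes> K w) = op_scale (2 powi weight k l w) (rep (d \<otimes> K w))" if d: "d \<in> D" for d w
  proof -
    have "coaction p q \<theta> k l d = pt d \<one>\<^bsub>O_U1\<^esub>" using fixed_D[OF d] by (simp add: fixed_def)
    then have "coaction p q \<theta> k l (d \<otimes> K w) = pt (d \<otimes> K w) (u_pow (weight k l w))"
      using d by (simp add: coaction_word T.pt_mult)
    then show ?thesis
      using d \<Psi>(2)[of "d \<otimes> K w" "u_pow (weight k l w)"] by (simp only: \<chi>_def o_def ev(3) R.m_closed D_carrier K_carrier u_pow_closed)
  qed
  ultimately show ?thesis using that by blast
qed

lemma two_powi_eq_1: "(2::complex) powi n = 1 \<Longrightarrow> n = 0"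
proof -
  assume "(2::complex) powi n = 1"
  then have "complex_of_real (2 powi n) = complex_of_real 1" by simp
  then have "(2::real) powi n = 1" by (simp only: of_real_eq_iff)
  then show "n = 0"
    by (metis less_numeral_extra(4) linorder_neqE_linordered_idom one_less_numeral_iff power_int_0_right power_int_strict_increasing semiring_norm(76))
qed

text \<open>Compare the coefficients of \<open>\<chi> x\<close> and \<open>rep x\<close> for the \<open>\<chi>\<close> of \<open>weighted_rep\<close>: at the
  position of a part of weight \<open>n\<close> they differ by the factor \<open>2\<^sup>n\<close>, which is 1 only for
  \<open>n = 0\<close>.\<close>

lemma fixed_expansion:
  assumes "x \<in> fixed k l"
  obtains S d where "finite S" "\<And>s. d s \<in> D" "\<And>s. s \<in> S \<Longrightarrow> k * fst s + l * snd s = 0"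
    "x = (\<Oplus>s\<in>S. d s \<otimes> K (nf (fst s) (snd s)))"
proof -
  have xR: "x \<in> carrier R" using assms fixed_carrier by blast
  obtain S d where S: "finite S" "\<And>s. d s \<in> D" "x = (\<Oplus>s\<in>S. d s \<otimes> K (nf (fst s) (snd s)))"
    using R_expansion[OF xR] by blast
  obtain \<chi> where \<chi>: "ring_hom_ring R lin_ops \<chi>"
    "\<And>x. x \<in> fixed k l \<Longrightarrow> \<chi> x = rep x"
    "\<And>d w. d \<in> D \<Longrightarrow> \<chi> (d \<otimes> K w) = op_scale (2 powi weight k l w) (rep (d \<otimes> K w))"
    using weighted_rep[of k l] by blast
  have dK: "(\<lambda>s. d s \<otimes> K (nf (fst s) (snd s))) \<in> S \<rightarrow> carrier R" using S(2) by auto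
  have d0: "d s = \<zero>" if s: "s \<in> S" and ns: "k * fst s + l * snd s \<noteq> 0" for s
  proof (rule D_word_eq_zero[of _ "nf (fst s) (snd s)"])
    show "d s \<in> D" by (rule S(2))
    fix t :: real
    define u where "u = (t, word_deg Ga (nf (fst s) (snd s)), word_deg Gb (nf (fst s) (snd s)))"
    define v where "v r = rep (d r \<otimes> K (nf (fst r) (snd r))) vac u" for r
    have v0: "v r = 0" if "r \<noteq> s" for r
      unfolding v_def u_def using that by (intro rep_D_word_vac S(2)) (auto simp: prod_eq_iff)
    have single: "(\<Sum>r\<in>S. c r * v r) = c s * v s" for c
    proof -
      have "(\<Sum>r\<in>S. c r * v r) = (\<Sum>r\<in>{s}. c r * v r)"
        using S(1) s v0 by (intro sum.mono_neutral_right) auto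
      then show ?thesis by simp
    qed
    have "rep x vac u = (\<Sum>r\<in>S. 1 * v r)"
      unfolding S(3) using lin_rep_finsum[OF rep_hom S(1) dK, of vac u] by (simp add: v_def)
    also have "\<dots> = v s" unfolding single by simp
    finally have 1: "rep x vac u = v s" .
    have "\<chi> x vac u = (\<Sum>r\<in>S. 2 powi weight k l (nf (fst r) (snd r)) * v r)"
      unfolding S(3) using lin_rep_finsum[OF \<chi>(1) S(1) dK, of vac u] by (simp only: v_def \<chi>(3) S(2))
    then have "v s = 2 powi weight k l (nf (fst s) (snd s)) * v s"
      unfolding single \<chi>(2)[OF assms] 1 .
    moreover have "(2::complex) powi weight k l (nf (fst s) (snd s)) \<noteq> 1"
      using two_powi_eq_1 ns by (auto simp: weight_def)
    ultimately have "v s = 0" by simp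
    then show "rep (d s \<otimes> K (nf (fst s) (snd s))) vac (t, word_deg Ga (nf (fst s) (snd s)), word_deg Gb (nf (fst s) (snd s))) = 0"
      by (simp only: v_def u_def)
  qed
  define S' where "S' = {s \<in> S. k * fst s + l * snd s = 0}"
  have "x = (\<Oplus>s\<in>S'. d s \<otimes> K (nf (fst s) (snd s)))"
    unfolding S(3) using S(1) dK d0
    by (intro R.add.finprod_mono_neutral_cong_right) (auto simp: S'_def)
  then show ?thesis using S(1,2) by (intro that[of S' d]) (auto simp: S'_def)
qed

lemma gen_pow_add: "0 \<le> i \<and> 0 \<le> j \<or> i \<le> 0 \<and> j \<le> 0 \<Longrightarrow> gen_pow g (i + j) = gen_pow g i @ gen_pow g j"
proof (elim disjE conjE)
  assume "i \<le> 0" "j \<le> 0"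
  then have "nat (- (i + j)) = nat (- i) + nat (- j)" by simp
  then have "gen_pow g (i + j) = replicate (nat (- i)) (Adj g) @ replicate (nat (- j)) (Adj g)"
    using \<open>i \<le> 0\<close> \<open>j \<le> 0\<close> by (auto simp: gen_pow_def replicate_add)
  then show ?thesis using \<open>i \<le> 0\<close> \<open>j \<le> 0\<close> by (auto simp: gen_pow_def)
qed (simp add: gen_pow_def nat_add_distrib replicate_add)

text \<open>All exponents in the power have the same sign, so no product such as \<open>aa\<^sup>*\<close> arises and
  sorting the letters costs only phases.\<close>

lemma nf_power:
  "\<exists>c. c \<noteq> 0 \<and> K (nf (int n * i) (int n * j)) = c \<odot> (K (nf i j) [^] n)"
proof (induction n)
  case 0
  show ?case by (intro exI[of _ 1]) (simp add: nf_def)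
next
  case (Suc n)
  define ni nj where nij: "ni = int n * i" "nj = int n * j"
  obtain c where c: "c \<noteq> 0" "K (nf ni nj) = c \<odot> (K (nf i j) [^] n)" using Suc unfolding nij by blast
  have "gen_pow Ga (int (Suc n) * i) = gen_pow Ga (ni + i)" "gen_pow Gb (int (Suc n) * j) = gen_pow Gb (nj + j)"
    by (simp_all add: nij algebra_simps)
  moreover have "gen_pow Ga (ni + i) = gen_pow Ga ni @ gen_pow Ga i" "gen_pow Gb (nj + j) = gen_pow Gb nj @ gen_pow Gb j"
    by (rule gen_pow_add, simp add: nij zero_le_mult_iff mult_le_0_iff, linarith)+
  ultimately have eq: "nf (int (Suc n) * i) (int (Suc n) * j) = gen_pow Ga ni @ gen_pow Ga i @ gen_pow Gb nj @ gen_pow Gb j"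
    by (simp only: nf_def append_assoc)
  obtain e where e: "e \<noteq> 0" "K (gen_pow Ga i) \<otimes> K (gen_pow Gb nj) = e \<odot> (K (gen_pow Gb nj) \<otimes> K (gen_pow Ga i))"
    using exchange_sym[OF K_carrier K_carrier words_exchange[OF set_gen_pow set_gen_pow]] by blast
  have "K (nf (int (Suc n) * i) (int (Suc n) * j)) =
      K (gen_pow Ga ni) \<otimes> ((K (gen_pow Ga i) \<otimes> K (gen_pow Gb nj)) \<otimes> K (gen_pow Gb j))"
    unfolding eq by (simp add: K_append R.m_assoc)
  also have "\<dots> = e \<odot> (K (nf ni nj) \<otimes> K (nf i j))"
    unfolding e(2) by (simp add: nf_def K_append R.m_assoc R.sc_mult_left R.sc_mult_right)
  also have "\<dots> = (e * c) \<odot> (K (nf i j) [^] Suc n)"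
    unfolding c(2) by (simp add: R.sc_mult_left R.sc_sc)
  finally show ?case using c(1) e(1) by (intro exI[of _ "e * c"]) simp
qed

end

section \<open>The generalised Weyl algebra\<close>

lemma ring_hom_finsum:
  assumes "ring_hom_ring A B h" "finite S" "m \<in> S \<rightarrow> carrier A"
  shows "h (\<Oplus>\<^bsub>A\<^esub>s\<in>S. m s) = (\<Oplus>\<^bsub>B\<^esub>s\<in>S. h (m s))"
proof -
  interpret ring_hom_ring A B h by fact
  show ?thesis using assms(2,3)
    by (induction S rule: finite_induct) (auto simp: Pi_iff)
qed

text \<open>The words \<open>a\<^sup>l b\<^sup>-\<^sup>k\<close> and \<open>a\<^sup>-\<^sup>l b\<^sup>k\<close> have weight 0; they become the generators
  \<open>X\<^sup>+\<close> and \<open>X\<^sup>-\<close>.\<close>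

locale heegaard_action = heegaard +
  fixes k l :: int
  assumes k: "k > 0" and l: "l \<noteq> 0" and coprime: "coprime k l"
begin

definition "plus_word = nf l (- k)"
definition "minus_word = nf (- l) k"

abbreviation "Xp \<equiv> K plus_word"
abbreviation "Xm \<equiv> K minus_word"

definition "twist d = (THE e. e \<in> D \<and> Xp \<otimes> d = e \<otimes> Xp)"

definition "center_elt = Xm \<otimes> Xp"

lemma degree_zero_word: "word_deg Ga w = 0 \<Longrightarrow> word_deg Gb w = 0 \<Longrightarrow> K w \<in> D"
  using normal_form[of w] by (auto simp: nf_def)

lemma center_elt_word: "center_elt = K (minus_word @ plus_word)"
  by (simp add: center_elt_def K_append)

lemma center_elt_D [simp]: "center_elt \<in> D"
  unfolding center_elt_word by (rule degree_zero_word) (simp_all add: plus_word_def minus_word_def)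

lemma center_elt_nonzero: "center_elt \<noteq> \<zero>"
  unfolding center_elt_word by (rule K_nonzero)

lemma center_elt_cancel: "d \<in> D \<Longrightarrow> e \<in> D \<Longrightarrow> d \<otimes> center_elt = e \<otimes> center_elt \<Longrightarrow> d = e"
  unfolding center_elt_word by (rule D_word_cancel)

lemma twist_eqI: "e \<in> D \<Longrightarrow> Xp \<otimes> d = e \<otimes> Xp \<Longrightarrow> twist d = e"
proof -
  assume e: "e \<in> D" "Xp \<otimes> d = e \<otimes> Xp"
  show "twist d = e"
    unfolding twist_def
  proof (rule the_equality)
    fix e' assume "e' \<in> D \<and> Xp \<otimes> d = e' \<otimes> Xp"
    then show "e' = e" using e by (intro D_word_cancel[of e' e plus_word]) simp_all
  qed (use e in simp)
qed

lemma twist_props: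
  assumes "d \<in> D"
  shows twist_D: "twist d \<in> D" and twist_rel: "Xp \<otimes> d = twist d \<otimes> Xp"
proof -
  obtain e where "e \<in> D" "Xp \<otimes> d = e \<otimes> Xp" using K_push[OF assms] by blast
  with twist_eqI show "twist d \<in> D" "Xp \<otimes> d = twist d \<otimes> Xp" by auto
qed

text \<open>Multiply by \<open>X\<^sup>-\<close> from the left and use that \<open>X\<^sup>- X\<^sup>+\<close> is central in \<open>D\<close> and cancellable.\<close>

lemma Xp_cancel:
  assumes d: "d \<in> D" and e: "e \<in> D" and eq: "Xp \<otimes> d = Xp \<otimes> e"
  shows "d = e"
proof -
  have "center_elt \<otimes> d = Xm \<otimes> (Xp \<otimes> d)" using d by (simp add: center_elt_def R.m_assoc)
  also have "\<dots> = center_elt \<otimes> e" unfolding eq using e by (simp add: center_elt_def R.m_assoc)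
  finally show ?thesis
    unfolding D_comm[OF center_elt_D d] D_comm[OF center_elt_D e] by (rule center_elt_cancel[OF d e])
qed

lemma twist_bij: "bij_betw twist D D"
proof (rule bij_betw_imageI)
  show "inj_on twist D"
  proof (rule inj_onI)
    fix d e assume d: "d \<in> D" and e: "e \<in> D" and "twist d = twist e"
    then have "Xp \<otimes> d = Xp \<otimes> e" by (simp only: twist_rel)
    then show "d = e" by (rule Xp_cancel[OF d e])
  qed
  show "twist ` D = D"
  proof (intro equalityI subsetI)
    fix e assume e: "e \<in> D"
    obtain d where d: "d \<in> D" "Xp \<otimes> d = e \<otimes> Xp" using K_pull[OF e] by blast
    then have "twist d = e" by (intro twist_eqI e)
    then show "e \<in> twist ` D" using d(1) by blast
  qed (auto intro: twist_D)
qed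

lemma twist_hom:
  assumes "d \<in> D" "e \<in> D"
  shows twist_add: "twist (d \<oplus> e) = twist d \<oplus> twist e"
    and twist_mult: "twist (d \<otimes> e) = twist d \<otimes> twist e"
    and twist_smult: "twist (c \<odot> d) = c \<odot> twist d"
    and twist_one: "twist \<one> = \<one>"
proof -
  show "twist (d \<oplus> e) = twist d \<oplus> twist e"
    using assms by (intro twist_eqI D_add twist_D) (simp_all add: R.r_distr R.l_distr twist_rel twist_D)
  show "twist (c \<odot> d) = c \<odot> twist d"
    using assms by (intro twist_eqI D_smult twist_D) (simp_all add: R.sc_mult_left R.sc_mult_right twist_rel twist_D)
  show "twist \<one> = \<one>" by (rule twist_eqI) simp_all
  have "Xp \<otimes> (d \<otimes> e) = (Xp \<otimes> d) \<otimes> e" using assms by (simp add: R.m_assoc)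
  also have "\<dots> = twist d \<otimes> (Xp \<otimes> e)" unfolding twist_rel[OF assms(1)] using assms by (simp add: R.m_assoc twist_D)
  also have "\<dots> = (twist d \<otimes> twist e) \<otimes> Xp" unfolding twist_rel[OF assms(2)] using assms by (simp add: R.m_assoc twist_D)
  finally show "twist (d \<otimes> e) = twist d \<otimes> twist e"
    using assms by (intro twist_eqI D_mult twist_D)
qed

text \<open>The product on the left lies in \<open>D\<close> and satisfies the equation that characterises the
  right-hand side, by associativity of \<open>X\<^sup>+ X\<^sup>- X\<^sup>+\<close>.\<close>

lemma Xp_Xm: "Xp \<otimes> Xm = twist center_elt"
proof -
  have "Xp \<otimes> Xm = K (plus_word @ minus_word)" by (simp add: K_append)
  also have "\<dots> \<in> D" by (rule degree_zero_word) (simp_all add: plus_word_def minus_word_def)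
  finally show ?thesis
    by (intro twist_eqI[symmetric]) (simp_all add: center_elt_def R.m_assoc)
qed

text \<open>Moving \<open>X\<^sup>-\<close> past \<open>\<sigma>(e)\<close> yields \<open>e' X\<^sup>-\<close> for some \<open>e' \<in> D\<close>. Multiplying by \<open>X\<^sup>+\<close> from the
  right gives \<open>e' X\<^sup>- X\<^sup>+ = e X\<^sup>- X\<^sup>+\<close>, hence \<open>e' = e\<close>.\<close>

lemma Xm_rel:
  assumes "e \<in> D"
  shows "Xm \<otimes> twist e = e \<otimes> Xm"
proof -
  obtain e' where e': "e' \<in> D" "Xm \<otimes> twist e = e' \<otimes> Xm" using K_push[OF twist_D[OF assms]] by blast
  have "e' \<otimes> center_elt = (e' \<otimes> Xm) \<otimes> Xp" using e'(1) by (simp add: center_elt_def R.m_assoc)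
  also have "\<dots> = Xm \<otimes> (Xp \<otimes> e)"
    unfolding e'(2)[symmetric] twist_rel[OF assms] using assms by (simp add: R.m_assoc twist_D)
  also have "\<dots> = center_elt \<otimes> e" using assms by (simp add: center_elt_def R.m_assoc)
  finally have "e' = e" unfolding D_comm[OF center_elt_D assms] by (rule center_elt_cancel[OF e'(1) assms])
  then show ?thesis using e'(2) by simp
qed

definition coeff_algebra :: "(complex, heegaard_gen star_poly set) module" where
  "coeff_algebra = \<lparr>carrier = D, mult = mult R, one = one R, zero = zero R, add = add R, smult = smult R\<rparr>"

lemma coeff_sel [simp]:
  "carrier coeff_algebra = D" "mult coeff_algebra = mult R" "one coeff_algebra = one R"
  "zero coeff_algebra = zero R" "add coeff_algebra = add R" "smult coeff_algebra = smult R"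
  by (simp_all add: coeff_algebra_def)

lemma coeff_complex_algebra: "complex_algebra coeff_algebra"
  by (rule complex_algebra_restrict) (auto simp: D_add D_mult D_smult)

abbreviation "free_gwa \<equiv> gwa_free coeff_algebra"
abbreviation "gwa_rels \<equiv> gwa_relators coeff_algebra twist center_elt"
abbreviation "G \<equiv> gwa coeff_algebra twist center_elt"
abbreviation "G_ideal \<equiv> gwa_ideal coeff_algebra twist center_elt"
abbreviation "letters \<equiv> Coeff ` D \<union> {XPlus, XMinus}"

lemma free_gwa_eq: "free_gwa = monoid_ring (words letters)"
  by (simp add: gwa_free_def)

lemma free_gwa_ring: "ring free_gwa"
  unfolding free_gwa_eq by (rule monoid_ring_ring[OF monoid_words])

sublocale FG: ring free_gwa by (rule free_gwa_ring)

abbreviation mono :: "heegaard_gen star_poly set gwa_letter list \<Rightarrow> heegaard_gen star_poly set gwa_poly"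
  where "mono w \<equiv> single w 1"

lemma mono_closed [simp]: "w \<in> lists letters \<Longrightarrow> single w c \<in> carrier free_gwa"
  by (simp add: free_gwa_eq)

lemma mono_append: "mono (v @ w) = mono v \<otimes>\<^bsub>free_gwa\<^esub> mono w"
  by (simp add: free_gwa_eq monoid_ring_sel)

lemma mono_Nil: "mono [] = \<one>\<^bsub>free_gwa\<^esub>"
  by (simp add: free_gwa_eq monoid_ring_sel)

lemma untwist:
  assumes "d \<in> D"
  shows "inv_into D twist d \<in> D" "twist (inv_into D twist d) = d"
  using twist_bij assms by (auto simp: bij_betw_def inv_into_into f_inv_into_f)

text \<open>The last family is stated with \<open>\<sigma>(d)\<close> and \<open>d\<close> in place of \<open>d\<close> and \<open>\<sigma>\<^sup>-\<^sup>1(d)\<close>, which is the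
  same set because \<open>\<sigma>\<close> is a bijection of \<open>D\<close>.\<close>

lemma gwa_rels_cases:
  assumes "r \<in> gwa_rels"
  obtains "r = mono [Coeff \<one>] \<ominus>\<^bsub>free_gwa\<^esub> \<one>\<^bsub>free_gwa\<^esub>"
  | c d where "c \<in> D" "d \<in> D" "r = mono [Coeff (c \<oplus> d)] \<ominus>\<^bsub>free_gwa\<^esub> (mono [Coeff c] \<oplus>\<^bsub>free_gwa\<^esub> mono [Coeff d])"
  | c d where "c \<in> D" "d \<in> D" "r = mono [Coeff (c \<otimes> d)] \<ominus>\<^bsub>free_gwa\<^esub> mono [Coeff c] \<otimes>\<^bsub>free_gwa\<^esub> mono [Coeff d]"
  | "r = mono [XMinus] \<otimes>\<^bsub>free_gwa\<^esub> mono [XPlus] \<ominus>\<^bsub>free_gwa\<^esub> mono [Coeff center_elt]"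
  | "r = mono [XPlus] \<otimes>\<^bsub>free_gwa\<^esub> mono [XMinus] \<ominus>\<^bsub>free_gwa\<^esub> mono [Coeff (twist center_elt)]"
  | d where "d \<in> D" "r = mono [XPlus] \<otimes>\<^bsub>free_gwa\<^esub> mono [Coeff d] \<ominus>\<^bsub>free_gwa\<^esub> mono [Coeff (twist d)] \<otimes>\<^bsub>free_gwa\<^esub> mono [XPlus]"
  | d where "d \<in> D" "r = mono [XMinus] \<otimes>\<^bsub>free_gwa\<^esub> mono [Coeff (twist d)] \<ominus>\<^bsub>free_gwa\<^esub> mono [Coeff d] \<otimes>\<^bsub>free_gwa\<^esub> mono [XMinus]"
proof -
  note cases = that
  have last: thesis
    if d: "d \<in> D" "r = mono [XMinus] \<otimes>\<^bsub>free_gwa\<^esub> mono [Coeff d] \<ominus>\<^bsub>free_gwa\<^esub> mono [Coeff (inv_into D twist d)] \<otimes>\<^bsub>free_gwa\<^esub> mono [XMinus]" for d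
    using cases(7)[of "inv_into D twist d"] untwist[OF d(1)] d(2) by simp
  show ?thesis
    using assms unfolding gwa_relators_def Let_def coeff_sel
    by (elim UnE CollectE exE conjE insertE emptyE)
       (fact cases(1) | erule cases(2-6); assumption | erule cases(4-5) | erule last; assumption)+
qed

lemma gwa_relsI:
  "mono [Coeff \<one>] \<ominus>\<^bsub>free_gwa\<^esub> \<one>\<^bsub>free_gwa\<^esub> \<in> gwa_rels"
  "c \<in> D \<Longrightarrow> d \<in> D \<Longrightarrow> mono [Coeff (c \<oplus> d)] \<ominus>\<^bsub>free_gwa\<^esub> (mono [Coeff c] \<oplus>\<^bsub>free_gwa\<^esub> mono [Coeff d]) \<in> gwa_rels"
  "c \<in> D \<Longrightarrow> d \<in> D \<Longrightarrow> mono [Coeff (c \<otimes> d)] \<ominus>\<^bsub>free_gwa\<^esub> mono [Coeff c] \<otimes>\<^bsub>free_gwa\<^esub> mono [Coeff d] \<in> gwa_rels"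
  "mono [XMinus] \<otimes>\<^bsub>free_gwa\<^esub> mono [XPlus] \<ominus>\<^bsub>free_gwa\<^esub> mono [Coeff center_elt] \<in> gwa_rels"
  "mono [XPlus] \<otimes>\<^bsub>free_gwa\<^esub> mono [XMinus] \<ominus>\<^bsub>free_gwa\<^esub> mono [Coeff (twist center_elt)] \<in> gwa_rels"
  "d \<in> D \<Longrightarrow> mono [XPlus] \<otimes>\<^bsub>free_gwa\<^esub> mono [Coeff d] \<ominus>\<^bsub>free_gwa\<^esub> mono [Coeff (twist d)] \<otimes>\<^bsub>free_gwa\<^esub> mono [XPlus] \<in> gwa_rels"
  "d \<in> D \<Longrightarrow> mono [XMinus] \<otimes>\<^bsub>free_gwa\<^esub> mono [Coeff (twist d)] \<ominus>\<^bsub>free_gwa\<^esub> mono [Coeff d] \<otimes>\<^bsub>free_gwa\<^esub> mono [XMinus] \<in> gwa_rels"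
  unfolding gwa_relators_def Let_def coeff_sel
  subgoal by (rule UnI1, rule UnI1, rule UnI1, rule UnI1, rule UnI1) blast
  subgoal by (rule UnI1, rule UnI1, rule UnI1, rule UnI1, rule UnI2) blast
  subgoal by (rule UnI1, rule UnI1, rule UnI1, rule UnI2) blast
  subgoal by (rule UnI1, rule UnI1, rule UnI2) blast
  subgoal by (rule UnI1, rule UnI1, rule UnI2) blast
  subgoal by (rule UnI1, rule UnI2) blast
  subgoal
    by (rule UnI2, rule CollectI, rule exI[of _ "twist d"])
       (use twist_bij twist_D in \<open>simp add: bij_betw_def inv_into_f_f\<close>)
  done

lemma gwa_rels_closed: "gwa_rels \<subseteq> carrier free_gwa"
proof
  fix r assume "r \<in> gwa_rels"
  then show "r \<in> carrier free_gwa"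
    by (cases rule: gwa_rels_cases)
       (auto intro!: FG.minus_closed FG.m_closed FG.add.m_closed mono_closed D_add D_mult twist_D)
qed

lemma G_ideal: "ideal G_ideal free_gwa"
  unfolding gwa_ideal_def by (rule FG.genideal_ideal[OF gwa_rels_closed])

sublocale GI: ideal G_ideal free_gwa by (rule G_ideal)

lemma G_ring: "ring G"
  unfolding gwa_def by (rule GI.quotient_is_ring)

sublocale G: ring G by (rule G_ring)

definition mono_class :: "heegaard_gen star_poly set gwa_letter list \<Rightarrow> heegaard_gen star_poly set gwa_poly set" where
  "mono_class w = G_ideal +>\<^bsub>free_gwa\<^esub> mono w"

lemma G_hom: "ring_hom_ring free_gwa G ((+>\<^bsub>free_gwa\<^esub>) G_ideal)"
  unfolding gwa_def by (rule GI.rcos_ring_hom_ring)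

lemma mono_class_closed [simp]: "w \<in> lists letters \<Longrightarrow> mono_class w \<in> carrier G"
proof -
  interpret \<pi>: ring_hom_ring free_gwa G "(+>\<^bsub>free_gwa\<^esub>) G_ideal" by (rule G_hom)
  show "w \<in> lists letters \<Longrightarrow> mono_class w \<in> carrier G"
    unfolding mono_class_def by (intro \<pi>.hom_closed mono_closed)
qed

lemma mono_class_append:
  "v \<in> lists letters \<Longrightarrow> w \<in> lists letters \<Longrightarrow> mono_class (v @ w) = mono_class v \<otimes>\<^bsub>G\<^esub> mono_class w"
proof -
  interpret \<pi>: ring_hom_ring free_gwa G "(+>\<^bsub>free_gwa\<^esub>) G_ideal" by (rule G_hom)
  assume "v \<in> lists letters" "w \<in> lists letters"
  then show ?thesis
    unfolding mono_class_def mono_append by (intro \<pi>.hom_mult mono_closed)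
qed

lemma mono_class_Nil: "mono_class [] = \<one>\<^bsub>G\<^esub>"
proof -
  interpret \<pi>: ring_hom_ring free_gwa G "(+>\<^bsub>free_gwa\<^esub>) G_ideal" by (rule G_hom)
  show ?thesis unfolding mono_class_def mono_Nil by (rule \<pi>.hom_one)
qed

lemma G_coset_eq:
  assumes "x \<ominus>\<^bsub>free_gwa\<^esub> y \<in> gwa_rels" "x \<in> carrier free_gwa" "y \<in> carrier free_gwa"
  shows "G_ideal +>\<^bsub>free_gwa\<^esub> x = G_ideal +>\<^bsub>free_gwa\<^esub> y"
proof -
  have "x \<ominus>\<^bsub>free_gwa\<^esub> y \<in> G_ideal"
    unfolding gwa_ideal_def using FG.genideal_self[OF gwa_rels_closed] assms(1) by (rule subsetD)
  then show ?thesis by (rule GI.coset_cong[OF assms(2,3)])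
qed

lemma G_relations:
  shows G_one: "mono_class [Coeff \<one>] = \<one>\<^bsub>G\<^esub>"
    and G_add: "c \<in> D \<Longrightarrow> d \<in> D \<Longrightarrow> mono_class [Coeff (c \<oplus> d)] = mono_class [Coeff c] \<oplus>\<^bsub>G\<^esub> mono_class [Coeff d]"
    and G_mult: "c \<in> D \<Longrightarrow> d \<in> D \<Longrightarrow> mono_class [Coeff (c \<otimes> d)] = mono_class [Coeff c, Coeff d]"
    and G_minus_plus: "mono_class [XMinus, XPlus] = mono_class [Coeff center_elt]"
    and G_plus_minus: "mono_class [XPlus, XMinus] = mono_class [Coeff (twist center_elt)]"
    and G_plus: "d \<in> D \<Longrightarrow> mono_class [XPlus, Coeff d] = mono_class [Coeff (twist d), XPlus]"
    and G_minus: "d \<in> D \<Longrightarrow> mono_class [XMinus, Coeff (twist d)] = mono_class [Coeff d, XMinus]"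
proof -
  interpret \<pi>: ring_hom_ring free_gwa G "(+>\<^bsub>free_gwa\<^esub>) G_ideal" by (rule G_hom)
  have two: "mono [L] \<otimes>\<^bsub>free_gwa\<^esub> mono [M] = mono [L, M]" for L M
    using mono_append[of "[L]" "[M]"] by simp
  note rel = gwa_relsI[unfolded two]
  show "mono_class [Coeff \<one>] = \<one>\<^bsub>G\<^esub>"
    unfolding mono_class_Nil[symmetric] mono_class_def
    by (rule G_coset_eq[OF rel(1)[folded mono_Nil]]) simp_all
  show "mono_class [Coeff (c \<oplus> d)] = mono_class [Coeff c] \<oplus>\<^bsub>G\<^esub> mono_class [Coeff d]"
    if cd: "c \<in> D" "d \<in> D"
  proof -
    have "mono_class [Coeff (c \<oplus> d)] = G_ideal +>\<^bsub>free_gwa\<^esub> (mono [Coeff c] \<oplus>\<^bsub>free_gwa\<^esub> mono [Coeff d])"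
      unfolding mono_class_def
      by (rule G_coset_eq[OF rel(2)[OF cd]]) (intro mono_closed FG.add.m_closed; use cd D_add in simp)+
    also have "\<dots> = mono_class [Coeff c] \<oplus>\<^bsub>G\<^esub> mono_class [Coeff d]"
      unfolding mono_class_def by (rule \<pi>.hom_add) (use cd in simp_all)
    finally show ?thesis .
  qed
  show "c \<in> D \<Longrightarrow> d \<in> D \<Longrightarrow> mono_class [Coeff (c \<otimes> d)] = mono_class [Coeff c, Coeff d]"
    unfolding mono_class_def by (rule G_coset_eq[OF rel(3)]) (auto intro!: mono_closed D_mult)
  show "mono_class [XMinus, XPlus] = mono_class [Coeff center_elt]"
    unfolding mono_class_def by (rule G_coset_eq[OF rel(4)]) (auto intro!: mono_closed)
  show "mono_class [XPlus, XMinus] = mono_class [Coeff (twist center_elt)]"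
    unfolding mono_class_def by (rule G_coset_eq[OF rel(5)]) (auto intro!: mono_closed twist_D)
  show "d \<in> D \<Longrightarrow> mono_class [XPlus, Coeff d] = mono_class [Coeff (twist d), XPlus]"
    unfolding mono_class_def by (rule G_coset_eq[OF rel(6)]) (auto intro!: mono_closed twist_D)
  show "d \<in> D \<Longrightarrow> mono_class [XMinus, Coeff (twist d)] = mono_class [Coeff d, XMinus]"
    unfolding mono_class_def by (rule G_coset_eq[OF rel(7)]) (auto intro!: mono_closed twist_D)
qed

definition letter_val :: "heegaard_gen star_poly set gwa_letter \<Rightarrow> heegaard_gen star_poly set" where
  "letter_val L = (case L of Coeff d \<Rightarrow> d | XPlus \<Rightarrow> Xp | XMinus \<Rightarrow> Xm)"

lemma letter_val_simps [simp]:
  "letter_val (Coeff d) = d" "letter_val XPlus = Xp" "letter_val XMinus = Xm"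
  by (simp_all add: letter_val_def)

lemma letter_val_closed: "w \<in> lists letters \<Longrightarrow> letter_val ` set w \<subseteq> carrier R"
  by auto

lemma gwa_map_exists:
  "\<exists>f. ring_hom_ring G R f \<and> (\<forall>w\<in>lists letters. f (mono_class w) = word_val R letter_val w)"
proof -
  interpret Z: scalar_ring R "\<lambda>n::int. add_pow R n" by (rule R.int_scalar_ring)
  let ?v = "word_val R letter_val"
  have vc: "?v \<in> carrier (words letters) \<rightarrow> carrier R"
    using R.word_val_closed[OF letter_val_closed] by simp
  define f0 where "f0 = Z.lin_ext ?v"
  have f0: "f0 \<in> ring_hom free_gwa R"
    unfolding free_gwa_eq f0_def
    by (rule Z.lin_ext_ring_hom[OF vc monoid_words])
       (simp_all add: R.word_val_append letter_val_closed)
  interpret f0: ring_hom_ring free_gwa R f0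
    by (rule ring_hom_ringI2[OF FG.ring_axioms R.ring_axioms f0])
  have mono: "f0 (mono w) = ?v w" if "w \<in> lists letters" for w
    using R.word_val_closed[OF letter_val_closed[OF that]] Z.lin_ext_single[of ?v w 1]
    by (simp only: f0_def Z.sc_one)
  have gens: "f0 (mono [Coeff d]) = d" "f0 (mono [XPlus]) = Xp" "f0 (mono [XMinus]) = Xm" if "d \<in> D" for d
    using that by (simp_all add: mono)
  have minus: "f0 (x \<ominus>\<^bsub>free_gwa\<^esub> y) = \<zero>"
    if "x \<in> carrier free_gwa" "y \<in> carrier free_gwa" "f0 x = f0 y" for x y
    using that by (simp add: a_minus_def R.r_neg)
  have gens0: "f0 (mono [XPlus]) = Xp" "f0 (mono [XMinus]) = Xm" by (rule gens(2,3)[OF D_one])+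
  have ker: "f0 r = \<zero>" if "r \<in> gwa_rels" for r
    using that
  proof (cases rule: gwa_rels_cases)
    case 1 then show ?thesis by (simp add: minus gens)
  next
    case (2 c d) then show ?thesis by (simp add: minus gens D_add)
  next
    case (3 c d) then show ?thesis by (simp add: minus gens D_mult)
  next
    case 4 then show ?thesis by (simp add: minus gens gens0 center_elt_def[symmetric])
  next
    case 5 then show ?thesis by (simp add: minus gens gens0 twist_D Xp_Xm)
  next
    case (6 d) then show ?thesis by (simp add: minus gens gens0 twist_D twist_rel)
  next
    case (7 d) then show ?thesis by (simp add: minus gens gens0 twist_D Xm_rel)
  qed
  have ker': "f0 x = \<zero>" if "x \<in> G_ideal" for x
  proof (rule ring_hom_kernel_genideal[OF f0 FG.ring_axioms R.ring_axioms gwa_rels_closed])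
    show "x \<in> genideal free_gwa gwa_rels" using that by (simp only: gwa_ideal_def)
  qed (rule ker)
  note lift = GI.quot_lift[OF f0 R.ring_axioms ker']
  have "ring_hom_ring G R (quot_lift f0)"
    using lift(2) unfolding gwa_def[symmetric] by (intro ring_hom_ringI2 G.ring_axioms R.ring_axioms)
  moreover have "quot_lift f0 (mono_class w) = ?v w" if "w \<in> lists letters" for w
    unfolding mono_class_def by (subst lift(1)[OF _ mono_closed[OF that]]) (simp_all add: mono[OF that])
  ultimately show ?thesis by blast
qed

end

context heegaard_action
begin

section \<open>Normal forms and the isomorphism\<close>

definition x_word :: "int \<Rightarrow> heegaard_gen star_poly set gwa_letter list" where
  "x_word s = (if s \<ge> 0 then replicate (nat s) XPlus else replicate (nat (- s)) XMinus)"

lemma x_word_letters [simp]: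
  "x_word s \<in> lists letters" "x_word s \<in> lists (insert XPlus (insert XMinus (Coeff ` D)))"
  by (auto simp: x_word_def)

lemma x_word_succ: "s \<ge> 0 \<Longrightarrow> x_word (s + 1) = XPlus # x_word s"
  by (simp add: x_word_def nat_add_distrib)

lemma x_word_pred: "s \<le> 0 \<Longrightarrow> x_word (s - 1) = XMinus # x_word s"
proof -
  assume "s \<le> 0"
  then have "nat (- (s - 1)) = Suc (nat (- s))" by simp
  then show ?thesis using \<open>s \<le> 0\<close> by (cases "s = 0") (simp_all add: x_word_def)
qed

lemma mono_class_Cons: "L \<in> letters \<Longrightarrow> w \<in> lists letters \<Longrightarrow> mono_class (L # w) = mono_class [L] \<otimes>\<^bsub>G\<^esub> mono_class w"
  using mono_class_append[of "[L]" w] by simp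

lemma rewrite_prefix:
  assumes "mono_class u = mono_class v" "u \<in> lists letters" "v \<in> lists letters" "w \<in> lists letters"
  shows "mono_class (u @ w) = mono_class (v @ w)"
  by (simp only: mono_class_append assms)

lemma coeff_coeff:
  assumes "d \<in> D" "e \<in> D" "w \<in> lists letters"
  shows "mono_class (Coeff d # Coeff e # w) = mono_class (Coeff (d \<otimes> e) # w)"
  using rewrite_prefix[OF G_mult[OF assms(1,2), symmetric] _ _ assms(3)] assms D_mult by simp

text \<open>A letter that meets the opposite one is absorbed into a coefficient by one of the two
  product relations.\<close>

lemma x_letter_step:
  assumes "L \<in> {XPlus, XMinus}"
  shows "\<exists>d\<in>D. \<exists>s'. mono_class (L # x_word s) = mono_class (Coeff d # x_word s')"
proof -
  have one: "\<exists>d\<in>D. \<exists>s'. mono_class (x_word t) = mono_class (Coeff d # x_word s')" for t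
  proof (intro bexI[of _ "\<one>"] exI[of _ t])
    have "mono_class (Coeff \<one> # x_word t) = mono_class [Coeff \<one>] \<otimes>\<^bsub>G\<^esub> mono_class (x_word t)"
      by (rule mono_class_Cons) simp_all
    then show "mono_class (x_word t) = mono_class (Coeff \<one> # x_word t)" by (simp add: G_one)
  qed simp
  consider "L = XPlus" "s \<ge> 0" | "L = XPlus" "s < 0" | "L = XMinus" "s \<le> 0" | "L = XMinus" "s > 0"
    using assms by fastforce
  then show ?thesis
  proof cases
    case 1 then show ?thesis using one[of "s + 1"] x_word_succ[of s] by simp
  next
    case 2
    then have "x_word s = XMinus # x_word (s + 1)" using x_word_pred[of "s + 1"] by simp
    then show ?thesis
      using 2 rewrite_prefix[OF G_plus_minus, of "x_word (s + 1)"] twist_D[OF center_elt_D] by auto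
  next
    case 3 then show ?thesis using one[of "s - 1"] x_word_pred[of s] by simp
  next
    case 4
    then have "x_word s = XPlus # x_word (s - 1)" using x_word_succ[of "s - 1"] by simp
    then show ?thesis
      using 4 rewrite_prefix[OF G_minus_plus, of "x_word (s - 1)"] center_elt_D by auto
  qed
qed

text \<open>The letter in front is first exchanged with the coefficient, by means of \<open>\<sigma>\<close> or its
  inverse, and then absorbed by \<open>x_letter_step\<close>.\<close>

lemma gwa_word_normal_form:
  "w \<in> lists letters \<Longrightarrow> \<exists>d\<in>D. \<exists>s. mono_class w = mono_class (Coeff d # x_word s)"
proof (induction w)
  case Nil
  show ?case
    by (intro bexI[of _ "\<one>"] exI[of _ 0]) (simp_all add: x_word_def G_one mono_class_Nil)
next
  case (Cons L w)
  have L: "L \<in> letters" and w: "w \<in> lists letters" using Cons.prems by auto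
  obtain d s where d: "d \<in> D" and ds: "mono_class w = mono_class (Coeff d # x_word s)"
    using Cons.IH[OF w] by blast
  have cons: "mono_class (L # w) = mono_class (L # Coeff d # x_word s)"
  proof -
    have "Coeff d # x_word s \<in> lists letters" using d by simp
    then show ?thesis unfolding mono_class_Cons[OF L w] ds by (rule mono_class_Cons[OF L, symmetric])
  qed
  have push: ?case if M: "M \<in> {XPlus, XMinus}" and e: "e \<in> D"
    and rel: "mono_class [M, Coeff d] = mono_class [Coeff e, M]" and "L = M" for M e
  proof -
    obtain d' s' where d': "d' \<in> D" "mono_class (M # x_word s) = mono_class (Coeff d' # x_word s')"
      using x_letter_step[OF M] by blast
    have M': "M \<in> letters" using M by auto
    have "mono_class (L # w) = mono_class (Coeff e # M # x_word s)"
      unfolding cons using rewrite_prefix[OF rel, of "x_word s"] M' d e \<open>L = M\<close> by simp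
    also have "\<dots> = mono_class (Coeff e # Coeff d' # x_word s')"
    proof -
      have e': "Coeff e \<in> letters" using e by blast
      have "M # x_word s \<in> lists letters" "Coeff d' # x_word s' \<in> lists letters" using M' d'(1) by simp_all
      then show ?thesis by (simp only: mono_class_Cons[OF e'] d'(2))
    qed
    also have "\<dots> = mono_class (Coeff (e \<otimes> d') # x_word s')"
      by (rule coeff_coeff) (use e d' in simp_all)
    finally show ?thesis using D_mult[OF e d'(1)] by blast
  qed
  show ?case
  proof (cases L)
    case (Coeff e)
    then have e: "e \<in> D" using L by auto
    have "mono_class (L # w) = mono_class (Coeff (e \<otimes> d) # x_word s)"
      unfolding cons using coeff_coeff[OF e d x_word_letters(1)] Coeff by simp
    then show ?thesis using D_mult[OF e d] by blast
  next
    case XPlus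
    show ?thesis by (rule push[OF _ twist_D[OF d] G_plus[OF d] XPlus]) simp
  next
    case XMinus
    show ?thesis
      by (rule push[OF _ untwist(1)[OF d] G_minus[OF untwist(1)[OF d], unfolded untwist(2)[OF d]] XMinus]) simp
  qed
qed

lemma coeff_hom:
  "ring_hom_ring coeff_algebra G (\<lambda>d. mono_class [Coeff d])"
proof -
  have "ring coeff_algebra" using coeff_complex_algebra by (simp add: complex_algebra_def)
  then show ?thesis
    by (intro ring_hom_ringI2 G_ring ring_hom_memI)
       (simp_all add: G_one G_add G_mult mono_class_append[of "[_]" "[_]", simplified])
qed

lemma coeff_zero: "mono_class [Coeff \<zero>] = \<zero>\<^bsub>G\<^esub>"
proof -
  interpret \<iota>: ring_hom_ring coeff_algebra G "\<lambda>d. mono_class [Coeff d]" by (rule coeff_hom)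
  show ?thesis using \<iota>.hom_zero by (simp only: coeff_sel)
qed

text \<open>Integers appear as coefficients of words in the ring of generators and relations, but
  integer multiples of 1 already come from \<open>D\<close>.\<close>

lemma int_coefficient: "\<exists>d\<in>D. G_ideal +>\<^bsub>free_gwa\<^esub> single [] c = mono_class [Coeff d]"
proof -
  interpret \<pi>: ring_hom_ring free_gwa G "(+>\<^bsub>free_gwa\<^esub>) G_ideal" by (rule G_hom)
  have add: "G_ideal +>\<^bsub>free_gwa\<^esub> single [] (c + d) =
      (G_ideal +>\<^bsub>free_gwa\<^esub> single [] c) \<oplus>\<^bsub>G\<^esub> (G_ideal +>\<^bsub>free_gwa\<^esub> single [] d)" for c d
  proof -
    have "single [] (c + d) = single [] c \<oplus>\<^bsub>free_gwa\<^esub> single [] d"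
      by (simp add: single_add free_gwa_eq monoid_ring_sel)
    then show ?thesis by (simp only: \<pi>.hom_add mono_closed lists.Nil)
  qed
  have one: "G_ideal +>\<^bsub>free_gwa\<^esub> single [] 1 = mono_class [Coeff \<one>]"
    unfolding G_one mono_class_Nil[symmetric] by (simp only: mono_class_def)
  have zero: "G_ideal +>\<^bsub>free_gwa\<^esub> single [] 0 = mono_class [Coeff \<zero>]"
  proof -
    have "single [] 0 = \<zero>\<^bsub>free_gwa\<^esub>" by (simp add: free_gwa_eq monoid_ring_sel)
    then show ?thesis using \<pi>.hom_zero by (simp only: coeff_zero)
  qed
  show ?thesis
  proof (induction c rule: int_induct[of _ 0])
    case base
    then show ?case using zero D_zero by blast
  next
    case (step1 c)
    then obtain d where d: "d \<in> D" "G_ideal +>\<^bsub>free_gwa\<^esub> single [] c = mono_class [Coeff d]" by blast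
    have "G_ideal +>\<^bsub>free_gwa\<^esub> single [] (c + 1) = mono_class [Coeff (d \<oplus> \<one>)]"
      unfolding add d(2) one by (rule G_add[OF d(1) D_one, symmetric])
    then show ?case using D_add[OF d(1) D_one] by blast
  next
    case (step2 c)
    then obtain d where d: "d \<in> D" "G_ideal +>\<^bsub>free_gwa\<^esub> single [] c = mono_class [Coeff d]" by blast
    define e where "e = d \<ominus> \<one>"
    have e: "e \<in> D" "e \<oplus> \<one> = d"
      using d(1) D_minus by (simp_all add: e_def) (simp add: a_minus_def R.a_assoc R.l_neg)
    have "(G_ideal +>\<^bsub>free_gwa\<^esub> single [] (c - 1)) \<oplus>\<^bsub>G\<^esub> mono_class [Coeff \<one>] =
        mono_class [Coeff e] \<oplus>\<^bsub>G\<^esub> mono_class [Coeff \<one>]"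
      using add[of "c - 1" 1] d(2) one G_add[OF e(1) D_one] e(2) by simp
    then have "G_ideal +>\<^bsub>free_gwa\<^esub> single [] (c - 1) = mono_class [Coeff e]"
      by (subst (asm) G.add.right_cancel) (simp_all add: e(1))
    then show ?case using e(1) by blast
  qed
qed

definition x_part :: "int \<Rightarrow> heegaard_gen star_poly set gwa_poly set set" where
  "x_part s = (\<lambda>d. mono_class (Coeff d # x_word s)) ` D"

lemma coeff_Cons: "d \<in> D \<Longrightarrow> mono_class (Coeff d # x_word s) = mono_class [Coeff d] \<otimes>\<^bsub>G\<^esub> mono_class (x_word s)"
  by (rule mono_class_Cons) simp_all

lemma gwa_span:
  assumes "y \<in> carrier G"
  shows "y \<in> graded_span G x_part"
proof -
  interpret \<pi>: ring_hom_ring free_gwa G "(+>\<^bsub>free_gwa\<^esub>) G_ideal" by (rule G_hom)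
  have closed: "x_part s \<subseteq> carrier G" for s
    unfolding x_part_def by (intro image_subsetI mono_class_closed) simp
  have zero: "\<zero>\<^bsub>G\<^esub> \<in> x_part s" for s
  proof -
    have "mono_class (Coeff \<zero> # x_word s) = \<zero>\<^bsub>G\<^esub>"
      unfolding coeff_Cons[OF D_zero] coeff_zero by (rule G.l_null) simp
    from this[symmetric] D_zero show ?thesis unfolding x_part_def by (rule image_eqI)
  qed
  have part_add: "x \<oplus>\<^bsub>G\<^esub> x' \<in> x_part s" if x: "x \<in> x_part s" "x' \<in> x_part s" for x x' s
  proof -
    obtain d d' where d: "d \<in> D" "x = mono_class (Coeff d # x_word s)" "d' \<in> D" "x' = mono_class (Coeff d' # x_word s)"
      using x unfolding x_part_def by blast
    have "x \<oplus>\<^bsub>G\<^esub> x' = mono_class (Coeff (d \<oplus> d') # x_word s)"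
      unfolding d(2,4) coeff_Cons[OF D_add[OF d(1,3)]] coeff_Cons[OF d(1)] coeff_Cons[OF d(3)] G_add[OF d(1,3)]
      using d(1,3) by (intro G.l_distr[symmetric] mono_class_closed) simp_all
    then show ?thesis unfolding x_part_def using D_add[OF d(1,3)] by blast
  qed
  obtain f where f: "f \<in> carrier free_gwa" "y = G_ideal +>\<^bsub>free_gwa\<^esub> f"
    using assms unfolding gwa_def GI.quot_carrier by blast
  have "G_ideal +>\<^bsub>free_gwa\<^esub> f \<in> graded_span G x_part"
    using f(1) unfolding free_gwa_eq
  proof (induction f rule: monoid_ring_induct)
    case zero
    have "\<zero>\<^bsub>G\<^esub> \<in> graded_span G x_part" by (rule G.graded_span_single[where M = x_part, OF \<open>\<And>s. \<zero>\<^bsub>G\<^esub> \<in> x_part s\<close>[of 0] closed])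
    then show ?case using \<pi>.hom_zero by (simp add: free_gwa_eq monoid_ring_sel)
  next
    case (single w c)
    then have w: "w \<in> lists letters" by simp
    obtain d where d: "d \<in> D" "G_ideal +>\<^bsub>free_gwa\<^esub> single [] c = mono_class [Coeff d]"
      using int_coefficient by blast
    obtain e s where e: "e \<in> D" "mono_class w = mono_class (Coeff e # x_word s)"
      using gwa_word_normal_form[OF w] by blast
    have "single w c = single [] c \<otimes>\<^bsub>free_gwa\<^esub> mono w"
      by (simp add: free_gwa_eq monoid_ring_sel)
    then have "G_ideal +>\<^bsub>free_gwa\<^esub> single w c = mono_class [Coeff d] \<otimes>\<^bsub>G\<^esub> mono_class w"
      using w d(2) by (simp only: \<pi>.hom_mult mono_closed lists.Nil mono_class_def)
    also have "\<dots> = mono_class (Coeff d # Coeff e # x_word s)"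
      unfolding e(2) using d(1) e(1) by (intro mono_class_Cons[symmetric]) simp_all
    also have "\<dots> = mono_class (Coeff (d \<otimes> e) # x_word s)"
      by (rule coeff_coeff[OF d(1) e(1)]) simp
    finally have "G_ideal +>\<^bsub>free_gwa\<^esub> single w c \<in> x_part s"
      unfolding x_part_def using D_mult[OF d(1) e(1)] by blast
    then show ?case unfolding free_gwa_eq by (rule G.graded_span_single[where M = x_part, OF _ closed])
  next
    case (add f g)
    have "f + g = f \<oplus>\<^bsub>free_gwa\<^esub> g" by (simp add: free_gwa_eq monoid_ring_sel)
    then have "G_ideal +>\<^bsub>free_gwa\<^esub> (f + g) = (G_ideal +>\<^bsub>free_gwa\<^esub> f) \<oplus>\<^bsub>G\<^esub> (G_ideal +>\<^bsub>free_gwa\<^esub> g)"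
      using add(1,2)[folded free_gwa_eq] by (simp only: \<pi>.hom_add)
    then show ?case
      using G.graded_span_add[where M = x_part, OF closed zero part_add add(3,4)] by (simp only: free_gwa_eq)
  qed
  then show ?thesis by (simp only: f(2))
qed

text \<open>The word of \<open>R\<close> that corresponds to \<open>x_word s\<close>; its bidegree is \<open>s (l, - k)\<close>.\<close>

definition shift_word :: "int \<Rightarrow> heegaard_gen letter list" where
  "shift_word s = (if s \<ge> 0 then concat (replicate (nat s) plus_word) else concat (replicate (nat (- s)) minus_word))"

lemma word_deg_concat: "word_deg g (concat (replicate n w)) = int n * word_deg g w"
  by (induction n) (simp_all add: algebra_simps)

lemma word_deg_shift_word: "word_deg Ga (shift_word s) = s * l" "word_deg Gb (shift_word s) = - s * k"
  by (auto simp: shift_word_def word_deg_concat plus_word_def minus_word_def)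

lemma K_concat: "K (concat (replicate n w)) = K w [^] n"
proof (induction n)
  case (Suc n)
  then show ?case by (simp only: replicate_Suc concat.simps K_append R.nat_pow_Suc2 K_carrier)
qed simp

lemma val_x_word: "word_val R letter_val (x_word s) = K (shift_word s)"
proof -
  have "word_val R letter_val (replicate n XPlus) = K (concat (replicate n plus_word))"
    "word_val R letter_val (replicate n XMinus) = K (concat (replicate n minus_word))" for n
    by (induction n) (simp_all add: K_append)
  then show ?thesis by (simp add: x_word_def shift_word_def)
qed

text \<open>As \<open>k\<close> and \<open>l\<close> are coprime, \<open>l\<close> divides \<open>i\<close>.\<close>

lemma degree_zero_normal_form:
  assumes "k * i + l * j = 0"
  obtains s c where "K (nf i j) = c \<odot> K (shift_word s)"
proof -
  have "l dvd k * i" using assms by (metis add.inverse_unique add.commute dvd_minus_iff dvd_triv_left)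
  then have "l dvd i" using coprime by (metis coprime_commute coprime_dvd_mult_right_iff)
  then obtain s where s: "i = l * s" by (auto elim: dvdE)
  have "l * (k * s + j) = 0" using assms by (simp add: s algebra_simps)
  then have j: "j = - (k * s)" using l by simp
  show ?thesis
  proof (cases "s \<ge> 0")
    case True
    then have "nf i j = nf (int (nat s) * l) (int (nat s) * (- k))" by (simp add: s j mult.commute)
    then show ?thesis
      using nf_power[of "nat s" l "- k"] True that[of _ s] by (auto simp: shift_word_def K_concat plus_word_def)
  next
    case False
    then have "nf i j = nf (int (nat (- s)) * (- l)) (int (nat (- s)) * k)" by (simp add: s j mult.commute)
    then show ?thesis
      using nf_power[of "nat (- s)" "- l" k] False that[of _ s] by (auto simp: shift_word_def K_concat minus_word_def)
  qed
qed

text \<open>Surjectivity is \<open>fixed_expansion\<close> together with \<open>degree_zero_normal_form\<close>. Injectivity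
  is \<open>gwa_span\<close> together with \<open>graded_sum_eq_zero\<close>, which applies because the bidegrees
  \<open>s (l, - k)\<close> are distinct (\<open>l \<noteq> 0\<close>).\<close>

lemma gwa_iso_exists:
  "\<exists>f. ring_hom_ring G R f \<and> bij_betw f (carrier G) (fixed k l) \<and> (\<forall>d\<in>D. f (mono_class [Coeff d]) = d)"
proof -
  obtain f where f: "ring_hom_ring G R f" "\<And>w. w \<in> lists letters \<Longrightarrow> f (mono_class w) = word_val R letter_val w"
    using gwa_map_exists by blast
  interpret f: ring_hom_ring G R f by (rule f(1))
  have f_part: "f (mono_class (Coeff d # x_word s)) = d \<otimes> K (shift_word s)" if "d \<in> D" for d s
    using that by (subst f(2)) (simp_all add: val_x_word)
  have expand: "\<exists>S d. finite S \<and> (\<forall>s\<in>S. d s \<in> D) \<and> y = (\<Oplus>\<^bsub>G\<^esub>s\<in>S. mono_class (Coeff (d s) # x_word s)) \<and>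
      f y = (\<Oplus>s\<in>S. d s \<otimes> K (shift_word s))" if y_closed: "y \<in> carrier G" for y
  proof -
    obtain S m where S: "finite S" "\<forall>s\<in>S. m s \<in> x_part s" "y = (\<Oplus>\<^bsub>G\<^esub>s\<in>S. m s)"
      using gwa_span[OF y_closed] unfolding graded_span_def by blast
    have "\<forall>s\<in>S. \<exists>d. d \<in> D \<and> m s = mono_class (Coeff d # x_word s)" using S(2) unfolding x_part_def by blast
    then obtain d where d: "\<forall>s\<in>S. d s \<in> D \<and> m s = mono_class (Coeff (d s) # x_word s)" by metis
    have y: "y = (\<Oplus>\<^bsub>G\<^esub>s\<in>S. mono_class (Coeff (d s) # x_word s))"
      unfolding S(3) using d by (intro G.finsum_cong') auto
    have "f y = (\<Oplus>s\<in>S. f (mono_class (Coeff (d s) # x_word s)))"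
      unfolding y using d by (intro ring_hom_finsum[OF f(1) S(1)]) auto
    also have "\<dots> = (\<Oplus>s\<in>S. d s \<otimes> K (shift_word s))"
      using d by (intro R.finsum_cong') (auto simp: f_part)
    finally show ?thesis using S(1) d y by blast
  qed
  have fixed_part: "d \<otimes> K (shift_word s) \<in> fixed k l" if "d \<in> D" for d s
    by (intro fixed_mult fixed_D[OF that] fixed_word) (simp add: weight_def word_deg_shift_word)
  have fixed_sum: "(\<Oplus>s\<in>S. m s) \<in> fixed k l" if "finite S" "\<forall>s\<in>S. m s \<in> fixed k l" for S :: "int set" and m
    using that
  proof (induction S rule: finite_induct)
    case empty
    show ?case using fixed_D[OF D_zero] by simp
  next
    case (insert s S)
    then have "m s \<in> fixed k l" "(\<Oplus>s\<in>S. m s) \<in> fixed k l" by auto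
    moreover have "m \<in> S \<rightarrow> carrier R" "m s \<in> carrier R" using insert fixed_carrier by blast+
    ultimately show ?case using insert fixed_add by simp
  qed
  have range: "f y \<in> fixed k l" if y: "y \<in> carrier G" for y
  proof -
    obtain S d where "finite S" "\<forall>s\<in>S. d s \<in> D" "f y = (\<Oplus>s\<in>S. d s \<otimes> K (shift_word s))"
      using expand[OF y] by blast
    then show ?thesis using fixed_sum[of S "\<lambda>s. d s \<otimes> K (shift_word s)"] fixed_part by simp
  qed
  have surj: "x \<in> f ` carrier G" if x: "x \<in> fixed k l" for x
  proof -
    obtain S d where S: "finite S" "\<And>s. d s \<in> D" "\<And>s. s \<in> S \<Longrightarrow> k * fst s + l * snd s = 0"
      "x = (\<Oplus>s\<in>S. d s \<otimes> K (nf (fst s) (snd s)))"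
      using fixed_expansion[OF x] by blast
    have "\<exists>y. y \<in> carrier G \<and> f y = d s \<otimes> K (nf (fst s) (snd s))" if s: "s \<in> S" for s
    proof -
      obtain n c where "K (nf (fst s) (snd s)) = c \<odot> K (shift_word n)"
        using degree_zero_normal_form[OF S(3)[OF s]] by blast
      then have "d s \<otimes> K (nf (fst s) (snd s)) = (c \<odot> d s) \<otimes> K (shift_word n)"
        using S(2)[of s] by (simp add: R.sc_mult_left R.sc_mult_right)
      then have "f (mono_class (Coeff (c \<odot> d s) # x_word n)) = d s \<otimes> K (nf (fst s) (snd s))"
        using f_part[OF D_smult[OF S(2)]] by simp
      moreover have "mono_class (Coeff (c \<odot> d s) # x_word n) \<in> carrier G"
        using D_smult[OF S(2)] by (intro mono_class_closed) simp
      ultimately show ?thesis by blast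
    qed
    then obtain y where y: "\<And>s. s \<in> S \<Longrightarrow> y s \<in> carrier G \<and> f (y s) = d s \<otimes> K (nf (fst s) (snd s))" by metis
    have "f (\<Oplus>\<^bsub>G\<^esub>s\<in>S. y s) = (\<Oplus>s\<in>S. f (y s))"
      using y by (intro ring_hom_finsum[OF f(1) S(1)]) auto
    also have "\<dots> = x" unfolding S(4) using y S(2) by (intro R.finsum_cong') auto
    finally show ?thesis using y by (intro image_eqI[of _ _ "\<Oplus>\<^bsub>G\<^esub>s\<in>S. y s"]) (auto intro!: G.finsum_closed)
  qed
  have inj: "y = \<zero>\<^bsub>G\<^esub>" if y: "y \<in> carrier G" and zero: "f y = \<zero>" for y
  proof -
    obtain S d where S: "finite S" "\<forall>s\<in>S. d s \<in> D" "y = (\<Oplus>\<^bsub>G\<^esub>s\<in>S. mono_class (Coeff (d s) # x_word s))"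
      "f y = (\<Oplus>s\<in>S. d s \<otimes> K (shift_word s))"
      using expand[OF y] by blast
    have "inj_on (\<lambda>s. (word_deg Ga (shift_word s), word_deg Gb (shift_word s))) S"
      using l by (auto simp: inj_on_def word_deg_shift_word)
    then have "d s = \<zero>" if "s \<in> S" for s
      using graded_sum_eq_zero[of S d shift_word s] S zero that by auto
    then have "mono_class (Coeff (d s) # x_word s) = \<zero>\<^bsub>G\<^esub>" if "s \<in> S" for s
      using that by (simp add: coeff_Cons coeff_zero)
    then show ?thesis unfolding S(3) by (simp cong: G.finsum_cong)
  qed
  have "inj_on f (carrier G)"
  proof (rule inj_onI)
    fix x y assume xy: "x \<in> carrier G" "y \<in> carrier G" "f x = f y"
    then have "f (x \<ominus>\<^bsub>G\<^esub> y) = \<zero>" by (simp add: a_minus_def R.r_neg)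
    then have "x \<ominus>\<^bsub>G\<^esub> y = \<zero>\<^bsub>G\<^esub>" by (intro inj G.minus_closed xy)
    then show "x = y" by (rule G.minus_eq_zeroD[OF xy(1,2)])
  qed
  then have "bij_betw f (carrier G) (fixed k l)"
    using range surj by (intro bij_betw_imageI) blast+
  moreover have "f (mono_class [Coeff d]) = d" if "d \<in> D" for d
    using that by (subst f(2)) simp_all
  ultimately show ?thesis using f(1) by blast
qed

lemma O_S2_carrier: "carrier (O_S2 p q \<theta> k l) = fixed k l"
  unfolding O_S2_def fixed_def R_def[symmetric] by simp

lemma O_S2_sel:
  "mult (O_S2 p q \<theta> k l) = mult R" "one (O_S2 p q \<theta> k l) = one R" "zero (O_S2 p q \<theta> k l) = zero R"
  "add (O_S2 p q \<theta> k l) = add R" "smult (O_S2 p q \<theta> k l) = smult R"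
  unfolding O_S2_def R_def[symmetric] by simp_all

lemma O_S2_gwa: "is_degree_one_gwa (O_S2 p q \<theta> k l)"
proof -
  obtain f where f: "ring_hom_ring G R f" "bij_betw f (carrier G) (fixed k l)" "\<And>d. d \<in> D \<Longrightarrow> f (mono_class [Coeff d]) = d"
    using gwa_iso_exists by blast
  interpret f: ring_hom_ring G R f by (rule f(1))
  have twist_iso: "twist \<in> ring_iso coeff_algebra coeff_algebra"
    using twist_bij by (intro ring_iso_memI) (simp_all add: twist_D twist_add twist_mult twist_one[OF D_one D_one])
  have f_iso: "f \<in> ring_iso G (O_S2 p q \<theta> k l)"
    using f(2) bij_betwE[OF f(2)] by (intro ring_iso_memI) (simp_all add: O_S2_carrier O_S2_sel)
  have O_S2_alg: "complex_algebra (O_S2 p q \<theta> k l)"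
    by (rule complex_algebra_restrict)
       (simp_all add: O_S2_carrier O_S2_sel fixed_carrier fixed_one fixed_add fixed_mult fixed_smult)
  have coeff: "gwa_coeff coeff_algebra twist center_elt d = mono_class [Coeff d]" for d
    by (simp add: gwa_coeff_def mono_class_def)
  show ?thesis
    unfolding is_degree_one_gwa_def
  proof (intro conjI exI[of _ coeff_algebra] exI[of _ twist] exI[of _ center_elt] exI[of _ f])
    show "\<forall>c. \<forall>d\<in>carrier coeff_algebra. f (gwa_coeff coeff_algebra twist center_elt (c \<odot>\<^bsub>coeff_algebra\<^esub> d)) =
        c \<odot>\<^bsub>O_S2 p q \<theta> k l\<^esub> f (gwa_coeff coeff_algebra twist center_elt d)"
      by (simp add: coeff f(3) D_smult O_S2_sel)
  qed (use O_S2_alg coeff_complex_algebra twist_iso f_iso center_elt_nonzero in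
       \<open>simp_all add: twist_smult[OF _ D_one] D_comm[OF center_elt_D]\<close>)
qed

end

theorem proposition2p6:
  fixes p q \<theta> :: real and k l :: int
  assumes "0 < p" "p < 1" "0 < q" "q < 1" "0 < \<theta>" "\<theta> < 1" "\<theta> \<notin> \<rat>"
    and "k > 0" "l \<noteq> 0" "coprime k l"
  shows "is_degree_one_gwa (O_S2 p q \<theta> k l)"
proof -
  interpret heegaard_action p q \<theta> "O_S3 p q \<theta>" k l
    using assms by unfold_locales auto
  show ?thesis by (rule O_S2_gwa)
qed

end
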